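(* Let $K$ be a field, let $A=\bigoplus_{i\ge 0}A_i$ be a connected graded $K$-algebra, and let $n\ge 0$. If $A$ is left-$FP_n$ or right-$FP_n$, then $A$ is bi-$FP_n$.
   Context: A graded $K$-algebra is a $K$-algebra $A=\bigoplus_{i\ge0}A_i$ (direct sum of $K$-subspaces) with $A_iA_j\subseteq A_{i+j}$; it is connected if $A_0$ has basis $\{1_A\}$. Its standard augmentation $\varepsilon:A\to K$ sends $1_A\mapsto 1_K$ and $A_i\mapsto 0$ for $i>0$. A module is of type $FP_n$ if there is an exact sequence $0\leftarrow M\leftarrow P_0\leftarrow\cdots\leftarrow P_n$ with $P_0,\dots,P_n$ finitely generated free modules (for graded modules it makes no difference whether the resolution is required to be graded or not). $A$ is left-$FP_n$ (resp. right-$FP_n$) if $K$, as a left (resp. right) $A$-module via $\varepsilon$, is of type $FP_n$. An $(A,A)$-bimodule is an abelian group with left and right $A$-actions satisfying $(am)b=a(mb)$ and $km=mk$ for $k\in K$; a free bimodule of rank $r$ is a direct sum of $r$ copies of $A\otimes_K A$ with action $a(u\otimes v)b=au\otimes vb$. $A$ is bi-$FP_n$ if $A$, as a bimodule by left and right multiplication, has an exact sequence $0\leftarrow A\leftarrow F_0\leftarrow\cdots\leftarrow F_n$ with $F_0,\dots,F_n$ finitely generated free $(A,A)$-bimodules. *)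

theory Defs
  imports Main
begin

text \<open>The algebra A is the whole type 'a (a ring with 1); the K-algebra structure is
  given by a ring homomorphism iota from the field 'k into the centre of A.
  The grading is a family Agr of subsets (A_i = Agr i).\<close>

definition K_algebra :: "('k::field \<Rightarrow> 'a::ring_1) \<Rightarrow> bool" where
  "K_algebra \<iota> \<longleftrightarrow> \<iota> 1 = 1 \<and> (\<forall>x y. \<iota> (x + y) = \<iota> x + \<iota> y) \<and>
     (\<forall>x y. \<iota> (x * y) = \<iota> x * \<iota> y) \<and> (\<forall>k a. \<iota> k * a = a * \<iota> k)"

definition K_subspace :: "('k::field \<Rightarrow> 'a::ring_1) \<Rightarrow> 'a set \<Rightarrow> bool" where
  "K_subspace \<iota> V \<longleftrightarrow> 0 \<in> V \<and> (\<forall>x\<in>V. \<forall>y\<in>V. x + y \<in> V) \<and> (\<forall>k. \<forall>x\<in>V. \<iota> k * x \<in> V)"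

definition graded_algebra :: "('k::field \<Rightarrow> 'a::ring_1) \<Rightarrow> (nat \<Rightarrow> 'a set) \<Rightarrow> bool" where
  "graded_algebra \<iota> Agr \<longleftrightarrow> K_algebra \<iota> \<and> (\<forall>i. K_subspace \<iota> (Agr i)) \<and>
     (\<forall>a. \<exists>!c. (\<forall>i. c i \<in> Agr i) \<and> finite {i. c i \<noteq> 0} \<and> a = (\<Sum>i\<in>{i. c i \<noteq> 0}. c i)) \<and>
     (\<forall>i j x y. x \<in> Agr i \<longrightarrow> y \<in> Agr j \<longrightarrow> x * y \<in> Agr (i + j))"

text \<open>Connected: A_0 has basis {1}, i.e. A_0 = K 1 (1 is nonzero since 'a is ring_1).\<close>
definition connected_graded_algebra :: "('k::field \<Rightarrow> 'a::ring_1) \<Rightarrow> (nat \<Rightarrow> 'a set) \<Rightarrow> bool" where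
  "connected_graded_algebra \<iota> Agr \<longleftrightarrow> graded_algebra \<iota> Agr \<and> Agr 0 = {\<iota> k * 1 | k. True}"

definition hcomp :: "(nat \<Rightarrow> 'a::ring_1 set) \<Rightarrow> 'a \<Rightarrow> nat \<Rightarrow> 'a" where
  "hcomp Agr a = (THE c. (\<forall>i. c i \<in> Agr i) \<and> finite {i. c i \<noteq> 0} \<and> a = (\<Sum>i\<in>{i. c i \<noteq> 0}. c i))"

definition aug :: "('k::field \<Rightarrow> 'a::ring_1) \<Rightarrow> (nat \<Rightarrow> 'a set) \<Rightarrow> 'a \<Rightarrow> 'k" where
  "aug \<iota> Agr a = (THE k. \<iota> k * 1 = hcomp Agr a 0)"

definition fvec :: "nat \<Rightarrow> (nat \<Rightarrow> 'a::ring_1) set" where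
  "fvec r = {v. \<forall>i\<ge>r. v i = 0}"

definition left_lin :: "nat \<Rightarrow> nat \<Rightarrow> ((nat \<Rightarrow> 'a::ring_1) \<Rightarrow> (nat \<Rightarrow> 'a)) \<Rightarrow> bool" where
  "left_lin r s f \<longleftrightarrow> (\<forall>v\<in>fvec r. f v \<in> fvec s) \<and>
     (\<forall>v\<in>fvec r. \<forall>w\<in>fvec r. f (\<lambda>i. v i + w i) = (\<lambda>i. f v i + f w i)) \<and>
     (\<forall>a. \<forall>v\<in>fvec r. f (\<lambda>i. a * v i) = (\<lambda>i. a * f v i))"

definition right_lin :: "nat \<Rightarrow> nat \<Rightarrow> ((nat \<Rightarrow> 'a::ring_1) \<Rightarrow> (nat \<Rightarrow> 'a)) \<Rightarrow> bool" where
  "right_lin r s f \<longleftrightarrow> (\<forall>v\<in>fvec r. f v \<in> fvec s) \<and>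
     (\<forall>v\<in>fvec r. \<forall>w\<in>fvec r. f (\<lambda>i. v i + w i) = (\<lambda>i. f v i + f w i)) \<and>
     (\<forall>a. \<forall>v\<in>fvec r. f (\<lambda>i. v i * a) = (\<lambda>i. f v i * a))"

definition left_FP :: "('k::field \<Rightarrow> 'a::ring_1) \<Rightarrow> (nat \<Rightarrow> 'a set) \<Rightarrow> nat \<Rightarrow> bool" where
  "left_FP \<iota> Agr n \<longleftrightarrow> (\<exists>(r::nat \<Rightarrow> nat) d (\<pi>::(nat \<Rightarrow> 'a) \<Rightarrow> 'k).
     (\<forall>v\<in>fvec (r 0). \<forall>w\<in>fvec (r 0). \<pi> (\<lambda>i. v i + w i) = \<pi> v + \<pi> w) \<and>
     (\<forall>a. \<forall>v\<in>fvec (r 0). \<pi> (\<lambda>i. a * v i) = aug \<iota> Agr a * \<pi> v) \<and>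
     \<pi> ` fvec (r 0) = UNIV \<and>
     (\<forall>i. 1 \<le> i \<and> i \<le> n \<longrightarrow> left_lin (r i) (r (i - 1)) (d i)) \<and>
     (1 \<le> n \<longrightarrow> d 1 ` fvec (r 1) = {v \<in> fvec (r 0). \<pi> v = 0}) \<and>
     (\<forall>i. 1 \<le> i \<and> i < n \<longrightarrow> d (i + 1) ` fvec (r (i + 1)) = {v \<in> fvec (r i). d i v = (\<lambda>_. 0)}))"

definition right_FP :: "('k::field \<Rightarrow> 'a::ring_1) \<Rightarrow> (nat \<Rightarrow> 'a set) \<Rightarrow> nat \<Rightarrow> bool" where
  "right_FP \<iota> Agr n \<longleftrightarrow> (\<exists>(r::nat \<Rightarrow> nat) d (\<pi>::(nat \<Rightarrow> 'a) \<Rightarrow> 'k).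
     (\<forall>v\<in>fvec (r 0). \<forall>w\<in>fvec (r 0). \<pi> (\<lambda>i. v i + w i) = \<pi> v + \<pi> w) \<and>
     (\<forall>a. \<forall>v\<in>fvec (r 0). \<pi> (\<lambda>i. v i * a) = \<pi> v * aug \<iota> Agr a) \<and>
     \<pi> ` fvec (r 0) = UNIV \<and>
     (\<forall>i. 1 \<le> i \<and> i \<le> n \<longrightarrow> right_lin (r i) (r (i - 1)) (d i)) \<and>
     (1 \<le> n \<longrightarrow> d 1 ` fvec (r 1) = {v \<in> fvec (r 0). \<pi> v = 0}) \<and>
     (\<forall>i. 1 \<le> i \<and> i < n \<longrightarrow> d (i + 1) ` fvec (r (i + 1)) = {v \<in> fvec (r i). d i v = (\<lambda>_. 0)}))"

text \<open>Free K-vector space on A \<times> A: finitely supported functions.\<close>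
definition fsupp :: "('b \<Rightarrow> 'k::zero) \<Rightarrow> bool" where
  "fsupp f \<longleftrightarrow> finite {p. f p \<noteq> 0}"

definition pt :: "'a \<Rightarrow> 'a \<Rightarrow> ('a \<times> 'a \<Rightarrow> 'k::field)" where
  "pt a b = (\<lambda>p. if p = (a, b) then 1 else 0)"

definition tens_gens :: "('k::field \<Rightarrow> 'a::ring_1) \<Rightarrow> ('a \<times> 'a \<Rightarrow> 'k) set" where
  "tens_gens \<iota> =
     {(\<lambda>p. pt (a + a') b p - pt a b p - pt a' b p) | a a' b. True} \<union>
     {(\<lambda>p. pt a (b + b') p - pt a b p - pt a b' p) | a b b'. True} \<union>
     {(\<lambda>p. pt (\<iota> k * a) b p - k * pt a b p) | k a b. True} \<union>
     {(\<lambda>p. pt a (\<iota> k * b) p - k * pt a b p) | k a b. True}"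

inductive_set tens_rel :: "('k::field \<Rightarrow> 'a::ring_1) \<Rightarrow> ('a \<times> 'a \<Rightarrow> 'k) set"
  for \<iota> :: "'k::field \<Rightarrow> 'a::ring_1" where
  tr_zero: "(\<lambda>_. 0) \<in> tens_rel \<iota>"
| tr_gen: "g \<in> tens_gens \<iota> \<Longrightarrow> g \<in> tens_rel \<iota>"
| tr_add: "x \<in> tens_rel \<iota> \<Longrightarrow> y \<in> tens_rel \<iota> \<Longrightarrow> (\<lambda>p. x p + y p) \<in> tens_rel \<iota>"
| tr_smult: "x \<in> tens_rel \<iota> \<Longrightarrow> (\<lambda>p. k * x p) \<in> tens_rel \<iota>"

definition push :: "('b \<Rightarrow> 'c) \<Rightarrow> ('b \<Rightarrow> 'k::field) \<Rightarrow> ('c \<Rightarrow> 'k)" where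
  "push g f = (\<lambda>q. \<Sum>p\<in>{p. g p = q \<and> f p \<noteq> 0}. f p)"

text \<open>Elements of the free bimodule (A \<otimes>_K A)^r are represented by r-tuples of
  representatives; two representatives are identified (\<approx>) iff they differ componentwise
  by an element of tens_rel.\<close>
definition fbvec :: "nat \<Rightarrow> (nat \<Rightarrow> ('a \<times> 'a \<Rightarrow> 'k::field)) set" where
  "fbvec r = {X. (\<forall>i. fsupp (X i)) \<and> (\<forall>i\<ge>r. X i = (\<lambda>_. 0))}"

definition tequiv :: "('k::field \<Rightarrow> 'a::ring_1) \<Rightarrow> (nat \<Rightarrow> ('a \<times> 'a \<Rightarrow> 'k)) \<Rightarrow> (nat \<Rightarrow> ('a \<times> 'a \<Rightarrow> 'k)) \<Rightarrow> bool" where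
  "tequiv \<iota> X Y \<longleftrightarrow> (\<forall>i. (\<lambda>p. X i p - Y i p) \<in> tens_rel \<iota>)"

definition fbadd :: "(nat \<Rightarrow> ('a \<times> 'a \<Rightarrow> 'k::field)) \<Rightarrow> (nat \<Rightarrow> ('a \<times> 'a \<Rightarrow> 'k)) \<Rightarrow> (nat \<Rightarrow> ('a \<times> 'a \<Rightarrow> 'k))" where
  "fbadd X Y = (\<lambda>i p. X i p + Y i p)"

definition fblact :: "'a::ring_1 \<Rightarrow> (nat \<Rightarrow> ('a \<times> 'a \<Rightarrow> 'k::field)) \<Rightarrow> (nat \<Rightarrow> ('a \<times> 'a \<Rightarrow> 'k))" where
  "fblact a X = (\<lambda>i. push (\<lambda>(u, v). (a * u, v)) (X i))"

definition fbract :: "(nat \<Rightarrow> ('a::ring_1 \<times> 'a \<Rightarrow> 'k::field)) \<Rightarrow> 'a \<Rightarrow> (nat \<Rightarrow> ('a \<times> 'a \<Rightarrow> 'k))" where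
  "fbract X b = (\<lambda>i. push (\<lambda>(u, v). (u, v * b)) (X i))"

definition bimod_hom :: "('k::field \<Rightarrow> 'a::ring_1) \<Rightarrow> nat \<Rightarrow> nat \<Rightarrow>
    ((nat \<Rightarrow> ('a \<times> 'a \<Rightarrow> 'k)) \<Rightarrow> (nat \<Rightarrow> ('a \<times> 'a \<Rightarrow> 'k))) \<Rightarrow> bool" where
  "bimod_hom \<iota> r s f \<longleftrightarrow> (\<forall>X\<in>fbvec r. f X \<in> fbvec s) \<and>
     (\<forall>X\<in>fbvec r. \<forall>Y\<in>fbvec r. tequiv \<iota> X Y \<longrightarrow> tequiv \<iota> (f X) (f Y)) \<and>
     (\<forall>X\<in>fbvec r. \<forall>Y\<in>fbvec r. tequiv \<iota> (f (fbadd X Y)) (fbadd (f X) (f Y))) \<and>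
     (\<forall>a. \<forall>X\<in>fbvec r. tequiv \<iota> (f (fblact a X)) (fblact a (f X))) \<and>
     (\<forall>b. \<forall>X\<in>fbvec r. tequiv \<iota> (f (fbract X b)) (fbract (f X) b))"

definition bi_FP :: "('k::field \<Rightarrow> 'a::ring_1) \<Rightarrow> nat \<Rightarrow> bool" where
  "bi_FP \<iota> n \<longleftrightarrow> (\<exists>(r::nat \<Rightarrow> nat) d (\<pi>::(nat \<Rightarrow> ('a \<times> 'a \<Rightarrow> 'k)) \<Rightarrow> 'a).
     (\<forall>X\<in>fbvec (r 0). \<forall>Y\<in>fbvec (r 0). tequiv \<iota> X Y \<longrightarrow> \<pi> X = \<pi> Y) \<and>
     (\<forall>X\<in>fbvec (r 0). \<forall>Y\<in>fbvec (r 0). \<pi> (fbadd X Y) = \<pi> X + \<pi> Y) \<and>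
     (\<forall>a. \<forall>X\<in>fbvec (r 0). \<pi> (fblact a X) = a * \<pi> X) \<and>
     (\<forall>b. \<forall>X\<in>fbvec (r 0). \<pi> (fbract X b) = \<pi> X * b) \<and>
     \<pi> ` fbvec (r 0) = UNIV \<and>
     (\<forall>i. 1 \<le> i \<and> i \<le> n \<longrightarrow> bimod_hom \<iota> (r i) (r (i - 1)) (d i)) \<and>
     (1 \<le> n \<longrightarrow> (\<forall>X\<in>fbvec (r 0). \<pi> X = 0 \<longleftrightarrow> (\<exists>Y\<in>fbvec (r 1). tequiv \<iota> (d 1 Y) X))) \<and>
     (\<forall>i. 1 \<le> i \<and> i < n \<longrightarrow> (\<forall>X\<in>fbvec (r i).
        tequiv \<iota> (d i X) (\<lambda>_ _. 0) \<longleftrightarrow> (\<exists>Y\<in>fbvec (r (i + 1)). tequiv \<iota> (d (i + 1) Y) X))))"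

end

theory Submission
  imports Defs "HOL.Vector_Spaces" "HOL-Library.Function_Algebras"
begin

text \<open>
  Let \<open>P\<close> be the given resolution of \<open>K\<close> by finitely generated free left modules. One constructs
  finitely generated free graded bimodules \<open>F\<^sub>0 = A \<otimes> A, F\<^sub>1, \<dots>\<close> one after the other. Suppose
  \<open>F\<^sub>i\<close> is reached and let \<open>Z\<close> be the kernel of its differential. As right modules everything
  splits, so \<open>Z\<close> is a right direct summand of \<open>F\<^sub>i\<close>, and applying \<open>- \<otimes>\<^sub>A K\<close> turns \<open>Z\<close> into the
  corresponding kernel of a resolution of \<open>K\<close> by free left modules. Comparing that resolution with
  \<open>P\<close> by chain maps \<open>f\<close>, \<open>g\<close> and a homotopy \<open>h\<close>, every \<open>q\<close> in this kernel is
  \<open>f (g q) + (1 - f g - h d) q\<close>, where \<open>g q\<close> is a boundary in \<open>P\<close>, so the kernel is finitely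
  generated. By a graded Nakayama argument the homogeneous components of lifts of its generators
  generate the bimodule \<open>Z\<close>, which yields \<open>F\<^sub>i\<^sub>+\<^sub>1\<close>.

  Elements of \<open>A \<otimes> A\<close> are not formed as a quotient: all maps are linear maps on formal
  combinations of pairs, and identities hold up to the subspace \<open>Rel\<close> of bilinearity relations.
\<close>

section \<open>Linear maps and subspaces\<close>

text \<open>Reduction by \<open>- \<otimes>_A K\<close> is not exact in general; a right linear
  splitting carried along at every stage makes it harmless. \<open>A\<close> is free as a right
  module, so \<open>F_0 -> A\<close> splits; the kernel is then a right summand of a free right
  module, hence the next surjection onto it splits as well. The splitting does a second job: an
  element of \<open>Z\<close> with reduction zero a priori only lies in \<open>F A_+\<close>, and
  applying the projector rewrites it as an element of \<open>Z A_+\<close>, as Nakayama requires.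

  The resolution \<open>P\<close> need be neither graded nor minimal. Finite generation is therefore
  carried over by an ungraded comparison, and the grading re-enters only when the lifted generators
  are cut into homogeneous components. Nakayama then works by induction on the degree: right
  multiplication by \<open>A_+\<close> raises it, and degrees are bounded below. Connectedness
  enters through \<open>A / A_+ = K\<close>. Stage \<open>i\<close> consumes the surjection of
  \<open>P_(i+1)\<close> onto the kernel in \<open>P_i\<close>, so \<open>P_0, ..., P_n\<close>
  yield exactly \<open>F_0, ..., F_n\<close>.\<close>

abbreviation lin where "lin \<equiv> Vector_Spaces.linear"
abbreviation subsp where "subsp \<equiv> module.subspace"

lemma lin_vector_space2: "lin s1 s2 f \<Longrightarrow> vector_space s2"
  and lin_add: "lin s1 s2 f \<Longrightarrow> f (x + y) = f x + f y"
  and lin_scale: "lin s1 s2 f \<Longrightarrow> f (s1 k x) = s2 k (f x)"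
  by (simp_all add: linear_iff)

lemma linI:
  assumes "vector_space s1" "vector_space s2" "\<And>x y. f (x + y) = f x + f y" "\<And>k x. f (s1 k x) = s2 k (f x)"
  shows "lin s1 s2 f"
  using assms by (simp add: linear_iff)

lemma lin_module_hom: "lin s1 s2 f \<Longrightarrow> module_hom s1 s2 f"
  by (simp add: linear_iff_module_hom)

lemma lin_zero: "lin s1 s2 f \<Longrightarrow> f 0 = 0"
  using module_hom.zero[OF lin_module_hom] .

lemma lin_diff: "lin s1 s2 f \<Longrightarrow> f (x - y) = f x - f y"
  using module_hom.diff[OF lin_module_hom] .

lemma lin_sum: "lin s1 s2 f \<Longrightarrow> f (sum g S) = (\<Sum>i\<in>S. f (g i))"
  using module_hom.sum[OF lin_module_hom] .

lemma lin_comp: "lin s1 s2 f \<Longrightarrow> lin s2 s3 g \<Longrightarrow> lin s1 s3 (\<lambda>x. g (f x))"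
  by (simp add: linear_iff)

lemma lin_minus_lin:
  assumes "lin s1 s2 f" "lin s1 s2 g"
  shows "lin s1 s2 (\<lambda>x. f x - g x)"
proof -
  have "module s2"
    using assms(1) by (simp add: linear_iff module_iff_vector_space)
  then show ?thesis
    using assms by (simp add: linear_iff module.scale_right_diff_distrib)
qed

lemma lin_ident: "vector_space s \<Longrightarrow> lin s s (\<lambda>x. x)"
  by (simp add: linear_iff)

lemma vector_space_module: "vector_space s \<Longrightarrow> module s"
  by (simp add: module_iff_vector_space)

lemma lin_plus_lin:
  assumes "lin s1 s2 f" "lin s1 s2 g"
  shows "lin s1 s2 (\<lambda>x. f x + g x)"
  using assms module.scale_right_distrib[OF vector_space_module[OF lin_vector_space2[OF assms(1)]]]
  by (simp add: linear_iff)

lemma subsp_vimage: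
  assumes "lin s1 s2 f" "subsp s2 N"
  shows "subsp s1 {x. f x \<in> N}"
  using module_hom.subspace_vimage[OF lin_module_hom[OF assms(1)] assms(2)]
  by (simp add: vimage_def)

lemma subsp_zero: "vector_space s \<Longrightarrow> subsp s {0}"
  by (simp add: module.subspace_single_0 vector_space_module)

lemma sum_fun_apply: "(\<Sum>i\<in>S. f i) x = (\<Sum>i\<in>S. f i x)"
  by (induction S rule: infinite_finite_induct) auto

section \<open>Formal combinations and maps that are linear modulo a subspace\<close>

lemma push_add:
  assumes "fsupp X" "fsupp Y"
  shows "push g (X + Y) = push g X + push g Y"
proof
  fix q
  let ?S = "{p. g p = q \<and> (X p \<noteq> 0 \<or> Y p \<noteq> 0)}"
  have fin: "finite ?S"
    by (rule finite_subset[OF _ finite_UnI[OF assms[unfolded fsupp_def]]]) auto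
  have *: "push g Z q = (\<Sum>p\<in>?S. Z p)" if "\<And>p. X p = 0 \<Longrightarrow> Y p = 0 \<Longrightarrow> Z p = 0" for Z
    unfolding push_def using that by (intro sum.mono_neutral_left fin) auto
  show "push g (X + Y) q = (push g X + push g Y) q"
    by (simp add: * sum.distrib)
qed

lemma push_scale: "push g (\<lambda>p. k * X p) = (\<lambda>q. k * push g X q)" for k :: "'k::field"
  by (cases "k = 0") (auto simp: push_def sum_distrib_left)

lemma push_point: "push g (\<lambda>p. if p = p0 then 1 else 0) = (\<lambda>q. if q = g p0 then (1::'k::field) else 0)"
proof
  fix q
  have "{p. g p = q \<and> (if p = p0 then (1::'k) else 0) \<noteq> 0} = (if q = g p0 then {p0} else {})"
    by auto
  then show "push g (\<lambda>p. if p = p0 then 1 else 0) q = (if q = g p0 then (1::'k) else 0)"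
    by (simp add: push_def)
qed

definition sR :: "'k::field \<Rightarrow> (nat \<Rightarrow> 'b \<Rightarrow> 'k) \<Rightarrow> (nat \<Rightarrow> 'b \<Rightarrow> 'k)" where
  "sR k X = (\<lambda>i p. k * X i p)"

lemma sR_apply [simp]: "sR k X i p = k * X i p"
  by (simp add: sR_def)

lemma vsR: "vector_space sR"
  by unfold_locales (auto simp: fun_eq_iff algebra_simps)

interpretation VR: vector_space sR
  by (rule vsR)

text \<open>The basic example is \<open>u \<mapsto> u \<otimes> v\<close>, which on formal
  combinations is linear only up to the relations. The preimage of \<open>N\<close> is still a
  subspace, and that is what induction over a spanning set needs.\<close>

definition modlin :: "('k \<Rightarrow> 'b \<Rightarrow> 'b) \<Rightarrow> ('c::ab_group_add) set \<Rightarrow> ('k::field \<Rightarrow> 'c \<Rightarrow> 'c) \<Rightarrow> ('b::ab_group_add \<Rightarrow> 'c) \<Rightarrow> bool" where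
  "modlin s1 N s2 f \<longleftrightarrow> vector_space s1 \<and> vector_space s2 \<and> subsp s2 N \<and>
     (\<forall>x y. f (x + y) - (f x + f y) \<in> N) \<and> (\<forall>k x. f (s1 k x) - s2 k (f x) \<in> N)"

lemma subsp_0: "vector_space s \<Longrightarrow> subsp s N \<Longrightarrow> 0 \<in> N"
  and subsp_add: "vector_space s \<Longrightarrow> subsp s N \<Longrightarrow> x \<in> N \<Longrightarrow> y \<in> N \<Longrightarrow> x + y \<in> N"
  and subsp_diff: "vector_space s \<Longrightarrow> subsp s N \<Longrightarrow> x \<in> N \<Longrightarrow> y \<in> N \<Longrightarrow> x - y \<in> N"
  and subsp_scale: "vector_space s \<Longrightarrow> subsp s N \<Longrightarrow> x \<in> N \<Longrightarrow> s k x \<in> N"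
  and subsp_sum: "vector_space s \<Longrightarrow> subsp s N \<Longrightarrow> (\<And>i. i \<in> I \<Longrightarrow> g i \<in> N) \<Longrightarrow> sum g I \<in> N"
  using module.subspace_0[of s N] module.subspace_add[of s N] module.subspace_diff[of s N]
    module.subspace_scale[of s N] module.subspace_sum[of s N I g] vector_space_module[of s]
  by auto

lemma subspI:
  assumes "vector_space s" "0 \<in> N" "\<And>x y. x \<in> N \<Longrightarrow> y \<in> N \<Longrightarrow> x + y \<in> N" "\<And>k x. x \<in> N \<Longrightarrow> s k x \<in> N"
  shows "subsp s N"
  using assms by (auto intro!: module.subspaceI vector_space_module)

lemma modlinI:
  assumes "vector_space s1" "vector_space s2" "subsp s2 N"
    "\<And>x y. f (x + y) - (f x + f y) \<in> N" "\<And>k x. f (s1 k x) - s2 k (f x) \<in> N"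
  shows "modlin s1 N s2 f"
  using assms by (simp add: modlin_def)

lemma modlin_zero:
  assumes "modlin s1 N s2 f"
  shows "f 0 \<in> N"
proof -
  have "f (0 + 0) - (f 0 + f 0) \<in> N" and s: "vector_space s2" "subsp s2 N"
    using assms by (simp_all add: modlin_def del: add_0_left add_0_right)
  then have "- f 0 \<in> N" by simp
  from subsp_diff[OF s subsp_0[OF s] this] show ?thesis by simp
qed

lemma modlin_subsp:
  assumes "modlin s1 N s2 f"
  shows "subsp s1 {x. f x \<in> N}"
proof (rule subspI)
  have s: "vector_space s2" "subsp s2 N"
    and a: "f (x + y) - (f x + f y) \<in> N" and m: "f (s1 k x) - s2 k (f x) \<in> N" for x y k
    using assms by (simp_all add: modlin_def)
  show "vector_space s1"
    using assms by (simp add: modlin_def)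
  show "0 \<in> {x. f x \<in> N}"
    using modlin_zero[OF assms] by simp
  show "x + y \<in> {x. f x \<in> N}" if "x \<in> {x. f x \<in> N}" "y \<in> {x. f x \<in> N}" for x y
    using subsp_add[OF s a[of x y] subsp_add[OF s, of "f x" "f y"]] that by simp
  show "s1 k x \<in> {x. f x \<in> N}" if "x \<in> {x. f x \<in> N}" for x k
    using subsp_add[OF s m[of k x] subsp_scale[OF s, of "f x" k]] that by simp
qed

lemma lin_modlin: "lin s1 s2 f \<Longrightarrow> subsp s2 N \<Longrightarrow> modlin s1 N s2 f"
  using subsp_0[of s2 N] by (simp add: modlin_def linear_iff)

lemma modlin_mono: "modlin s1 N s2 f \<Longrightarrow> subsp s2 N' \<Longrightarrow> N \<subseteq> N' \<Longrightarrow> modlin s1 N' s2 f"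
  by (auto simp: modlin_def)

lemma modlin_precomp:
  "lin s1 s2 f \<Longrightarrow> modlin s2 N s3 g \<Longrightarrow> modlin s1 N s3 (\<lambda>x. g (f x))"
  by (simp add: modlin_def linear_iff)

lemma modlin_postcomp:
  assumes f: "modlin s1 N s2 f" and g: "lin s2 s3 g" and N': "subsp s3 N'" "\<And>x. x \<in> N \<Longrightarrow> g x \<in> N'"
  shows "modlin s1 N' s3 (\<lambda>x. g (f x))"
proof (rule modlinI)
  show "g (f (x + y)) - (g (f x) + g (f y)) \<in> N'" for x y
    unfolding lin_add[OF g, symmetric] lin_diff[OF g, symmetric]
    using f by (intro N') (simp add: modlin_def)
  show "g (f (s1 k x)) - s3 k (g (f x)) \<in> N'" for k x
    unfolding lin_scale[OF g, symmetric] lin_diff[OF g, symmetric]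
    using f by (intro N') (simp add: modlin_def)
qed (use f g N' in \<open>simp_all add: modlin_def linear_iff\<close>)

lemma modlin_sum:
  assumes s: "vector_space s1" "vector_space s2" "subsp s2 N" and f: "\<And>i. i \<in> I \<Longrightarrow> modlin s1 N s2 (f i)"
  shows "modlin s1 N s2 (\<lambda>x. \<Sum>i\<in>I. f i x)"
proof (rule modlinI[OF s])
  show "(\<Sum>i\<in>I. f i (x + y)) - ((\<Sum>i\<in>I. f i x) + (\<Sum>i\<in>I. f i y)) \<in> N" for x y
    unfolding sum.distrib[symmetric] sum_subtractf[symmetric]
    using f by (intro subsp_sum[OF s(2,3)]) (simp add: modlin_def)
  show "(\<Sum>i\<in>I. f i (s1 k x)) - s2 k (\<Sum>i\<in>I. f i x) \<in> N" for k x
    unfolding module.scale_sum_right[OF vector_space_module[OF s(2)]] sum_subtractf[symmetric]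
    using f by (intro subsp_sum[OF s(2,3)]) (simp add: modlin_def)
qed

lemma modlin_diff:
  assumes "modlin s1 N s2 f" "modlin s1 N s2 g"
  shows "modlin s1 N s2 (\<lambda>x. f x - g x)"
proof (rule modlinI)
  have s: "vector_space s2" "subsp s2 N"
    using assms(1) by (simp_all add: modlin_def)
  show "f (x + y) - g (x + y) - (f x - g x + (f y - g y)) \<in> N" for x y
  proof -
    have "(f (x + y) - (f x + f y)) - (g (x + y) - (g x + g y)) \<in> N"
      using assms by (intro subsp_diff[OF s, of "_ - _" "_ - _"]) (simp_all only: modlin_def)
    then show ?thesis
      by (simp add: algebra_simps)
  qed
  show "f (s1 k x) - g (s1 k x) - s2 k (f x - g x) \<in> N" for k x
  proof -
    have "(f (s1 k x) - s2 k (f x)) - (g (s1 k x) - s2 k (g x)) \<in> N"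
      using assms by (intro subsp_diff[OF s, of "_ - _" "_ - _"]) (simp_all only: modlin_def)
    then show ?thesis
      by (simp add: algebra_simps module.scale_right_diff_distrib[OF vector_space_module[OF s(1)]])
  qed
qed (use assms in \<open>simp_all add: modlin_def\<close>)

lemma modlin_const_0: "vector_space s1 \<Longrightarrow> vector_space s2 \<Longrightarrow> subsp s2 N \<Longrightarrow> modlin s1 N s2 (\<lambda>x. 0)"
  using modlin_sum[of s1 s2 N "{}" "\<lambda>_ _. 0"] by simp

section \<open>Tuples of finitely supported combinations\<close>

lemma subsp_fbvec: "subsp sR (fbvec r)"
proof (rule subspI[OF vsR])
  show "X + Y \<in> fbvec r" if "X \<in> fbvec r" "Y \<in> fbvec r" for X Y
  proof -
    have "finite {p. (X + Y) i p \<noteq> 0}" for i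
    proof (rule finite_subset)
      show "{p. (X + Y) i p \<noteq> 0} \<subseteq> {p. X i p \<noteq> 0} \<union> {p. Y i p \<noteq> 0}"
        by auto
      show "finite ({p. X i p \<noteq> 0} \<union> {p. Y i p \<noteq> 0})"
        using that by (simp add: fbvec_def fsupp_def)
    qed
    then show ?thesis
      using that by (simp add: fbvec_def fsupp_def fun_eq_iff)
  qed
  show "sR k X \<in> fbvec r" if "X \<in> fbvec r" for k X
    using that by (simp add: fbvec_def fsupp_def fun_eq_iff)
qed (simp add: fbvec_def fsupp_def fun_eq_iff)

lemmas fbvec_0 = subsp_0[OF vsR subsp_fbvec]
  and fbvec_add = subsp_add[OF vsR subsp_fbvec]
  and fbvec_diff = subsp_diff[OF vsR subsp_fbvec]
  and fbvec_scale = subsp_scale[OF vsR subsp_fbvec]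
  and fbvec_sum = subsp_sum[OF vsR subsp_fbvec]

lemma fbvec_mono: "r \<le> s \<Longrightarrow> X \<in> fbvec r \<Longrightarrow> X \<in> fbvec s"
  by (auto simp: fbvec_def)

definition Fin :: "(nat \<Rightarrow> 'a \<times> 'a \<Rightarrow> 'k::field) set" where
  "Fin = (\<Union>r. fbvec r)"

lemma fbvec_Fin: "X \<in> fbvec r \<Longrightarrow> X \<in> Fin"
  by (auto simp: Fin_def)

lemma subsp_Fin: "subsp sR Fin"
proof (rule subspI[OF vsR])
  show "X + Y \<in> Fin" if "X \<in> Fin" "Y \<in> Fin" for X Y
  proof -
    obtain r s where "X \<in> fbvec r" "Y \<in> fbvec s"
      using \<open>X \<in> Fin\<close> \<open>Y \<in> Fin\<close> by (auto simp: Fin_def)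
    then have "X \<in> fbvec (max r s)" "Y \<in> fbvec (max r s)"
      using fbvec_mono max.cobounded1 max.cobounded2 by blast+
    then show ?thesis
      using fbvec_add fbvec_Fin by blast
  qed
  show "sR k X \<in> Fin" if "X \<in> Fin" for k X
    using that fbvec_scale unfolding Fin_def by blast
qed (use fbvec_0 in \<open>auto simp: Fin_def\<close>)

definition unitvec :: "nat \<Rightarrow> 'b \<Rightarrow> nat \<Rightarrow> 'b \<Rightarrow> 'k::field" where
  "unitvec j p = (\<lambda>i q. if i = j \<and> q = p then 1 else 0)"

lemma fbvec_expand:
  assumes "X \<in> fbvec r"
  shows "X = (\<Sum>j<r. \<Sum>p\<in>{p. X j p \<noteq> 0}. sR (X j p) (unitvec j p))"
proof (intro ext)
  fix i q
  have fin: "finite {p. X j p \<noteq> 0}" for j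
    using assms by (simp add: fbvec_def fsupp_def)
  have "(\<Sum>p\<in>{p. X j p \<noteq> 0}. sR (X j p) (unitvec j p)) i q = (if i = j then X i q else 0)" for j
  proof (cases "i = j")
    case True
    have "(\<Sum>p\<in>{p. X j p \<noteq> 0}. sR (X j p) (unitvec j p)) i q
        = (\<Sum>p\<in>{p. X j p \<noteq> 0}. if q = p then X j p else 0)"
      unfolding sum_fun_apply by (intro sum.cong) (auto simp: unitvec_def True)
    also have "\<dots> = X i q"
      using fin by (simp add: True)
    finally show ?thesis using True by simp
  qed (simp add: sum_fun_apply unitvec_def)
  then have "(\<Sum>j<r. \<Sum>p\<in>{p. X j p \<noteq> 0}. sR (X j p) (unitvec j p)) i q = (\<Sum>j<r. if i = j then X i q else 0)"
    by (simp only: sum_fun_apply)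
  also have "\<dots> = X i q"
    using assms by (auto simp: fbvec_def)
  finally show "X i q = (\<Sum>j<r. \<Sum>p\<in>{p. X j p \<noteq> 0}. sR (X j p) (unitvec j p)) i q" ..
qed

text \<open>Evaluating a dependence at \<open>(j, p)\<close> leaves only the coefficient of
  \<open>unitvec j p\<close>. Independence is what allows linear maps to be prescribed freely on
  symbols.\<close>

lemma independent_unitvec: "VR.independent (range (\<lambda>(j, p). unitvec j p))"
  unfolding VR.independent_explicit_finite_subsets
proof (intro allI impI ballI)
  fix S c v
  assume S: "S \<subseteq> range (\<lambda>(j, p). unitvec j p :: nat \<Rightarrow> 'b \<Rightarrow> 'k::field)" "finite S"
    and eq: "(\<Sum>v\<in>S. sR (c v) v) = 0" and v: "v \<in> S"
  obtain j p where jp: "v = unitvec j p"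
    using S v by auto
  have "c x * x j p = (if x = v then c x else 0)" if "x \<in> S" for x
  proof -
    obtain j' p' where "x = unitvec j' p'"
      using S \<open>x \<in> S\<close> by auto
    moreover have "(unitvec j' p' :: nat \<Rightarrow> 'b \<Rightarrow> 'k) = unitvec j p \<longleftrightarrow> j' = j \<and> p' = p"
      by (metis (mono_tags, lifting) unitvec_def zero_neq_one)
    ultimately show ?thesis
      by (auto simp: jp unitvec_def)
  qed
  then have "(\<Sum>x\<in>S. c x * x j p) = (\<Sum>x\<in>S. if x = v then c x else 0)"
    by (intro sum.cong refl)
  moreover have "(\<Sum>x\<in>S. c x * x j p) = 0"
    using fun_cong[OF fun_cong[OF eq, of j], of p] by (simp add: sum_fun_apply)
  ultimately show "c v = 0"
    using S v by simp
qed

lemma sum_lessThan_plus: "(\<Sum>k<m + n. F k) = (\<Sum>k<m. F k) + (\<Sum>k<n. F (m + k))"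
  for F :: "nat \<Rightarrow> 'b::comm_monoid_add"
  by (induction n) (simp_all add: add.assoc)

section \<open>Connected graded algebras\<close>

text \<open>Taking for \<open>\<cdot>\<close> either the multiplication or its opposite, with the two tensor factors
  exchanged in the latter case, handles left and right modules at the same time.\<close>

locale conn_alg =
  fixes \<iota> :: "'k::field \<Rightarrow> 'a::ring_1" and Agr :: "nat \<Rightarrow> 'a set"
    and mul :: "'a \<Rightarrow> 'a \<Rightarrow> 'a" (infixl "\<cdot>" 70) and T :: "'a \<Rightarrow> 'a \<Rightarrow> 'a \<times> 'a"
  assumes conn: "connected_graded_algebra \<iota> Agr"
    and side: "(mul = (*) \<and> T = Pair) \<or> (mul = (\<lambda>x y. y * x) \<and> T = (\<lambda>u v. (v, u)))"
begin

lemma mul_assoc: "a \<cdot> b \<cdot> c = a \<cdot> (b \<cdot> c)"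
  and mul_add_left: "(a + b) \<cdot> c = a \<cdot> c + b \<cdot> c"
  and mul_add_right: "c \<cdot> (a + b) = c \<cdot> a + c \<cdot> b"
  and mul_diff_right: "c \<cdot> (a - b) = c \<cdot> a - c \<cdot> b"
  and mul_1_left [simp]: "1 \<cdot> a = a"
  and mul_1_right [simp]: "a \<cdot> 1 = a"
  and mul_0_left [simp]: "0 \<cdot> a = 0"
  and mul_0_right [simp]: "a \<cdot> 0 = 0"
  and mul_sum_right: "a \<cdot> sum f S = (\<Sum>i\<in>S. a \<cdot> f i)"
  using side by (auto simp: algebra_simps sum_distrib_left sum_distrib_right)

lemma graded: "graded_algebra \<iota> Agr" and Agr_0: "Agr 0 = {\<iota> k * 1 | k. True}"
  using conn by (auto simp: connected_graded_algebra_def)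

lemma K_alg: "K_algebra \<iota>"
  using graded by (simp add: graded_algebra_def)

lemma iota_1 [simp]: "\<iota> 1 = 1"
  and iota_add: "\<iota> (x + y) = \<iota> x + \<iota> y"
  and iota_central: "\<iota> x * a = a * \<iota> x"
  using K_alg by (auto simp: K_algebra_def)

lemma iota_mul: "\<iota> (x * y) = \<iota> x \<cdot> \<iota> y"
proof -
  have "\<iota> (x * y) = \<iota> x * \<iota> y"
    using K_alg unfolding K_algebra_def by blast
  then show ?thesis
    using side iota_central[of x "\<iota> y"] by (elim disjE) simp_all
qed

lemma iota_comm: "a \<cdot> \<iota> x = \<iota> x \<cdot> a"
  using side iota_central[of x a] by (elim disjE) simp_all

lemma iota_times: "\<iota> x * a = \<iota> x \<cdot> a"
  using side iota_central[of x a] by (elim disjE) simp_all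

lemma iota_0 [simp]: "\<iota> 0 = 0"
  using iota_add[of 0 0] by simp

lemma iota_diff: "\<iota> (x - y) = \<iota> x - \<iota> y"
  using iota_add[of "x - y" y] by (simp add: algebra_simps)

lemma iota_eq_0: "\<iota> x = 0 \<Longrightarrow> x = 0"
  using iota_mul[of x "inverse x"] by (cases "x = 0") auto

lemma iota_inj: "\<iota> x = \<iota> y \<Longrightarrow> x = y"
  using iota_diff[of x y] iota_eq_0[of "x - y"] by simp

definition sA :: "'k \<Rightarrow> 'a \<Rightarrow> 'a" where "sA k a = \<iota> k \<cdot> a"
definition sQ :: "'k \<Rightarrow> (nat \<Rightarrow> 'a) \<Rightarrow> (nat \<Rightarrow> 'a)" where "sQ k q = (\<lambda>i. \<iota> k \<cdot> q i)"

lemma vsA: "vector_space sA"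
  by unfold_locales (auto simp: sA_def mul_add_left mul_add_right iota_add iota_mul mul_assoc)

lemma vsQ: "vector_space sQ"
  by unfold_locales
    (auto simp: sQ_def mul_add_left mul_add_right iota_add iota_mul mul_assoc fun_eq_iff)

lemma sA_mul_left: "sA k a \<cdot> b = sA k (a \<cdot> b)"
  by (simp add: sA_def mul_assoc)

lemma sA_mul_right: "a \<cdot> sA k b = sA k (a \<cdot> b)"
  unfolding sA_def by (metis mul_assoc iota_comm)

lemma Agr_0_mem: "0 \<in> Agr i"
  and Agr_add: "x \<in> Agr i \<Longrightarrow> y \<in> Agr i \<Longrightarrow> x + y \<in> Agr i"
  and Agr_sA: "x \<in> Agr i \<Longrightarrow> sA k x \<in> Agr i"
  using graded by (simp_all add: graded_algebra_def K_subspace_def sA_def iota_times[symmetric])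

lemma Agr_mul:
  assumes "x \<in> Agr i" "y \<in> Agr j"
  shows "x \<cdot> y \<in> Agr (i + j)"
proof -
  have "x * y \<in> Agr (i + j)" "y * x \<in> Agr (j + i)"
    using graded assms by (simp_all add: graded_algebra_def)
  then show ?thesis
    using side by (elim disjE) (simp_all add: add.commute)
qed

section \<open>Homogeneous components and the augmentation\<close>

lemma hcomp_P: "(\<forall>i. hcomp Agr a i \<in> Agr i) \<and> finite {i. hcomp Agr a i \<noteq> 0} \<and>
    a = (\<Sum>i\<in>{i. hcomp Agr a i \<noteq> 0}. hcomp Agr a i)"
proof -
  have "\<exists>!c. (\<forall>i. c i \<in> Agr i) \<and> finite {i. c i \<noteq> 0} \<and> a = (\<Sum>i\<in>{i. c i \<noteq> 0}. c i)"
    using graded by (simp add: graded_algebra_def)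
  from theI'[OF this] show ?thesis
    unfolding hcomp_def .
qed

lemma hcomp_mem: "hcomp Agr a i \<in> Agr i"
  using hcomp_P by blast

lemma hcomp_eqI:
  assumes "\<And>i. c i \<in> Agr i" "\<And>i. i \<ge> N \<Longrightarrow> c i = 0" "a = (\<Sum>i<N. c i)"
  shows "hcomp Agr a = c"
proof -
  have sub: "{i. c i \<noteq> 0} \<subseteq> {..<N}"
    using assms(2) not_le by auto
  have "a = (\<Sum>i\<in>{i. c i \<noteq> 0}. c i)"
    unfolding assms(3) by (rule sum.mono_neutral_right) (use sub in auto)
  moreover have "finite {i. c i \<noteq> 0}"
    using sub finite_subset by blast
  moreover have "\<exists>!c. (\<forall>i. c i \<in> Agr i) \<and> finite {i. c i \<noteq> 0} \<and> a = (\<Sum>i\<in>{i. c i \<noteq> 0}. c i)"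
    using graded by (simp add: graded_algebra_def)
  ultimately show ?thesis
    unfolding hcomp_def using assms(1) by (intro the1_equality) simp_all
qed

text \<open>Sums over initial segments replace sums over the support, and every large
  \<open>N\<close> is allowed. Two elements then have a common range of summation, and the support
  of a sum, which cancellation may shrink, need not be computed.\<close>

lemma hcomp_bound:
  obtains N0 where "\<And>i. i \<ge> N0 \<Longrightarrow> hcomp Agr a i = 0" "\<And>N. N \<ge> N0 \<Longrightarrow> (\<Sum>i<N. hcomp Agr a i) = a"
proof -
  have fin: "finite {i. hcomp Agr a i \<noteq> 0}"
    using hcomp_P by blast
  then obtain N0 where "\<forall>i\<in>{i. hcomp Agr a i \<noteq> 0}. i < N0"
    unfolding finite_nat_set_iff_bounded by (elim exE)
  then have z: "hcomp Agr a i = 0" if "i \<ge> N0" for i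
    using that by fastforce
  have "(\<Sum>i<N. hcomp Agr a i) = a" if "N \<ge> N0" for N
  proof -
    have "(\<Sum>i\<in>{i. hcomp Agr a i \<noteq> 0}. hcomp Agr a i) = (\<Sum>i<N. hcomp Agr a i)"
    proof (rule sum.mono_neutral_left)
      show "{i. hcomp Agr a i \<noteq> 0} \<subseteq> {..<N}"
        using z that by (auto simp: not_le[symmetric])
    qed auto
    then show ?thesis
      using hcomp_P[of a] by simp
  qed
  then show thesis
    using that z by blast
qed

lemma hcomp_add: "hcomp Agr (a + b) i = hcomp Agr a i + hcomp Agr b i"
proof -
  obtain N1 where N1: "\<And>i. i \<ge> N1 \<Longrightarrow> hcomp Agr a i = 0" "\<And>N. N \<ge> N1 \<Longrightarrow> (\<Sum>i<N. hcomp Agr a i) = a"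
    by (rule hcomp_bound[of a]) blast
  obtain N2 where N2: "\<And>i. i \<ge> N2 \<Longrightarrow> hcomp Agr b i = 0" "\<And>N. N \<ge> N2 \<Longrightarrow> (\<Sum>i<N. hcomp Agr b i) = b"
    by (rule hcomp_bound[of b]) blast
  have "hcomp Agr (a + b) = (\<lambda>i. hcomp Agr a i + hcomp Agr b i)"
    by (rule hcomp_eqI[where N = "max N1 N2"])
      (simp_all add: N1 N2 Agr_add hcomp_mem sum.distrib)
  then show ?thesis by simp
qed

lemma sA_0 [simp]: "sA k 0 = 0"
  by (simp add: sA_def)

lemma hcomp_sA: "hcomp Agr (sA k a) i = sA k (hcomp Agr a i)"
proof -
  obtain N where N: "\<And>i. i \<ge> N \<Longrightarrow> hcomp Agr a i = 0" "(\<Sum>i<N. hcomp Agr a i) = a"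
    by (rule hcomp_bound[of a]) blast
  have "sA k a = (\<Sum>i<N. sA k (hcomp Agr a i))"
    unfolding sA_def mul_sum_right[symmetric] by (simp add: N)
  then have "hcomp Agr (sA k a) = (\<lambda>i. sA k (hcomp Agr a i))"
    by (intro hcomp_eqI[where N = N]) (simp_all add: Agr_sA hcomp_mem N(1))
  then show ?thesis by simp
qed

lemma lin_hcomp: "lin sA sA (\<lambda>a. hcomp Agr a i)"
  by (intro linI vsA hcomp_add hcomp_sA)

lemma hcomp_hom: "a \<in> Agr d \<Longrightarrow> hcomp Agr a i = (if i = d then a else 0)"
  by (subst hcomp_eqI[where N = "Suc d" and c = "\<lambda>i. if i = d then a else 0"])
    (auto simp: Agr_0_mem)

lemma hom_induct:
  assumes "subsp sA S" "\<And>d a. a \<in> Agr d \<Longrightarrow> a \<in> S"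
  shows "a \<in> S"
proof -
  obtain N where "(\<Sum>i<N. hcomp Agr a i) = a"
    by (rule hcomp_bound[of a]) blast
  moreover have "(\<Sum>i<N. hcomp Agr a i) \<in> S"
    by (rule module.subspace_sum[OF vector_space_module[OF vsA] assms(1)])
      (use assms(2) hcomp_mem in blast)
  ultimately show ?thesis by simp
qed

abbreviation \<epsilon> where "\<epsilon> \<equiv> aug \<iota> Agr"

text \<open>Connectedness makes the degree 0 component a scalar. Through this identity and the
  injectivity of \<open>\<iota>\<close>, rules for \<open>\<epsilon>\<close> become rules for
  \<open>hcomp\<close>.\<close>

lemma iota_eps: "\<iota> (\<epsilon> a) = hcomp Agr a 0"
proof -
  have "\<exists>k. \<iota> k = hcomp Agr a 0"
    using hcomp_mem[of a 0] by (auto simp: Agr_0)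
  then have "\<exists>!k. \<iota> k * 1 = hcomp Agr a 0"
    using iota_inj by (metis mult.right_neutral)
  from theI'[OF this] show ?thesis
    by (simp add: aug_def)
qed

lemma eps_add: "\<epsilon> (a + b) = \<epsilon> a + \<epsilon> b"
  by (rule iota_inj) (simp add: iota_eps iota_add hcomp_add)

lemma eps_sA: "\<epsilon> (sA k a) = k * \<epsilon> a"
  by (rule iota_inj) (simp add: iota_eps hcomp_sA iota_mul, simp add: sA_def)

lemma eps_diff: "\<epsilon> (a - b) = \<epsilon> a - \<epsilon> b"
  using eps_add[of "a - b" b] by (simp add: algebra_simps)

lemma iota_Agr_0: "\<iota> k \<in> Agr 0"
  by (auto simp: Agr_0)

lemma eps_iota [simp]: "\<epsilon> (\<iota> k) = k"
  by (rule iota_inj) (simp add: iota_eps hcomp_hom[OF iota_Agr_0])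

lemma eps_1 [simp]: "\<epsilon> 1 = 1"
  using eps_iota[of 1] by simp

lemma eps_0 [simp]: "\<epsilon> 0 = 0"
  using eps_iota[of 0] by simp

lemma hcomp_mul_hom:
  assumes "b \<in> Agr d"
  shows "hcomp Agr (a \<cdot> b) n = (if d \<le> n then hcomp Agr a (n - d) \<cdot> b else 0)"
proof -
  let ?f = "\<lambda>a. hcomp Agr (a \<cdot> b) n"
  let ?g = "\<lambda>a. (if d \<le> n then hcomp Agr a (n - d) \<cdot> b else 0)"
  have f: "lin sA sA ?f"
    by (intro linI vsA) (auto simp: mul_add_left hcomp_add sA_mul_left hcomp_sA)
  have g: "lin sA sA ?g"
    by (intro linI vsA) (auto simp: mul_add_left hcomp_add sA_mul_left hcomp_sA)
  have "a \<in> {a. ?f a - ?g a \<in> {0}}"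
  proof (rule hom_induct[OF subsp_vimage[OF lin_minus_lin[OF f g] subsp_zero[OF vsA]]])
    fix i x assume x: "x \<in> Agr i"
    show "x \<in> {a. ?f a - ?g a \<in> {0}}"
      by (auto simp: hcomp_hom[OF Agr_mul[OF x assms]] hcomp_hom[OF x])
  qed
  then show ?thesis by simp
qed

lemma eps_mul: "\<epsilon> (a \<cdot> b) = \<epsilon> a * \<epsilon> b"
proof (rule iota_inj)
  let ?f = "\<lambda>b. hcomp Agr (a \<cdot> b) 0"
  let ?g = "\<lambda>b. hcomp Agr a 0 \<cdot> hcomp Agr b 0"
  have f: "lin sA sA ?f"
    by (intro linI vsA) (auto simp: mul_add_right hcomp_add sA_mul_right hcomp_sA)
  have g: "lin sA sA ?g"
    by (intro linI vsA) (auto simp: mul_add_right hcomp_add sA_mul_right hcomp_sA)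
  have "b \<in> {b. ?f b - ?g b \<in> {0}}"
    by (rule hom_induct[OF subsp_vimage[OF lin_minus_lin[OF f g] subsp_zero[OF vsA]]])
      (auto simp: hcomp_mul_hom hcomp_hom)
  then show "\<iota> (\<epsilon> (a \<cdot> b)) = \<iota> (\<epsilon> a * \<epsilon> b)"
    by (simp add: iota_eps iota_mul)
qed

section \<open>Formal tensors and the bilinearity relations\<close>

lemma T_eq: "T u v = T u' v' \<longleftrightarrow> u = u' \<and> v = v'"
  using side by auto

lemma T_surj: "\<exists>u v. p = T u v"
  using side by (cases p) auto

text \<open>Represents \<open>u \<otimes> v\<close> in the \<open>j\<close>-th summand.\<close>

definition E :: "nat \<Rightarrow> 'a \<Rightarrow> 'a \<Rightarrow> (nat \<Rightarrow> 'a \<times> 'a \<Rightarrow> 'k)" where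
  "E j u v = unitvec j (T u v)"

lemma E_fbvec: "j < r \<Longrightarrow> E j u v \<in> fbvec r"
  by (auto simp: E_def unitvec_def fbvec_def fsupp_def)

lemma E_Fin: "E j u v \<in> Fin"
  using E_fbvec[of j "Suc j"] fbvec_Fin by blast

lemma fbvec_induct:
  assumes "X \<in> fbvec r" "subsp sR S" "\<And>j u v. j < r \<Longrightarrow> E j u v \<in> S"
  shows "X \<in> S"
proof -
  have "unitvec j p \<in> S" if "j < r" for j p
    using assms(3)[OF that] T_surj[of p] by (auto simp: E_def)
  then have "(\<Sum>j<r. \<Sum>p\<in>{p. X j p \<noteq> 0}. sR (X j p) (unitvec j p)) \<in> S"
    by (intro subsp_sum[OF vsR assms(2)] subsp_scale[OF vsR assms(2)]) auto
  then show ?thesis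
    using fbvec_expand[OF assms(1)] by simp
qed

lemma ext_exists:
  assumes "vector_space s"
  shows "\<exists>G. lin sR s G \<and> (\<forall>j u v. G (E j u v) = \<phi> j u v)"
proof -
  have pair: "vector_space_pair (sR :: 'k \<Rightarrow> (nat \<Rightarrow> 'a \<times> 'a \<Rightarrow> 'k) \<Rightarrow> _) s"
    using vsR assms by (simp add: vector_space_pair_def)
  define f where "f X = (case (SOME t. X = (case t of (j, u, v) \<Rightarrow> E j u v)) of (j, u, v) \<Rightarrow> \<phi> j u v)" for X
  have inj: "E j u v = E j' u' v' \<longleftrightarrow> j = j' \<and> u = u' \<and> v = v'" for j u v j' u' v'
    unfolding E_def by (metis (mono_tags, lifting) unitvec_def zero_neq_one T_eq)
  have f: "f (E j u v) = \<phi> j u v" for j u v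
  proof -
    have "(SOME t. E j u v = (case t of (j, u, v) \<Rightarrow> E j u v)) = (j, u, v)"
      by (rule some_equality) (auto simp: inj)
    then show ?thesis by (simp add: f_def)
  qed
  obtain G where "lin sR s G" "\<forall>x\<in>range (\<lambda>(j, p). unitvec j p). G x = f x"
    using vector_space_pair.linear_independent_extend[OF pair independent_unitvec] by blast
  moreover have "E j u v \<in> range (\<lambda>(j, p). unitvec j p)" for j u v
    by (auto simp: E_def)
  ultimately show ?thesis
    using f by (intro exI[of _ G]) metis
qed

text \<open>The universal property of the free vector space on symbols. Values at infinitely
  supported tuples depend on a choice, so two such maps are compared on \<open>Fin\<close>
  only.\<close>

definition lext :: "('k \<Rightarrow> 'b \<Rightarrow> 'b) \<Rightarrow> (nat \<Rightarrow> 'a \<Rightarrow> 'a \<Rightarrow> 'b) \<Rightarrow> (nat \<Rightarrow> 'a \<times> 'a \<Rightarrow> 'k) \<Rightarrow> 'b::ab_group_add" where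
  "lext s \<phi> = (SOME G. lin sR s G \<and> (\<forall>j u v. G (E j u v) = \<phi> j u v))"

lemma lext:
  assumes "vector_space s"
  shows lin_lext: "lin sR s (lext s \<phi>)" and lext_E: "lext s \<phi> (E j u v) = \<phi> j u v"
  using someI_ex[OF ext_exists[OF assms, of \<phi>]] unfolding lext_def by blast+

definition Rel :: "(nat \<Rightarrow> 'a \<times> 'a \<Rightarrow> 'k) set" where
  "Rel = {X \<in> Fin. \<forall>i. X i \<in> tens_rel \<iota>}"

abbreviation eqv (infix "\<approx>" 50) where "X \<approx> Y \<equiv> X - Y \<in> Rel"

lemma subsp_Rel: "subsp sR Rel"
proof (rule subspI[OF vsR])
  show "X + Y \<in> Rel" if "X \<in> Rel" "Y \<in> Rel" for X Y
    using that tr_add[of "X i" \<iota> "Y i" for i]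
    by (auto simp: Rel_def plus_fun_def[of "X _"] intro: subsp_add[OF vsR subsp_Fin])
  show "sR k X \<in> Rel" if "X \<in> Rel" for k X
    using that tr_smult[of "X i" \<iota> k for i]
    by (auto simp: Rel_def sR_def[of k X, THEN fun_cong] intro: subsp_scale[OF vsR subsp_Fin])
qed (simp add: Rel_def subsp_0[OF vsR subsp_Fin], simp add: zero_fun_def tr_zero)

lemmas Rel_0 [simp] = subsp_0[OF vsR subsp_Rel]
  and Rel_add = subsp_add[OF vsR subsp_Rel]
  and Rel_diff = subsp_diff[OF vsR subsp_Rel]
  and Rel_scale = subsp_scale[OF vsR subsp_Rel]
  and Rel_sum = subsp_sum[OF vsR subsp_Rel]

lemma eqv_sym: "X \<approx> Y \<Longrightarrow> Y \<approx> X"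
  using Rel_diff[OF Rel_0, of "X - Y"] by simp

lemma eqv_trans [trans]: "X \<approx> Y \<Longrightarrow> Y \<approx> Z \<Longrightarrow> X \<approx> Z"
  using Rel_add[of "X - Y" "Y - Z"] by simp

lemma eqv_eq_trans [trans]: "X \<approx> Y \<Longrightarrow> Y = Z \<Longrightarrow> X \<approx> Z"
  by simp

lemma eq_eqv_trans [trans]: "X = Y \<Longrightarrow> Y \<approx> Z \<Longrightarrow> X \<approx> Z"
  by simp

lemma eqv_sum: "(\<And>i. i \<in> I \<Longrightarrow> f i \<approx> g i) \<Longrightarrow> sum f I \<approx> sum g I"
  unfolding sum_subtractf[symmetric] by (rule Rel_sum)

lemma eqv_diff: "X \<approx> Y \<Longrightarrow> X' \<approx> Y' \<Longrightarrow> X - X' \<approx> Y - Y'"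
  using Rel_diff[of "X - Y" "X' - Y'"] by (simp add: algebra_simps)

lemma lin_eqv: "lin sR sR G \<Longrightarrow> (\<And>Z. Z \<in> Rel \<Longrightarrow> G Z \<in> Rel) \<Longrightarrow> X \<approx> Y \<Longrightarrow> G X \<approx> G Y"
  by (simp add: lin_diff[symmetric])

lemma eqv_mem: "subsp sR S \<Longrightarrow> Rel \<subseteq> S \<Longrightarrow> X \<approx> Y \<Longrightarrow> Y \<in> S \<Longrightarrow> X \<in> S"
  using subsp_add[OF vsR, of S "X - Y" Y] by auto

text \<open>The relations are stable under exchanging the two factors; when \<open>T\<close> is
  flipped, the rules for the left and the right entry merely change places.\<close>

lemma tens_rel_sides:
  "(\<lambda>p. (if p = T (a + a') b then 1 else 0) - ((if p = T a b then 1 else 0) + (if p = T a' b then 1 else 0))) \<in> tens_rel \<iota>" (is ?A)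
  "(\<lambda>p. (if p = T a (b + b') then 1 else 0) - ((if p = T a b then 1 else 0) + (if p = T a b' then 1 else 0))) \<in> tens_rel \<iota>" (is ?B)
  "(\<lambda>p. (if p = T (sA k a) b then 1 else 0) - k * (if p = T a b then 1 else 0)) \<in> tens_rel \<iota>" (is ?C)
  "(\<lambda>p. (if p = T a (sA k b) then 1 else 0) - k * (if p = T a b then 1 else 0)) \<in> tens_rel \<iota>" (is ?D)
proof -
  have g1: "(\<lambda>p. pt (x + x') y p - (pt x y p + pt x' y p)) \<in> tens_rel \<iota>"
    and g2: "(\<lambda>p. pt x (y + y') p - (pt x y p + pt x y' p)) \<in> tens_rel \<iota>"
    and g3: "(\<lambda>p. pt (sA k x) y p - k * pt x y p) \<in> tens_rel \<iota>"
    and g4: "(\<lambda>p. pt x (sA k y) p - k * pt x y p) \<in> tens_rel \<iota>" for x x' y y'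
    unfolding diff_diff_eq[symmetric] sA_def iota_times[symmetric]
    by (rule tr_gen, unfold tens_gens_def, blast)+
  consider "T = Pair" | "T = (\<lambda>u v. (v, u))"
    using side by blast
  then have "?A \<and> ?B \<and> ?C \<and> ?D"
  proof cases
    case 1
    show ?thesis
      using g1[of a a' b] g2[of a b b'] g3[of a b] g4[of a b] unfolding pt_def \<open>T = Pair\<close> by blast
  next
    case 2
    show ?thesis
      using g2[of b a a'] g1[of b b' a] g4[of b a] g3[of b a] unfolding pt_def \<open>T = (\<lambda>u v. (v, u))\<close> by blast
  qed
  then show ?A ?B ?C ?D
    by blast+
qed

lemma modlin_E_left: "modlin sA Rel sR (\<lambda>u. E j u v)"
proof (intro modlinI vsA vsR subsp_Rel)
  fix x y k
  have "(E j (x + y) v - (E j x v + E j y v)) i \<in> tens_rel \<iota>" for i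
    using tens_rel_sides(1)[of x y v] tr_zero[of \<iota>]
    by (cases "i = j") (simp_all add: E_def unitvec_def fun_diff_def plus_fun_def)
  then show "E j (x + y) v - (E j x v + E j y v) \<in> Rel"
    by (auto simp: Rel_def intro!: subsp_diff[OF vsR subsp_Fin] subsp_add[OF vsR subsp_Fin] E_Fin)
  have "(E j (sA k x) v - sR k (E j x v)) i \<in> tens_rel \<iota>" for i
    using tens_rel_sides(3)[of k x v] tr_zero[of \<iota>]
    by (cases "i = j") (simp_all add: E_def unitvec_def fun_diff_def sR_def)
  then show "E j (sA k x) v - sR k (E j x v) \<in> Rel"
    by (auto simp: Rel_def intro!: subsp_diff[OF vsR subsp_Fin] subsp_scale[OF vsR subsp_Fin] E_Fin)
qed

lemma modlin_E_right: "modlin sA Rel sR (E j u)"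
proof (intro modlinI vsA vsR subsp_Rel)
  fix x y k
  have "(E j u (x + y) - (E j u x + E j u y)) i \<in> tens_rel \<iota>" for i
    using tens_rel_sides(2)[of u x y] tr_zero[of \<iota>]
    by (cases "i = j") (simp_all add: E_def unitvec_def fun_diff_def plus_fun_def)
  then show "E j u (x + y) - (E j u x + E j u y) \<in> Rel"
    by (auto simp: Rel_def intro!: subsp_diff[OF vsR subsp_Fin] subsp_add[OF vsR subsp_Fin] E_Fin)
  have "(E j u (sA k x) - sR k (E j u x)) i \<in> tens_rel \<iota>" for i
    using tens_rel_sides(4)[of u k x] tr_zero[of \<iota>]
    by (cases "i = j") (simp_all add: E_def unitvec_def fun_diff_def sR_def)
  then show "E j u (sA k x) - sR k (E j u x) \<in> Rel"
    by (auto simp: Rel_def intro!: subsp_diff[OF vsR subsp_Fin] subsp_scale[OF vsR subsp_Fin] E_Fin)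
qed

definition at :: "nat \<Rightarrow> ('a \<times> 'a \<Rightarrow> 'k) \<Rightarrow> (nat \<Rightarrow> 'a \<times> 'a \<Rightarrow> 'k)" where
  "at j t = (\<lambda>i. if i = j then t else 0)"

text \<open>Each coordinate is treated by induction on \<open>tens_rel\<close> and put into its slot
  by \<open>at\<close>; membership in \<open>Fin\<close> makes the tuple a finite sum of such
  pieces.\<close>

lemma Rel_induct:
  assumes X: "X \<in> Rel" and S: "subsp sR S"
    and gen: "\<And>j a a' b. E j (a + a') b - (E j a b + E j a' b) \<in> S"
      "\<And>j a b b'. E j a (b + b') - (E j a b + E j a b') \<in> S"
      "\<And>j k a b. E j (sA k a) b - sR k (E j a b) \<in> S"
      "\<And>j k a b. E j a (sA k b) - sR k (E j a b) \<in> S"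
  shows "X \<in> S"
proof -
  have at_mem: "at j t \<in> S" if "t \<in> tens_rel \<iota>" for j t
    using that
  proof induction
    case tr_zero
    have "at j (\<lambda>_. 0) = 0"
      by (auto simp: at_def fun_eq_iff)
    then show ?case
      using subsp_0[OF vsR S] by (simp only:)
  next
    case (tr_gen g)
    have E_cases: "(\<forall>u v. at j (pt u v) = E j u v) \<or> (\<forall>u v. at j (pt v u) = E j u v)"
    proof -
      have "at j (\<lambda>p. if p = T u v then 1 else 0) = E j u v" for u v
        by (intro ext) (simp add: at_def E_def unitvec_def)
      then show ?thesis
        using side unfolding pt_def by (elim disjE) simp_all
    qed
    have at_diff2: "at j (\<lambda>p. x p - y p - z p) = at j x - (at j y + at j z)"
      and at_diff_scale: "at j (\<lambda>p. x p - k * y p) = at j x - sR k (at j y)" for x y z k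
      by (auto simp: at_def fun_eq_iff)
    have pt1: "at j (\<lambda>p. pt (a + a') b p - pt a b p - pt a' b p) \<in> S" for a a' b
      using E_cases gen(1,2) unfolding at_diff2 by metis
    have pt2: "at j (\<lambda>p. pt a (b + b') p - pt a b p - pt a b' p) \<in> S" for a b b'
      using E_cases gen(1,2) unfolding at_diff2 by metis
    have pt3: "at j (\<lambda>p. pt (\<iota> k * a) b p - k * pt a b p) \<in> S" for a b k
      using E_cases gen(3,4) unfolding at_diff_scale iota_times sA_def by metis
    have pt4: "at j (\<lambda>p. pt a (\<iota> k * b) p - k * pt a b p) \<in> S" for a b k
      using E_cases gen(3,4) unfolding at_diff_scale iota_times sA_def by metis
    show ?case
      using tr_gen pt1 pt2 pt3 pt4 unfolding tens_gens_def by blast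
  next
    case (tr_add x y)
    have "at j (\<lambda>p. x p + y p) = at j x + at j y"
      by (auto simp: at_def fun_eq_iff)
    then show ?case
      using subsp_add[OF vsR S tr_add.IH] by (simp only:)
  next
    case (tr_smult x k)
    have "at j (\<lambda>p. k * x p) = sR k (at j x)"
      by (auto simp: at_def fun_eq_iff)
    then show ?case
      using subsp_scale[OF vsR S tr_smult.IH] by (simp only:)
  qed
  obtain r where r: "X \<in> fbvec r" and t: "\<And>j. X j \<in> tens_rel \<iota>"
    using X by (auto simp: Rel_def Fin_def)
  have "X = (\<Sum>j<r. at j (X j))"
  proof (intro ext)
    fix i p
    have "(\<Sum>j<r. at j (X j)) i p = (\<Sum>j<r. if i = j then X j p else 0)"
      unfolding sum_fun_apply by (intro sum.cong) (auto simp: at_def)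
    also have "\<dots> = X i p"
      using r by (auto simp: fbvec_def)
    finally show "X i p = (\<Sum>j<r. at j (X j)) i p" ..
  qed
  then show ?thesis
    using subsp_sum[OF vsR S, of "{..<r}" "\<lambda>j. at j (X j)"] at_mem t by metis
qed

text \<open>The universal property of the tensor product: a map given on symbols descends as soon as
  it is bilinear modulo \<open>N\<close>. Most of the later well-definedness statements are
  instances.\<close>

lemma Rel_map:
  assumes X: "X \<in> Rel" and G: "lin sR s G"
    and bil: "\<And>j v. modlin sA N s (\<lambda>u. G (E j u v))" "\<And>j u. modlin sA N s (\<lambda>v. G (E j u v))"
  shows "G X \<in> N"
proof -
  have N: "subsp s N"
    using bil(1) by (simp add: modlin_def)
  have "X \<in> {X. G X \<in> N}"
    by (rule Rel_induct[OF X subsp_vimage[OF G N]])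
      (use bil in \<open>simp_all add: lin_diff[OF G] lin_add[OF G] lin_scale[OF G] modlin_def\<close>)
  then show ?thesis by simp
qed

lemma fbvec_map:
  assumes "X \<in> fbvec r" "lin sR s G" "subsp s S" "\<And>j u v. j < r \<Longrightarrow> G (E j u v) \<in> S"
  shows "G X \<in> S"
  using fbvec_induct[OF assms(1) subsp_vimage[OF assms(2,3)]] assms(4) by blast

lemma fbvec_cong_mod:
  assumes "X \<in> fbvec r" "modlin sR N s F" "modlin sR N s G"
    "\<And>j u v. j < r \<Longrightarrow> F (E j u v) - G (E j u v) \<in> N"
  shows "F X - G X \<in> N"
  using fbvec_induct[OF assms(1) modlin_subsp[OF modlin_diff[OF assms(2,3)]]] assms(4) by blast

lemma fbvec_cong:
  assumes "X \<in> fbvec r" "lin sR s F" "lin sR s G" "\<And>j u v. j < r \<Longrightarrow> F (E j u v) = G (E j u v)"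
  shows "F X = G X"
proof -
  have z: "subsp s {0}"
    using lin_vector_space2[OF assms(2)] by (rule subsp_zero)
  have "F X - G X \<in> {0}"
    by (rule fbvec_cong_mod[OF assms(1) lin_modlin[OF assms(2) z] lin_modlin[OF assms(3) z]])
      (simp add: assms(4))
  then show ?thesis by simp
qed

lemma Fin_cong:
  assumes "X \<in> Fin" "lin sR s F" "lin sR s G" "\<And>j u v. F (E j u v) = G (E j u v)"
  shows "F X = G X"
  using assms fbvec_cong[OF _ assms(2,3)] by (auto simp: Fin_def)

lemma Fin_cong_Rel:
  assumes "X \<in> Fin" "lin sR sR F" "lin sR sR G" "\<And>j u v. F (E j u v) \<approx> G (E j u v)"
  shows "F X \<approx> G X"
  using assms fbvec_cong_mod[OF _ lin_modlin[OF assms(2) subsp_Rel] lin_modlin[OF assms(3) subsp_Rel]]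
  by (auto simp: Fin_def)

text \<open>Symbols with homogeneous entries span only modulo the relations, since splitting the
  entries of \<open>E j u v\<close> uses additivity; hence the requirement
  \<open>Rel \<subseteq> S\<close>.\<close>

lemma fbvec_hom_induct:
  assumes X: "X \<in> fbvec r" and S: "subsp sR S" "Rel \<subseteq> S"
    and hom: "\<And>j u v d e. j < r \<Longrightarrow> u \<in> Agr d \<Longrightarrow> v \<in> Agr e \<Longrightarrow> E j u v \<in> S"
  shows "X \<in> S"
proof (rule fbvec_induct[OF X S(1)])
  fix j u v assume j: "j < r"
  have "v \<in> {v. E j u v \<in> S}"
  proof (rule hom_induct[OF modlin_subsp[OF modlin_mono[OF modlin_E_right S]]], rule CollectI)
    fix e v assume v: "v \<in> Agr e"
    have "u \<in> {u. E j u v \<in> S}"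
      by (rule hom_induct[OF modlin_subsp[OF modlin_mono[OF modlin_E_left S]]])
        (use hom j v in blast)
    then show "E j u v \<in> S" by simp
  qed
  then show "E j u v \<in> S" by simp
qed

lemma E_zero_left: "E j 0 v \<in> Rel"
  using modlin_zero[OF modlin_E_left] .

lemma E_zero_right: "E j u 0 \<in> Rel"
  using modlin_zero[OF modlin_E_right] .

lemma E_sA_left: "E j (sA k u) v \<approx> sR k (E j u v)"
  using modlin_E_left[of j v] by (simp add: modlin_def)

section \<open>The bimodule structure and the augmented module\<close>

definition L :: "'a \<Rightarrow> (nat \<Rightarrow> 'a \<times> 'a \<Rightarrow> 'k) \<Rightarrow> (nat \<Rightarrow> 'a \<times> 'a \<Rightarrow> 'k)" where
  "L a = lext sR (\<lambda>j u v. E j (a \<cdot> u) v)"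

definition Rt :: "'a \<Rightarrow> (nat \<Rightarrow> 'a \<times> 'a \<Rightarrow> 'k) \<Rightarrow> (nat \<Rightarrow> 'a \<times> 'a \<Rightarrow> 'k)" where
  "Rt b = lext sR (\<lambda>j u v. E j u (v \<cdot> b))"

lemma lin_L: "lin sR sR (L a)" and L_E: "L a (E j u v) = E j (a \<cdot> u) v"
  by (simp_all add: L_def lin_lext[OF vsR] lext_E[OF vsR])

lemma lin_Rt: "lin sR sR (Rt b)" and Rt_E: "Rt b (E j u v) = E j u (v \<cdot> b)"
  by (simp_all add: Rt_def lin_lext[OF vsR] lext_E[OF vsR])

lemma lin_mul_left: "lin sA sA (\<lambda>u. a \<cdot> u)" and lin_mul_right: "lin sA sA (\<lambda>u. u \<cdot> a)"
  by (intro linI vsA; simp add: mul_add_left mul_add_right sA_mul_left sA_mul_right)+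

lemma L_Rel: "X \<in> Rel \<Longrightarrow> L a X \<in> Rel"
  by (erule Rel_map[OF _ lin_L])
    (simp_all add: L_E modlin_E_right modlin_precomp[OF lin_mul_left modlin_E_left])

lemma Rt_Rel: "X \<in> Rel \<Longrightarrow> Rt b X \<in> Rel"
  by (erule Rel_map[OF _ lin_Rt])
    (simp_all add: Rt_E modlin_E_left modlin_precomp[OF lin_mul_right modlin_E_right])

lemma L_fbvec: "X \<in> fbvec r \<Longrightarrow> L a X \<in> fbvec r"
  by (erule fbvec_map[OF _ lin_L subsp_fbvec]) (simp add: L_E E_fbvec)

lemma Rt_fbvec: "X \<in> fbvec r \<Longrightarrow> Rt b X \<in> fbvec r"
  by (erule fbvec_map[OF _ lin_Rt subsp_fbvec]) (simp add: Rt_E E_fbvec)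

lemma Rt_Fin: "X \<in> Fin \<Longrightarrow> Rt a X \<in> Fin"
  by (auto simp: Fin_def intro: Rt_fbvec)

lemma Rt_1: "X \<in> Fin \<Longrightarrow> Rt 1 X = X"
  by (erule Fin_cong[OF _ lin_Rt lin_ident[OF vsR]]) (simp add: Rt_E)

lemma L_mul: "X \<in> Fin \<Longrightarrow> L (a \<cdot> b) X = L a (L b X)"
  by (erule Fin_cong[OF _ lin_L lin_comp[OF lin_L lin_L]]) (simp add: L_E mul_assoc)

lemma Rt_mul: "X \<in> Fin \<Longrightarrow> Rt (a \<cdot> b) X = Rt b (Rt a X)"
  by (erule Fin_cong[OF _ lin_Rt lin_comp[OF lin_Rt lin_Rt]]) (simp add: Rt_E mul_assoc)

lemma L_Rt: "X \<in> Fin \<Longrightarrow> L a (Rt b X) = Rt b (L a X)"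
  by (erule Fin_cong[OF _ lin_comp[OF lin_Rt lin_L] lin_comp[OF lin_L lin_Rt]]) (simp add: Rt_E L_E)

lemma lin_scaled: "lin sR sR (sR k)"
  by (intro linI vsR) (auto simp: fun_eq_iff algebra_simps)

lemma modlin_L:
  assumes "X \<in> Fin"
  shows "modlin sA Rel sR (\<lambda>a. L a X)"
proof (intro modlinI vsA vsR subsp_Rel)
  show "L (a + b) X \<approx> L a X + L b X" for a b
  proof (rule Fin_cong_Rel[OF assms lin_L lin_plus_lin[OF lin_L lin_L]])
    show "L (a + b) (E j u v) \<approx> L a (E j u v) + L b (E j u v)" for j u v
      using modlin_E_left[of j v] by (simp add: L_E mul_add_left modlin_def)
  qed
  show "L (sA k a) X \<approx> sR k (L a X)" for k a
  proof (rule Fin_cong_Rel[OF assms lin_L lin_comp[OF lin_L lin_scaled]])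
    show "L (sA k a) (E j u v) \<approx> sR k (L a (E j u v))" for j u v
      using modlin_E_left[of j v] by (simp add: L_E sA_mul_left modlin_def)
  qed
qed

lemma modlin_Rt:
  assumes "X \<in> Fin"
  shows "modlin sA Rel sR (\<lambda>a. Rt a X)"
proof (intro modlinI vsA vsR subsp_Rel)
  show "Rt (a + b) X \<approx> Rt a X + Rt b X" for a b
  proof (rule Fin_cong_Rel[OF assms lin_Rt lin_plus_lin[OF lin_Rt lin_Rt]])
    show "Rt (a + b) (E j u v) \<approx> Rt a (E j u v) + Rt b (E j u v)" for j u v
      using modlin_E_right[of j u] by (simp add: Rt_E mul_add_right modlin_def)
  qed
  show "Rt (sA k a) X \<approx> sR k (Rt a X)" for k a
  proof (rule Fin_cong_Rel[OF assms lin_Rt lin_comp[OF lin_Rt lin_scaled]])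
    show "Rt (sA k a) (E j u v) \<approx> sR k (Rt a (E j u v))" for j u v
      using modlin_E_right[of j u] by (simp add: Rt_E sA_mul_right modlin_def)
  qed
qed

section \<open>Reduction along the augmentation\<close>

definition aQ :: "'a \<Rightarrow> (nat \<Rightarrow> 'a) \<Rightarrow> (nat \<Rightarrow> 'a)" where
  "aQ a q = (\<lambda>i. a \<cdot> q i)"

text \<open>The projection \<open>F \<rightarrow> F \<otimes>\<^sub>A K\<close>, with the target identified with a free left module.\<close>

definition bar :: "(nat \<Rightarrow> 'a \<times> 'a \<Rightarrow> 'k) \<Rightarrow> (nat \<Rightarrow> 'a)" where
  "bar = lext sQ (\<lambda>j u v i. if i = j then sA (\<epsilon> v) u else 0)"

lemma lin_bar: "lin sR sQ bar" and bar_E: "bar (E j u v) = (\<lambda>i. if i = j then sA (\<epsilon> v) u else 0)"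
  by (simp_all add: bar_def lin_lext[OF vsQ] lext_E[OF vsQ])

lemma sA_add: "sA k (a + b) = sA k a + sA k b"
  and sA_add_scalar: "sA (k + l) a = sA k a + sA l a"
  and sA_sA: "sA k (sA l a) = sA (k * l) a"
  by (simp_all add: sA_def mul_add_right mul_add_left iota_add iota_mul mul_assoc)

lemma sA_1 [simp]: "sA 1 a = a"
  by (simp add: sA_def)

lemma bar_Rel:
  assumes "X \<in> Rel"
  shows "bar X = 0"
proof -
  have z: "subsp sQ {0}"
    by (rule subsp_zero[OF vsQ])
  have "bar X \<in> {0}"
  proof (rule Rel_map[OF assms lin_bar]; rule lin_modlin[OF _ z]; rule linI[OF vsA vsQ])
  qed (auto simp: bar_E fun_eq_iff sA_add sA_add_scalar eps_add eps_sA sQ_def sA_def[symmetric] sA_sA mult.commute)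
  then show ?thesis by simp
qed

lemma bar_eqv: "X \<approx> Y \<Longrightarrow> bar X = bar Y"
  using bar_Rel[of "X - Y"] by (simp add: lin_diff[OF lin_bar])

lemma subsp_fvec: "subsp sQ (fvec r)"
  by (rule subspI[OF vsQ]) (auto simp: fvec_def sQ_def)

lemma bar_fvec: "X \<in> fbvec r \<Longrightarrow> bar X \<in> fvec r"
  by (erule fbvec_map[OF _ lin_bar subsp_fvec]) (auto simp: bar_E fvec_def)

lemma lin_aQ: "lin sQ sQ (aQ a)"
  by (intro linI vsQ) (auto simp: aQ_def sQ_def sA_def[symmetric] sA_mul_right mul_add_right fun_eq_iff)

lemma lin_sQ: "lin sQ sQ (sQ k)"
  by (intro linI vsQ) (auto simp: sQ_def sA_def[symmetric] sA_sA mul_add_right fun_eq_iff mult.commute sA_add)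

lemma bar_L: "X \<in> Fin \<Longrightarrow> bar (L a X) = aQ a (bar X)"
  by (erule Fin_cong[OF _ lin_comp[OF lin_L lin_bar] lin_comp[OF lin_bar lin_aQ]])
    (auto simp: L_E bar_E aQ_def sA_mul_right fun_eq_iff)

lemma bar_Rt: "X \<in> Fin \<Longrightarrow> bar (Rt b X) = sQ (\<epsilon> b) (bar X)"
  by (erule Fin_cong[OF _ lin_comp[OF lin_Rt lin_bar] lin_comp[OF lin_bar lin_sQ]])
    (auto simp: Rt_E bar_E sQ_def sA_def[symmetric] sA_sA eps_mul fun_eq_iff mult.commute)

text \<open>On tensors this is \<open>x \<mapsto> bar x \<otimes> 1\<close>, given on symbols so as
  to be strictly linear. The difference \<open>x - cut x\<close> lies in \<open>F A_+\<close> up to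
  relations: on a symbol it is \<open>u \<otimes> (v - \<epsilon> v)\<close>.\<close>

definition cut :: "(nat \<Rightarrow> 'a \<times> 'a \<Rightarrow> 'k) \<Rightarrow> (nat \<Rightarrow> 'a \<times> 'a \<Rightarrow> 'k)" where
  "cut = lext sR (\<lambda>j u v. E j (sA (\<epsilon> v) u) 1)"

lemma lin_cut: "lin sR sR cut" and cut_E: "cut (E j u v) = E j (sA (\<epsilon> v) u) 1"
  by (simp_all add: cut_def lin_lext[OF vsR] lext_E[OF vsR])

definition lift1 :: "nat \<Rightarrow> (nat \<Rightarrow> 'a) \<Rightarrow> (nat \<Rightarrow> 'a \<times> 'a \<Rightarrow> 'k)" where
  "lift1 r q = (\<Sum>j<r. E j (q j) 1)"

lemma lift1_fbvec: "lift1 r q \<in> fbvec r"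
  unfolding lift1_def by (intro fbvec_sum E_fbvec) auto

lemma bar_lift1: "q \<in> fvec r \<Longrightarrow> bar (lift1 r q) = q"
  by (auto simp: lift1_def lin_sum[OF lin_bar] bar_E fun_eq_iff sum_fun_apply fvec_def)

lemma modlin_lift1: "modlin sQ Rel sR (lift1 r)"
proof -
  have "lin sQ sA (\<lambda>q. q j)" for j
    by (intro linI vsQ vsA) (simp_all add: sQ_def sA_def)
  then show ?thesis
    unfolding lift1_def by (intro modlin_sum vsQ vsR subsp_Rel modlin_precomp[OF _ modlin_E_left])
qed

lemma cut_lift1:
  assumes "X \<in> fbvec r"
  shows "cut X \<approx> lift1 r (bar X)"
proof (rule fbvec_cong_mod[OF assms lin_modlin[OF lin_cut subsp_Rel] modlin_precomp[OF lin_bar modlin_lift1]])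
  fix j u v assume j: "j < r"
  have "lift1 r (bar (E j u v)) \<approx> (\<Sum>i<r. if i = j then E j (sA (\<epsilon> v) u) 1 else 0)"
    unfolding lift1_def by (intro eqv_sum) (simp add: bar_E E_zero_left)
  also have "(\<Sum>i<r. if i = j then E j (sA (\<epsilon> v) u) 1 else 0) = cut (E j u v)"
    using j by (simp add: cut_E)
  finally show "cut (E j u v) \<approx> lift1 r (bar (E j u v))"
    by (rule eqv_sym)
qed

lemma cut_Rel:
  assumes "X \<in> fbvec r" "bar X = 0"
  shows "cut X \<in> Rel"
  using cut_lift1[OF assms(1)] modlin_zero[OF modlin_lift1, of r] Rel_add
  by (fastforce simp: assms(2))

section \<open>Homogeneous components\<close>

text \<open>The component of degree \<open>n\<close> when the \<open>j\<close>-th basis element of the free bimodule has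
  degree \<open>\<delta> j\<close>.\<close>

definition H :: "(nat \<Rightarrow> nat) \<Rightarrow> nat \<Rightarrow> (nat \<Rightarrow> 'a \<times> 'a \<Rightarrow> 'k) \<Rightarrow> (nat \<Rightarrow> 'a \<times> 'a \<Rightarrow> 'k)" where
  "H \<delta> n = lext sR (\<lambda>j u v. \<Sum>d\<le>n. \<Sum>e\<le>n.
     if d + e + \<delta> j = n then E j (hcomp Agr u d) (hcomp Agr v e) else 0)"

lemma lin_H: "lin sR sR (H \<delta> n)"
  and H_E: "H \<delta> n (E j u v) = (\<Sum>d\<le>n. \<Sum>e\<le>n.
     if d + e + \<delta> j = n then E j (hcomp Agr u d) (hcomp Agr v e) else 0)"
  by (simp_all add: H_def lin_lext[OF vsR] lext_E[OF vsR])

lemma H_Rel: "X \<in> Rel \<Longrightarrow> H \<delta> n X \<in> Rel"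
proof (erule Rel_map[OF _ lin_H])
  have modlin_if: "modlin sA Rel sR f \<Longrightarrow> modlin sA Rel sR (\<lambda>x. if b then f x else 0)" for f b
    by (cases b) (simp_all add: modlin_const_0[OF vsA vsR subsp_Rel])
  show "modlin sA Rel sR (\<lambda>u. H \<delta> n (E j u v))" for j v
    unfolding H_E
    by (intro modlin_sum vsA vsR subsp_Rel modlin_if modlin_precomp[OF lin_hcomp modlin_E_left])
  show "modlin sA Rel sR (\<lambda>v. H \<delta> n (E j u v))" for j u
    unfolding H_E
    by (intro modlin_sum vsA vsR subsp_Rel modlin_if modlin_precomp[OF lin_hcomp modlin_E_right])
qed

lemma H_fbvec: "X \<in> fbvec r \<Longrightarrow> H \<delta> n X \<in> fbvec r"
  by (erule fbvec_map[OF _ lin_H subsp_fbvec])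
    (auto simp: H_E intro!: fbvec_sum E_fbvec fbvec_0)

text \<open>This holds only modulo \<open>Rel\<close>: the components in other degrees vanish, but
  \<open>E j 0 v\<close> is a nonzero formal combination that represents zero.\<close>

lemma H_hom:
  assumes u: "u \<in> Agr d" and v: "v \<in> Agr e"
  shows "H \<delta> n (E j u v) \<approx> (if d + e + \<delta> j = n then E j u v else 0)"
proof -
  let ?sum = "\<Sum>d'\<le>n. \<Sum>e'\<le>n. if d' = d then if e' = e then if d + e + \<delta> j = n then E j u v else 0 else 0 else 0"
  have "H \<delta> n (E j u v) \<approx> ?sum"
    unfolding H_E
    by (intro eqv_sum) (auto simp: hcomp_hom[OF u] hcomp_hom[OF v] E_zero_left E_zero_right)
  also have "?sum = (if d + e + \<delta> j = n then E j u v else 0)"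
  proof -
    have "(\<Sum>d'\<le>n. \<Sum>e'\<le>n. if d' = d then if e' = e then c else 0 else 0) = (if d \<le> n \<and> e \<le> n then c else 0)"
      for c :: "nat \<Rightarrow> 'a \<times> 'a \<Rightarrow> 'k"
    proof -
      have "(\<Sum>e'\<le>n. if d' = d then if e' = e then c else 0 else 0) = (if d' = d then if e \<le> n then c else 0 else 0)" for d'
        by (cases "d' = d") simp_all
      then show ?thesis by simp
    qed
    then show ?thesis by auto
  qed
  finally show ?thesis .
qed

lemma H_L:
  assumes a: "a \<in> Agr i" and X: "X \<in> fbvec r"
  shows "H \<delta> n (L a X) \<approx> (if i \<le> n then L a (H \<delta> (n - i) X) else 0)"
proof -
  let ?F = "\<lambda>X. if i \<le> n then L a (H \<delta> (n - i) X) else 0"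
  have l: "lin sR sR (\<lambda>X. H \<delta> n (L a X) - ?F X)"
    by (cases "i \<le> n")
      (auto intro!: lin_minus_lin lin_comp[OF lin_L lin_H] lin_comp[OF lin_H lin_L])
  have "X \<in> {X. H \<delta> n (L a X) - ?F X \<in> Rel}"
  proof (rule fbvec_hom_induct[OF X subsp_vimage[OF l subsp_Rel]])
    show "Rel \<subseteq> {X. H \<delta> n (L a X) - ?F X \<in> Rel}"
      by (auto intro!: H_Rel L_Rel Rel_diff)
    fix j u v d e assume u: "u \<in> Agr d" and v: "v \<in> Agr e"
    have "H \<delta> n (L a (E j u v)) \<approx> (if i + d + e + \<delta> j = n then E j (a \<cdot> u) v else 0)"
      unfolding L_E by (rule H_hom[OF Agr_mul[OF a u] v])
    moreover have "?F (E j u v) \<approx> (if i + d + e + \<delta> j = n then E j (a \<cdot> u) v else 0)"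
    proof (cases "i \<le> n")
      case True
      have "L a (H \<delta> (n - i) (E j u v)) \<approx> L a (if d + e + \<delta> j = n - i then E j u v else 0)"
        by (rule lin_eqv[OF lin_L L_Rel H_hom[OF u v]])
      also have "L a (if d + e + \<delta> j = n - i then E j u v else 0) = (if i + d + e + \<delta> j = n then E j (a \<cdot> u) v else 0)"
        using True by (auto simp: L_E lin_zero[OF lin_L])
      finally show ?thesis using True by simp
    qed simp
    ultimately show "E j u v \<in> {X. H \<delta> n (L a X) - ?F X \<in> Rel}"
      by (auto intro: eqv_trans[OF _ eqv_sym])
  qed
  then show ?thesis by simp
qed

lemma H_Rt:
  assumes b: "b \<in> Agr i" and X: "X \<in> fbvec r"
  shows "H \<delta> n (Rt b X) \<approx> (if i \<le> n then Rt b (H \<delta> (n - i) X) else 0)"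
proof -
  let ?F = "\<lambda>X. if i \<le> n then Rt b (H \<delta> (n - i) X) else 0"
  have l: "lin sR sR (\<lambda>X. H \<delta> n (Rt b X) - ?F X)"
    by (cases "i \<le> n")
      (auto intro!: lin_minus_lin lin_comp[OF lin_Rt lin_H] lin_comp[OF lin_H lin_Rt])
  have "X \<in> {X. H \<delta> n (Rt b X) - ?F X \<in> Rel}"
  proof (rule fbvec_hom_induct[OF X subsp_vimage[OF l subsp_Rel]])
    show "Rel \<subseteq> {X. H \<delta> n (Rt b X) - ?F X \<in> Rel}"
      by (auto intro!: H_Rel Rt_Rel Rel_diff)
    fix j u v d e assume u: "u \<in> Agr d" and v: "v \<in> Agr e"
    have "H \<delta> n (Rt b (E j u v)) \<approx> (if d + (e + i) + \<delta> j = n then E j u (v \<cdot> b) else 0)"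
      unfolding Rt_E by (rule H_hom[OF u Agr_mul[OF v b]])
    moreover have "?F (E j u v) \<approx> (if d + (e + i) + \<delta> j = n then E j u (v \<cdot> b) else 0)"
    proof (cases "i \<le> n")
      case True
      have "Rt b (H \<delta> (n - i) (E j u v)) \<approx> Rt b (if d + e + \<delta> j = n - i then E j u v else 0)"
        by (rule lin_eqv[OF lin_Rt Rt_Rel H_hom[OF u v]])
      also have "Rt b (if d + e + \<delta> j = n - i then E j u v else 0) = (if d + (e + i) + \<delta> j = n then E j u (v \<cdot> b) else 0)"
        using True by (auto simp: Rt_E lin_zero[OF lin_Rt])
      finally show ?thesis using True by simp
    qed simp
    ultimately show "E j u v \<in> {X. H \<delta> n (Rt b X) - ?F X \<in> Rel}"
      by (auto intro: eqv_trans[OF _ eqv_sym])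
  qed
  then show ?thesis by simp
qed

lemma H_sum:
  assumes "X \<in> fbvec r"
  shows "\<exists>N0. \<forall>N\<ge>N0. (\<Sum>n<N. H \<delta> n X) \<approx> X"
proof -
  let ?S = "{X. \<exists>N0. \<forall>N\<ge>N0. (\<Sum>n<N. H \<delta> n X) \<approx> X}"
  have "X \<in> ?S"
  proof (rule fbvec_hom_induct[OF assms])
    show "subsp sR ?S"
    proof (rule subspI[OF vsR])
      fix X Y assume "X \<in> ?S" "Y \<in> ?S"
      then obtain N1 N2 where N: "\<And>N. N \<ge> N1 \<Longrightarrow> (\<Sum>n<N. H \<delta> n X) \<approx> X"
        "\<And>N. N \<ge> N2 \<Longrightarrow> (\<Sum>n<N. H \<delta> n Y) \<approx> Y"
        by blast
      have "(\<Sum>n<N. H \<delta> n (X + Y)) \<approx> X + Y" if "N \<ge> max N1 N2" for N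
        using Rel_add[OF N(1)[of N] N(2)[of N]] that
        by (simp add: lin_add[OF lin_H] sum.distrib algebra_simps)
      then show "X + Y \<in> ?S" by blast
    next
      fix k X assume "X \<in> ?S"
      then obtain N1 where N: "\<And>N. N \<ge> N1 \<Longrightarrow> (\<Sum>n<N. H \<delta> n X) \<approx> X"
        by blast
      have "(\<Sum>n<N. H \<delta> n (sR k X)) \<approx> sR k X" if "N \<ge> N1" for N
        using Rel_scale[OF N[OF that], of k]
        by (simp add: lin_scale[OF lin_H] VR.scale_right_diff_distrib VR.scale_sum_right)
      then show "sR k X \<in> ?S" by blast
    qed (simp add: lin_zero[OF lin_H])
    show "Rel \<subseteq> ?S"
      by (auto intro!: H_Rel Rel_diff Rel_sum)
    fix j u v d e assume u: "u \<in> Agr d" and v: "v \<in> Agr e"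
    have "(\<Sum>n<N. H \<delta> n (E j u v)) \<approx> E j u v" if "N > d + e + \<delta> j" for N
    proof -
      have "(\<Sum>n<N. H \<delta> n (E j u v)) \<approx> (\<Sum>n<N. if d + e + \<delta> j = n then E j u v else 0)"
        by (intro eqv_sum H_hom[OF u v])
      also have "(\<Sum>n<N. if d + e + \<delta> j = n then E j u v else 0) = E j u v"
        using that by simp
      finally show ?thesis .
    qed
    then show "E j u v \<in> ?S"
      by (auto intro!: exI[of _ "Suc (d + e + \<delta> j)"])
  qed
  then show ?thesis by simp
qed

section \<open>Maps between free left modules\<close>

lemmas fvec_0 = subsp_0[OF vsQ subsp_fvec]
  and fvec_diff = subsp_diff[OF vsQ subsp_fvec]
  and fvec_sum = subsp_sum[OF vsQ subsp_fvec]

lemma fvec_aQ: "q \<in> fvec r \<Longrightarrow> aQ a q \<in> fvec r"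
  by (auto simp: fvec_def aQ_def)

text \<open>The conditions concern \<open>fvec r\<close> only, because the maps of the given
  resolution are unspecified outside it.\<close>

definition llin :: "nat \<Rightarrow> nat \<Rightarrow> ((nat \<Rightarrow> 'a) \<Rightarrow> (nat \<Rightarrow> 'a)) \<Rightarrow> bool" where
  "llin r s f \<longleftrightarrow> (\<forall>v\<in>fvec r. f v \<in> fvec s) \<and>
     (\<forall>v\<in>fvec r. \<forall>w\<in>fvec r. f (v + w) = f v + f w) \<and>
     (\<forall>a. \<forall>v\<in>fvec r. f (aQ a v) = aQ a (f v))"

lemma llinI:
  assumes "\<And>v. v \<in> fvec r \<Longrightarrow> f v \<in> fvec s"
    "\<And>v w. v \<in> fvec r \<Longrightarrow> w \<in> fvec r \<Longrightarrow> f (v + w) = f v + f w"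
    "\<And>a v. v \<in> fvec r \<Longrightarrow> f (aQ a v) = aQ a (f v)"
  shows "llin r s f"
  using assms by (simp add: llin_def)

lemma llin_mem: "llin r s f \<Longrightarrow> v \<in> fvec r \<Longrightarrow> f v \<in> fvec s"
  and llin_add: "llin r s f \<Longrightarrow> v \<in> fvec r \<Longrightarrow> w \<in> fvec r \<Longrightarrow> f (v + w) = f v + f w"
  and llin_aQ: "llin r s f \<Longrightarrow> v \<in> fvec r \<Longrightarrow> f (aQ a v) = aQ a (f v)"
  by (simp_all add: llin_def)

lemma llin_0: "llin r s f \<Longrightarrow> f 0 = 0"
  using llin_add[of r s f 0 0] fvec_0 by simp

lemma llin_minus:
  assumes f: "llin r s f" and "v \<in> fvec r" "w \<in> fvec r"
  shows "f (v - w) = f v - f w"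
  using llin_add[OF f fvec_diff[OF assms(2,3)] assms(3)] by (simp add: algebra_simps)

lemma llin_sum:
  assumes f: "llin r s f" and "\<And>i. i \<in> I \<Longrightarrow> g i \<in> fvec r"
  shows "f (sum g I) = (\<Sum>i\<in>I. f (g i))"
  using assms(2)
proof (induction I rule: infinite_finite_induct)
  case (insert x F)
  have "f (sum g (insert x F)) = f (g x + sum g F)"
    by (simp only: sum.insert[OF insert.hyps])
  also have "\<dots> = f (g x) + f (sum g F)"
    by (intro llin_add[OF f] fvec_sum insert.prems) auto
  also have "\<dots> = (\<Sum>i\<in>insert x F. f (g i))"
    using insert by (simp only: sum.insert[OF insert.hyps]) simp
  finally show ?case .
qed (simp_all add: llin_0[OF f])

lemma llin_comp: "llin r s f \<Longrightarrow> llin s t g \<Longrightarrow> llin r t (\<lambda>v. g (f v))"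
  by (auto simp: llin_def)

lemma llin_ident: "llin r r (\<lambda>v. v)"
  by (simp add: llin_def)

lemma aQ_diff: "aQ a (v - w) = aQ a v - aQ a w"
  and aQ_0 [simp]: "aQ a 0 = 0"
  by (auto simp: aQ_def fun_eq_iff mul_add_right mul_diff_right)

lemma aQ_aQ: "aQ a (aQ b v) = aQ (a \<cdot> b) v"
  by (simp add: aQ_def mul_assoc)

lemma aQ_sum: "aQ a (sum g I) = (\<Sum>i\<in>I. aQ a (g i))"
  by (rule lin_sum[OF lin_aQ])

lemma llin_sub: "llin r s f \<Longrightarrow> llin r s g \<Longrightarrow> llin r s (\<lambda>v. f v - g v)"
  by (auto simp: llin_def fvec_diff aQ_diff)

definition ue :: "nat \<Rightarrow> nat \<Rightarrow> 'a" where
  "ue j = (\<lambda>i. if i = j then 1 else 0)"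

lemma ue_fvec: "j < r \<Longrightarrow> ue j \<in> fvec r"
  by (auto simp: ue_def fvec_def)

lemma fvec_expand:
  assumes "v \<in> fvec r"
  shows "v = (\<Sum>j<r. aQ (v j) (ue j))"
proof
  fix i
  have "(\<Sum>j<r. aQ (v j) (ue j)) i = (\<Sum>j<r. if i = j then v j else 0)"
    unfolding sum_fun_apply by (intro sum.cong) (auto simp: aQ_def ue_def)
  also have "\<dots> = v i"
    using assms by (auto simp: fvec_def)
  finally show "v i = (\<Sum>j<r. aQ (v j) (ue j)) i" ..
qed

definition lcomb :: "nat \<Rightarrow> (nat \<Rightarrow> nat \<Rightarrow> 'a) \<Rightarrow> (nat \<Rightarrow> 'a) \<Rightarrow> (nat \<Rightarrow> 'a)" where
  "lcomb r c v = (\<Sum>j<r. aQ (v j) (c j))"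

lemma llin_expand:
  assumes f: "llin r s f" and v: "v \<in> fvec r"
  shows "f v = lcomb r (\<lambda>j. f (ue j)) v"
proof -
  have "f (\<Sum>j<r. aQ (v j) (ue j)) = lcomb r (\<lambda>j. f (ue j)) v"
    unfolding lcomb_def
    by (subst llin_sum[OF f]) (auto simp: fvec_aQ ue_fvec llin_aQ[OF f])
  then show ?thesis
    using fvec_expand[OF v] by simp
qed

lemma llin_lcomb:
  assumes "\<And>j. j < r \<Longrightarrow> c j \<in> fvec s"
  shows "llin r s (lcomb r c)"
proof (rule llinI)
  show "lcomb r c v \<in> fvec s" for v
    unfolding lcomb_def using assms by (intro fvec_sum fvec_aQ) auto
qed (auto simp: lcomb_def sum.distrib[symmetric] aQ_sum aQ_aQ aQ_def mul_add_left mul_assoc fun_eq_iff sum_fun_apply mul_sum_right intro!: sum.cong)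

text \<open>Free modules are projective: lift the basis vectors and extend. This supplies the next
  chain maps and the homotopy in \<open>next_stage\<close>.\<close>

lemma llin_lift:
  fixes F D :: "(nat \<Rightarrow> 'a) \<Rightarrow> (nat \<Rightarrow> 'a)"
  assumes F: "llin r s F" and D: "llin t s D" and sub: "F ` fvec r \<subseteq> D ` fvec t"
  obtains G where "llin r t G" "\<And>v. v \<in> fvec r \<Longrightarrow> D (G v) = F v"
proof -
  have "\<exists>w. w \<in> fvec t \<and> D w = F (ue j)" if "j < r" for j
    using subsetD[OF sub imageI[OF ue_fvec[OF that]]] by force
  then have "\<exists>c. \<forall>j. j < r \<longrightarrow> c j \<in> fvec t \<and> D (c j) = F (ue j)"
    by (intro choice) blast
  then obtain c where c: "\<And>j. j < r \<Longrightarrow> c j \<in> fvec t \<and> D (c j) = F (ue j)"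
    by blast
  show thesis
  proof (rule that)
    show G: "llin r t (lcomb r c)"
      using c by (intro llin_lcomb) blast
    fix v :: "nat \<Rightarrow> 'a" assume v: "v \<in> fvec r"
    have "D (lcomb r c v) = lcomb r (\<lambda>j. F (ue j)) v"
      unfolding lcomb_def
      by (subst llin_sum[OF D]) (use c in \<open>auto simp: fvec_aQ llin_aQ[OF D]\<close>)
    then show "D (lcomb r c v) = F v"
      by (simp add: llin_expand[OF F v])
  qed
qed

section \<open>Bimodule maps and right linear maps out of free bimodules\<close>

text \<open>The bimodule map that sends the \<open>j\<close>-th free generator
  \<open>1 \<otimes> 1\<close> to \<open>z j\<close>.\<close>

definition D :: "(nat \<Rightarrow> nat \<Rightarrow> 'a \<times> 'a \<Rightarrow> 'k) \<Rightarrow> (nat \<Rightarrow> 'a \<times> 'a \<Rightarrow> 'k) \<Rightarrow> (nat \<Rightarrow> 'a \<times> 'a \<Rightarrow> 'k)" where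
  "D z = lext sR (\<lambda>j u v. L u (Rt v (z j)))"

lemma lin_D: "lin sR sR (D z)" and D_E: "D z (E j u v) = L u (Rt v (z j))"
  by (simp_all add: D_def lin_lext[OF vsR] lext_E[OF vsR])

lemma D_Rel:
  assumes z: "\<And>j. z j \<in> Fin" and X: "X \<in> Rel"
  shows "D z X \<in> Rel"
proof (rule Rel_map[OF X lin_D])
  show "modlin sA Rel sR (\<lambda>u. D z (E j u v))" for j v
    unfolding D_E by (intro modlin_L Rt_Fin z)
  show "modlin sA Rel sR (\<lambda>v. D z (E j u v))" for j u
    unfolding D_E by (intro modlin_postcomp[OF modlin_Rt lin_L subsp_Rel] L_Rel z)
qed

lemma D_mem:
  assumes "X \<in> fbvec m" "subsp sR S" "\<And>j. z j \<in> S" "\<And>a X. X \<in> S \<Longrightarrow> L a X \<in> S" "\<And>b X. X \<in> S \<Longrightarrow> Rt b X \<in> S"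
  shows "D z X \<in> S"
  by (rule fbvec_map[OF assms(1) lin_D assms(2)]) (simp add: D_E assms)

lemma D_fbvec: "(\<And>j. z j \<in> fbvec s) \<Longrightarrow> X \<in> fbvec m \<Longrightarrow> D z X \<in> fbvec s"
  by (rule D_mem[OF _ subsp_fbvec]) (auto intro: L_fbvec Rt_fbvec)

lemma D_L:
  assumes z: "\<And>j. z j \<in> Fin" and X: "X \<in> Fin"
  shows "D z (L a X) = L a (D z X)"
  by (rule Fin_cong[OF X lin_comp[OF lin_L lin_D] lin_comp[OF lin_D lin_L]])
    (simp add: L_E D_E L_mul Rt_Fin z)

lemma D_Rt:
  assumes z: "\<And>j. z j \<in> Fin" and X: "X \<in> Fin"
  shows "D z (Rt b X) = Rt b (D z X)"
  by (rule Fin_cong[OF X lin_comp[OF lin_Rt lin_D] lin_comp[OF lin_D lin_Rt]])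
    (simp add: Rt_E D_E Rt_mul L_Rt Rt_Fin z)

lemma lin_lcomb: "lin sQ sQ (lcomb m c)"
proof (rule linI[OF vsQ vsQ])
  show "lcomb m c (x + y) = lcomb m c x + lcomb m c y" for x y
    by (auto simp: lcomb_def sum.distrib[symmetric] aQ_def mul_add_left fun_eq_iff sum_fun_apply intro!: sum.cong)
  show "lcomb m c (sQ k x) = sQ k (lcomb m c x)" for k x
    by (auto simp: lcomb_def lin_sum[OF lin_sQ] aQ_def sQ_def mul_assoc fun_eq_iff sum_fun_apply mul_sum_right intro!: sum.cong)
qed

text \<open>Reducing a bimodule map gives the left linear map with the reduced values on the basis;
  this is how the differentials of the resolution of \<open>K\<close> arise.\<close>

lemma bar_D:
  assumes z: "\<And>j. z j \<in> Fin" and X: "X \<in> fbvec m"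
  shows "bar (D z X) = lcomb m (\<lambda>j. bar (z j)) (bar X)"
proof (rule fbvec_cong[OF X lin_comp[OF lin_D lin_bar] lin_comp[OF lin_bar lin_lcomb]])
  fix j u v assume j: "j < m"
  have "bar (D z (E j u v)) = aQ u (sQ (\<epsilon> v) (bar (z j)))"
    by (simp add: D_E bar_L bar_Rt Rt_Fin z)
  also have "\<dots> = aQ (sA (\<epsilon> v) u) (bar (z j))"
    by (simp add: aQ_def sQ_def sA_def[symmetric] sA_mul_left sA_mul_right)
  also have "\<dots> = (\<Sum>i<m. if i = j then aQ (sA (\<epsilon> v) u) (bar (z j)) else 0)"
    using j by simp
  also have "\<dots> = lcomb m (\<lambda>j. bar (z j)) (bar (E j u v))"
    unfolding lcomb_def by (intro sum.cong) (auto simp: bar_E aQ_def fun_eq_iff)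
  finally show "bar (D z (E j u v)) = lcomb m (\<lambda>j. bar (z j)) (bar (E j u v))" .
qed

section \<open>Homogeneous elements and degree-preserving bimodule maps\<close>

definition homog :: "(nat \<Rightarrow> nat) \<Rightarrow> nat \<Rightarrow> (nat \<Rightarrow> 'a \<times> 'a \<Rightarrow> 'k) \<Rightarrow> bool" where
  "homog \<delta> d X \<longleftrightarrow> (\<forall>n. H \<delta> n X \<approx> (if n = d then X else 0))"

lemma homog_H:
  assumes X: "X \<in> fbvec r"
  shows "homog \<delta> d (H \<delta> d X)"
proof -
  have "H \<delta> n (H \<delta> d X) \<approx> (if n = d then H \<delta> d X else 0)" for n
  proof -
    let ?F = "\<lambda>X. H \<delta> n (H \<delta> d X) - (if n = d then H \<delta> d X else 0)"
    have l: "lin sR sR ?F"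
      by (cases "n = d") (auto intro!: lin_minus_lin lin_comp[OF lin_H lin_H] lin_H)
    have "X \<in> {X. ?F X \<in> Rel}"
    proof (rule fbvec_hom_induct[OF X subsp_vimage[OF l subsp_Rel]])
      show "Rel \<subseteq> {X. ?F X \<in> Rel}"
        by (auto intro!: H_Rel Rel_diff)
      fix j u v k e assume u: "u \<in> Agr k" and v: "v \<in> Agr e"
      have d: "H \<delta> d (E j u v) \<approx> (if k + e + \<delta> j = d then E j u v else 0)"
        by (rule H_hom[OF u v])
      have "H \<delta> n (H \<delta> d (E j u v)) \<approx> H \<delta> n (if k + e + \<delta> j = d then E j u v else 0)"
        by (rule lin_eqv[OF lin_H H_Rel d])
      moreover have "H \<delta> n (if k + e + \<delta> j = d then E j u v else 0) \<approx> (if n = d then if k + e + \<delta> j = d then E j u v else 0 else 0)"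
        using H_hom[OF u v, of \<delta> n j] by (auto simp: lin_zero[OF lin_H])
      moreover have "(if n = d then if k + e + \<delta> j = d then E j u v else 0 else 0) \<approx> (if n = d then H \<delta> d (E j u v) else 0)"
        using eqv_sym[OF d] by simp
      ultimately show "E j u v \<in> {X. ?F X \<in> Rel}"
        by (intro CollectI) (rule eqv_trans[OF eqv_trans])
    qed
    then show ?thesis by simp
  qed
  then show ?thesis by (simp add: homog_def)
qed

text \<open>Giving the \<open>j\<close>-th generator the degree of its image makes the map degree
  preserving. Its kernel is then graded again, as the next syzygy must be.\<close>

lemma H_D:
  assumes z: "\<And>j. z j \<in> fbvec r" "\<And>j. homog \<delta> (\<delta>' j) (z j)" and X: "X \<in> fbvec m"
  shows "H \<delta> n (D z X) \<approx> D z (H \<delta>' n X)"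
proof -
  let ?F = "\<lambda>X. H \<delta> n (D z X) - D z (H \<delta>' n X)"
  have zF: "z j \<in> Fin" for j
    using z(1) fbvec_Fin by blast
  have l: "lin sR sR ?F"
    by (auto intro!: lin_minus_lin lin_comp[OF lin_D lin_H] lin_comp[OF lin_H lin_D])
  have "X \<in> {X. ?F X \<in> Rel}"
  proof (rule fbvec_hom_induct[OF X subsp_vimage[OF l subsp_Rel]])
    show "Rel \<subseteq> {X. ?F X \<in> Rel}"
      by (auto intro!: H_Rel Rel_diff D_Rel zF)
    fix j u v d e assume u: "u \<in> Agr d" and v: "v \<in> Agr e"
    let ?R = "if d + e + \<delta>' j = n then L u (Rt v (z j)) else 0"
    have "D z (H \<delta>' n (E j u v)) \<approx> D z (if d + e + \<delta>' j = n then E j u v else 0)"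
      by (rule lin_eqv[OF lin_D D_Rel[OF zF] H_hom[OF u v]])
    also have "D z (if d + e + \<delta>' j = n then E j u v else 0) = ?R"
      by (simp add: D_E lin_zero[OF lin_D])
    finally have 1: "D z (H \<delta>' n (E j u v)) \<approx> ?R" .
    have 2: "H \<delta> n (L u (Rt v (z j))) \<approx> ?R"
    proof (cases "d + e \<le> n")
      case True
      have "H \<delta> n (L u (Rt v (z j))) \<approx> L u (H \<delta> (n - d) (Rt v (z j)))"
        using H_L[OF u Rt_fbvec[OF z(1)], of \<delta> n v j] True by simp
      also have "L u (H \<delta> (n - d) (Rt v (z j))) \<approx> L u (Rt v (H \<delta> (n - d - e) (z j)))"
        using lin_eqv[OF lin_L L_Rel H_Rt[OF v z(1)], of u \<delta> "n - d" j] True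
        by (simp add: le_diff_conv2)
      also have "L u (Rt v (H \<delta> (n - d - e) (z j))) \<approx> L u (Rt v (if n - d - e = \<delta>' j then z j else 0))"
        using z(2) by (intro lin_eqv[OF lin_L L_Rel] lin_eqv[OF lin_Rt Rt_Rel]) (simp_all add: homog_def)
      also have "L u (Rt v (if n - d - e = \<delta>' j then z j else 0)) = ?R"
        using True by (auto simp: lin_zero[OF lin_L] lin_zero[OF lin_Rt])
      finally show ?thesis .
    next
      \<comment> \<open>Here the truncated difference \<open>n - d - e\<close> could equal
        \<open>\<delta>' j\<close> by accident, so vanishing is read off from \<open>H_L\<close> and
        \<open>H_Rt\<close> directly.\<close>
      case False
      have "H \<delta> n (L u (Rt v (z j))) \<approx> (if d \<le> n then L u (H \<delta> (n - d) (Rt v (z j))) else 0)"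
        by (rule H_L[OF u Rt_fbvec[OF z(1)]])
      moreover have "L u (H \<delta> (n - d) (Rt v (z j))) \<in> Rel" if "d \<le> n"
      proof -
        have "\<not> e \<le> n - d"
          using False that by linarith
        then show ?thesis
          using H_Rt[OF v z(1), of \<delta> "n - d" j] by (intro L_Rel) simp
      qed
      ultimately have "H \<delta> n (L u (Rt v (z j))) \<in> Rel"
        using Rel_add by (fastforce split: if_splits)
      then show ?thesis using False by simp
    qed
    show "E j u v \<in> {X. ?F X \<in> Rel}"
      using eqv_trans[OF 2 eqv_sym[OF 1]] by (simp add: D_E)
  qed
  then show ?thesis by simp
qed

text \<open>As a right module \<open>A \<otimes> A\<close> is free on a \<open>K\<close>-basis of
  the left factor, so a right linear map amounts to a family of \<open>K\<close>-linear maps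
  \<open>\<eta> j\<close>.\<close>

definition rmap :: "(nat \<Rightarrow> 'a \<Rightarrow> nat \<Rightarrow> 'a \<times> 'a \<Rightarrow> 'k) \<Rightarrow> (nat \<Rightarrow> 'a \<times> 'a \<Rightarrow> 'k) \<Rightarrow> (nat \<Rightarrow> 'a \<times> 'a \<Rightarrow> 'k)" where
  "rmap \<eta> = lext sR (\<lambda>j u v. Rt v (\<eta> j u))"

lemma lin_rmap: "lin sR sR (rmap \<eta>)" and rmap_E: "rmap \<eta> (E j u v) = Rt v (\<eta> j u)"
  by (simp_all add: rmap_def lin_lext[OF vsR] lext_E[OF vsR])

lemma rmap_Rel:
  assumes \<eta>: "\<And>j. lin sA sR (\<eta> j)" "\<And>j u. \<eta> j u \<in> Fin" and X: "X \<in> Rel"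
  shows "rmap \<eta> X \<in> Rel"
proof (rule Rel_map[OF X lin_rmap])
  show "modlin sA Rel sR (\<lambda>u. rmap \<eta> (E j u v))" for j v
    unfolding rmap_E by (intro lin_modlin subsp_Rel lin_comp[OF \<eta>(1) lin_Rt])
  show "modlin sA Rel sR (\<lambda>v. rmap \<eta> (E j u v))" for j u
    unfolding rmap_E by (intro modlin_Rt \<eta>(2))
qed

lemma rmap_fbvec: "(\<And>j u. \<eta> j u \<in> fbvec s) \<Longrightarrow> X \<in> fbvec r \<Longrightarrow> rmap \<eta> X \<in> fbvec s"
  by (erule fbvec_map[OF _ lin_rmap subsp_fbvec]) (simp add: rmap_E Rt_fbvec)

lemma rmap_Rt:
  assumes "\<And>j u. \<eta> j u \<in> Fin" "X \<in> Fin"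
  shows "rmap \<eta> (Rt b X) = Rt b (rmap \<eta> X)"
  by (rule Fin_cong[OF assms(2) lin_comp[OF lin_Rt lin_rmap] lin_comp[OF lin_rmap lin_Rt]])
    (simp add: Rt_E rmap_E Rt_mul assms(1))

text \<open>Right linear maps preserve \<open>F A_+\<close>, which \<open>bar\<close> kills.
  Equality is strict because \<open>\<eta>\<close> is linear and \<open>bar\<close> takes values in
  genuine tuples over \<open>A\<close>.\<close>

lemma bar_rmap_cut:
  assumes \<eta>: "\<And>j. lin sA sR (\<eta> j)" "\<And>j u. \<eta> j u \<in> Fin" and X: "X \<in> Fin"
  shows "bar (rmap \<eta> X) = bar (rmap \<eta> (cut X))"
  by (rule Fin_cong[OF X lin_comp[OF lin_rmap lin_bar] lin_comp[OF lin_cut lin_comp[OF lin_rmap lin_bar]]])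
    (simp add: cut_E rmap_E bar_Rt \<eta>(2) lin_scale[OF \<eta>(1)] lin_scale[OF lin_bar] vector_space.vector_space_assms(4)[OF vsQ]
      lin_scale[OF lin_Rt])

section \<open>Syzygies\<close>

text \<open>\<open>Z\<close> is a graded sub-bimodule of the free bimodule of rank \<open>r\<close>, and \<open>p\<close> is a right linear
  projector onto \<open>Z\<close> up to \<open>Rel\<close>.\<close>

definition syzygy where
  "syzygy r \<delta> Z p \<longleftrightarrow> subsp sR Z \<and> Z \<subseteq> fbvec r \<and> Rel \<inter> fbvec r \<subseteq> Z \<and>
     (\<forall>a. \<forall>X\<in>Z. L a X \<in> Z) \<and> (\<forall>b. \<forall>X\<in>Z. Rt b X \<in> Z) \<and> (\<forall>n. \<forall>X\<in>Z. H \<delta> n X \<in> Z) \<and>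
     lin sR sR p \<and> (\<forall>X\<in>Rel. p X \<in> Rel) \<and> (\<forall>X\<in>fbvec r. p X \<in> Z) \<and>
     (\<forall>b. \<forall>X\<in>fbvec r. p (Rt b X) \<approx> Rt b (p X)) \<and> (\<forall>X\<in>Z. p X \<approx> X)"

lemma syzygyD:
  assumes "syzygy r \<delta> Z p"
  shows syzygy_subsp: "subsp sR Z"
    and syzygy_fbvec: "X \<in> Z \<Longrightarrow> X \<in> fbvec r"
    and syzygy_Rel: "X \<in> Rel \<Longrightarrow> X \<in> fbvec r \<Longrightarrow> X \<in> Z"
    and syzygy_L: "X \<in> Z \<Longrightarrow> L a X \<in> Z"
    and syzygy_Rt: "X \<in> Z \<Longrightarrow> Rt b X \<in> Z"
    and syzygy_H: "X \<in> Z \<Longrightarrow> H \<delta> n X \<in> Z"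
    and syzygy_lin: "lin sR sR p"
    and syzygy_proj_Rel: "X \<in> Rel \<Longrightarrow> p X \<in> Rel"
    and syzygy_proj: "X \<in> fbvec r \<Longrightarrow> p X \<in> Z"
    and syzygy_proj_Rt: "X \<in> fbvec r \<Longrightarrow> p (Rt b X) \<approx> Rt b (p X)"
    and syzygy_proj_id: "X \<in> Z \<Longrightarrow> p X \<approx> X"
  using assms unfolding syzygy_def by blast+

text \<open>The sub-bimodule generated by \<open>z 0\<close>, ..., \<open>z (m - 1)\<close>,
  saturated so that membership is invariant under \<open>\<approx>\<close>.\<close>

definition gen where
  "gen m z = {X. \<exists>Y\<in>fbvec m. D z Y \<approx> X}"

lemma subsp_gen: "subsp sR (gen m z)"
proof (rule subspI[OF vsR])
  show "0 \<in> gen m z"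
    unfolding gen_def using fbvec_0 by (auto simp: lin_zero[OF lin_D] intro!: bexI[of _ 0])
  fix X X' assume "X \<in> gen m z" "X' \<in> gen m z"
  then obtain Y Y' where Y: "Y \<in> fbvec m" "Y' \<in> fbvec m" "D z Y \<approx> X" "D z Y' \<approx> X'"
    unfolding gen_def by blast
  have "D z (Y + Y') \<approx> X + X'"
    using Rel_add[OF Y(3,4)] by (simp add: lin_add[OF lin_D] algebra_simps)
  then show "X + X' \<in> gen m z"
    unfolding gen_def using fbvec_add[OF Y(1,2)] by blast
next
  fix k X assume "X \<in> gen m z"
  then obtain Y where Y: "Y \<in> fbvec m" "D z Y \<approx> X"
    unfolding gen_def by blast
  have "D z (sR k Y) \<approx> sR k X"
    using Rel_scale[OF Y(2), of k] by (simp add: lin_scale[OF lin_D] VR.scale_right_diff_distrib)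
  then show "sR k X \<in> gen m z"
    unfolding gen_def using fbvec_scale[OF Y(1)] by blast
qed

lemma Rel_gen: "Rel \<subseteq> gen m z"
proof
  fix X assume "X \<in> Rel"
  then have "D z 0 \<approx> X"
    using Rel_diff[OF Rel_0] by (simp add: lin_zero[OF lin_D])
  then show "X \<in> gen m z"
    unfolding gen_def using fbvec_0 by blast
qed

lemma gen_D: "Y \<in> fbvec m \<Longrightarrow> D z Y \<in> gen m z"
  unfolding gen_def by (auto intro!: bexI[of _ Y])

lemma gen_Rt:
  assumes z: "\<And>j. z j \<in> Fin" and X: "X \<in> gen m z"
  shows "Rt b X \<in> gen m z"
proof -
  obtain Y where Y: "Y \<in> fbvec m" "D z Y \<approx> X"
    using X unfolding gen_def by blast
  have "D z (Rt b Y) \<approx> Rt b X"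
    unfolding D_Rt[OF z fbvec_Fin[OF Y(1)]] by (rule lin_eqv[OF lin_Rt Rt_Rel Y(2)])
  then show ?thesis
    unfolding gen_def using Rt_fbvec[OF Y(1)] by blast
qed

text \<open>Graded Nakayama lemma: \<open>Z = N + Z A\<^sub>+\<close> for the sub-bimodule \<open>N\<close> generated by the \<open>z j\<close>;
  the projector \<open>p\<close> is what writes elements of \<open>Z\<close> in the kernel of \<^term>\<open>bar\<close>
  as elements of \<open>Z A\<^sub>+\<close>.\<close>

lemma nakayama:
  assumes syz: "syzygy r \<delta> Z p"
    and z: "\<And>j. z j \<in> Z" "\<And>j. homog \<delta> (\<delta>' j) (z j)"
    and bars: "\<And>X. X \<in> Z \<Longrightarrow> \<exists>Y\<in>fbvec m. bar (D z Y) = bar X"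
    and X: "X \<in> Z"
  shows "X \<in> gen m z"
proof -
  note N = subsp_gen[of m z] and RN = Rel_gen[of m z]
  note p = syzygyD[OF syz]
  have zr: "z j \<in> fbvec r" for j
    using z(1) p(2) by blast
  have zF: "z j \<in> Fin" for j
    using zr fbvec_Fin by blast
  \<comment> \<open>The induction on the degree runs over all of \<open>Z\<close> at once, since it
    is applied to elements \<open>w\<close> other than \<open>X\<close>.\<close>
  have HN: "H \<delta> n X \<in> gen m z" if "X \<in> Z" for n X
    using that
  proof (induction n arbitrary: X rule: less_induct)
    case (less n)
    \<comment> \<open>The degree 0 part of \<open>v\<close> contributes only a relation; a part of
      degree \<open>d > 0\<close> shifts the question to the component of \<open>w\<close> in degree
      \<open>n - d\<close>.\<close>
    have key: "H \<delta> n (Rt v w - sR (\<epsilon> v) w) \<in> gen m z" if w: "w \<in> Z" for v w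
    proof -
      have wr: "w \<in> fbvec r" and wF: "w \<in> Fin"
        using w p(2) fbvec_Fin by blast+
      have l: "lin sA sR (\<lambda>v. sR (\<epsilon> v) w)"
        by (intro linI vsA vsR) (auto simp: eps_add eps_sA fun_eq_iff algebra_simps)
      have "modlin sA Rel sR (\<lambda>v. H \<delta> n (Rt v w - sR (\<epsilon> v) w))"
        using modlin_postcomp[OF modlin_diff[OF modlin_Rt[OF wF] lin_modlin[OF l subsp_Rel]]
            lin_H subsp_Rel H_Rel] .
      then have ml: "modlin sA (gen m z) sR (\<lambda>v. H \<delta> n (Rt v w - sR (\<epsilon> v) w))"
        by (rule modlin_mono[OF _ N RN])
      have "v \<in> {v. H \<delta> n (Rt v w - sR (\<epsilon> v) w) \<in> gen m z}"
      proof (rule hom_induct[OF modlin_subsp[OF ml]], rule CollectI)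
        fix d v assume v: "v \<in> Agr d"
        show "H \<delta> n (Rt v w - sR (\<epsilon> v) w) \<in> gen m z"
        proof (cases "d = 0")
          case True
          then obtain k where k: "v = sA k 1"
            using v by (auto simp: Agr_0 sA_def)
          have "Rt v w - sR (\<epsilon> v) w \<in> Rel"
            using modlin_Rt[OF wF] Rt_1[OF wF] unfolding k modlin_def by (simp add: eps_sA) metis
          then show ?thesis
            using H_Rel RN by blast
        next
          case False
          have "\<iota> (\<epsilon> v) = 0"
            using False by (simp add: iota_eps hcomp_hom[OF v])
          then have "\<epsilon> v = 0"
            by (rule iota_eq_0)
          then have eq: "Rt v w - sR (\<epsilon> v) w = Rt v w"
            by (simp add: fun_eq_iff)
          have "(if d \<le> n then Rt v (H \<delta> (n - d) w) else 0) \<in> gen m z"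
            using False less.IH[OF _ w] subsp_0[OF vsR N] by (simp add: gen_Rt[OF zF])
          then show ?thesis
            unfolding eq using eqv_mem[OF N RN H_Rt[OF v wr]] by blast
        qed
      qed
      then show ?thesis by simp
    qed
    \<comment> \<open>On a symbol the difference is \<open>w v - \<epsilon>(v) w\<close> with
      \<open>w = p (E j u 1)\<close>. The projector places \<open>w\<close> in \<open>Z\<close>,
      where \<open>key\<close> applies; the symbol itself lies only in the free bimodule.\<close>
    have cutN: "H \<delta> n (p W - p (cut W)) \<in> gen m z" if W: "W \<in> fbvec r" for W
    proof (rule fbvec_map[OF W _ N])
      show "lin sR sR (\<lambda>W. H \<delta> n (p W - p (cut W)))"
        by (intro lin_comp[OF lin_minus_lin lin_H] lin_comp[OF lin_cut] p(7))
      fix j u v assume j: "j < r"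
      let ?w = "p (E j u 1)"
      have "p (Rt v (E j u 1)) \<approx> Rt v ?w"
        by (rule p(10)[OF E_fbvec[OF j]])
      then have 1: "p (E j u v) \<approx> Rt v ?w"
        by (simp add: Rt_E)
      have "p (E j (sA (\<epsilon> v) u) 1) \<approx> p (sR (\<epsilon> v) (E j u 1))"
        by (rule lin_eqv[OF p(7,8) E_sA_left])
      then have 2: "p (cut (E j u v)) \<approx> sR (\<epsilon> v) ?w"
        by (simp add: cut_E lin_scale[OF p(7)])
      show "H \<delta> n (p (E j u v) - p (cut (E j u v))) \<in> gen m z"
        by (rule eqv_mem[OF N RN lin_eqv[OF lin_H H_Rel eqv_diff[OF 1 2]] key[OF p(9)[OF E_fbvec[OF j]]]])
    qed
    obtain Y where Y: "Y \<in> fbvec m" "bar (D z Y) = bar X"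
      using bars[OF less.prems] by blast
    have DY: "D z Y \<in> Z"
      by (rule D_mem[OF Y(1) p(1) z(1)]) (auto intro: p(4,5))
    \<comment> \<open>Subtracting an element generated by the \<open>z j\<close> leaves one with
      reduction zero. Its \<open>cut\<close> is then a relation, so \<open>W\<close> has the form
      treated by \<open>cutN\<close>.\<close>
    define W where "W = X - D z Y"
    have WZ: "W \<in> Z"
      unfolding W_def by (rule subsp_diff[OF vsR p(1) less.prems DY])
    have Wr: "W \<in> fbvec r"
      by (rule p(2)[OF WZ])
    have "bar W = 0"
      using Y(2) by (simp add: W_def lin_diff[OF lin_bar])
    then have "p (cut W) \<in> Rel"
      by (intro p(8) cut_Rel[OF Wr])
    then have "W \<approx> p W - p (cut W)"
      using eqv_diff[OF eqv_sym[OF p(11)[OF WZ]], of 0 "p (cut W)"] Rel_diff[OF Rel_0] by simp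
    then have "H \<delta> n W \<approx> H \<delta> n (p W - p (cut W))"
      by (intro lin_eqv[OF lin_H H_Rel])
    then have "H \<delta> n W \<in> gen m z"
      using cutN[OF Wr] by (rule eqv_mem[OF N RN])
    moreover have "H \<delta> n (D z Y) \<in> gen m z"
      by (rule eqv_mem[OF N RN H_D[OF zr z(2) Y(1)] gen_D[OF H_fbvec[OF Y(1)]]])
    ultimately have "H \<delta> n W + H \<delta> n (D z Y) \<in> gen m z"
      by (rule subsp_add[OF vsR N])
    moreover have "H \<delta> n X = H \<delta> n W + H \<delta> n (D z Y)"
      by (simp add: W_def lin_diff[OF lin_H])
    ultimately show ?case by (simp only:)
  qed
  obtain M where "(\<Sum>n<M. H \<delta> n X) \<approx> X"
    using H_sum[OF p(2)[OF X]] by blast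
  then show ?thesis
    by (rule eqv_mem[OF N RN eqv_sym]) (intro subsp_sum[OF vsR N] HN X)
qed

text \<open>Up to relations each \<open>y k\<close> is the sum of its components. These lie in
  \<open>Z\<close> because \<open>Z\<close> is graded, and their reductions still span that of
  \<open>Z\<close>, so Nakayama applies to them.\<close>

lemma homogeneous_generators:
  fixes l :: nat
  assumes syz: "syzygy r \<delta> Z p" and gens: "\<forall>k. y k \<in> Z"
    and span: "\<forall>X\<in>Z. \<exists>a. bar X = (\<Sum>k<l. aQ (a k) (bar (y k)))"
  shows "\<exists>m z \<delta>'. (\<forall>j. z j \<in> Z) \<and> (\<forall>j. homog \<delta> (\<delta>' j) (z j)) \<and> Z \<subseteq> gen m z"
proof -
  have y: "y k \<in> Z" for k
    using gens by blast
  note p = syzygyD[OF syz]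
  have "\<exists>N0. \<forall>k. \<forall>N\<ge>N0 k. (\<Sum>n<N. H \<delta> n (y k)) \<approx> y k"
    by (intro choice allI H_sum[OF p(2)[OF y]])
  then obtain N0 where N0: "\<And>k N. N \<ge> N0 k \<Longrightarrow> (\<Sum>n<N. H \<delta> n (y k)) \<approx> y k"
    by blast
  define N where "N = Suc (\<Sum>k<l. N0 k)"
  have N: "(\<Sum>n<N. H \<delta> n (y k)) \<approx> y k" if "k < l" for k
  proof (rule N0)
    have "N0 k \<le> (\<Sum>k<l. N0 k)"
      using that by (intro member_le_sum) auto
    then show "N0 k \<le> N" by (simp add: N_def)
  qed
  have Npos: "N > 0"
    by (simp add: N_def)
  \<comment> \<open>The index \<open>j = k * N + n\<close> stands for the degree \<open>n\<close>
    component of \<open>y k\<close>, so the degree is \<open>j mod N\<close>. Indices from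
    \<open>l * N\<close> on are filler that still lies in \<open>Z\<close>.\<close>
  define z where "z j = H \<delta> (j mod N) (y (j div N))" for j
  define \<delta>' where "\<delta>' j = j mod N" for j
  have zZ: "z j \<in> Z" for j
    unfolding z_def by (intro p(6) y)
  have zh: "homog \<delta> (\<delta>' j) (z j)" for j
    unfolding z_def \<delta>'_def by (rule homog_H[OF p(2)[OF y]])
  have zF: "z j \<in> Fin" for j
    using p(2)[OF zZ] by (rule fbvec_Fin)
  have z_idx: "z (k * N + n) = H \<delta> n (y k)" if "n < N" for k n
    using that by (simp add: z_def)
  have "\<exists>Y\<in>fbvec (l * N). bar (D z Y) = bar X" if X: "X \<in> Z" for X
  proof -
    obtain a where a: "bar X = (\<Sum>k<l. aQ (a k) (bar (y k)))"
      using span X by blast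
    define Y where "Y = (\<Sum>k<l. \<Sum>n<N. E (k * N + n) (a k) 1)"
    have "k * N + n < l * N" if "k < l" "n < N" for k n
    proof -
      have "k * N + n < Suc k * N" using that by simp
      also have "\<dots> \<le> l * N" using that by (intro mult_le_mono1) simp
      finally show ?thesis .
    qed
    then have "Y \<in> fbvec (l * N)"
      unfolding Y_def by (intro fbvec_sum E_fbvec) auto
    moreover have "bar (D z Y) = bar X"
    proof -
      have "D z Y = (\<Sum>k<l. L (a k) (\<Sum>n<N. H \<delta> n (y k)))"
        unfolding Y_def lin_sum[OF lin_D] D_E Rt_1[OF zF] lin_sum[OF lin_L]
        by (intro sum.cong refl) (simp add: z_idx)
      then have "bar (D z Y) = (\<Sum>k<l. bar (L (a k) (\<Sum>n<N. H \<delta> n (y k))))"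
        by (simp only: lin_sum[OF lin_bar])
      also have "\<dots> = (\<Sum>k<l. aQ (a k) (bar (y k)))"
      proof (intro sum.cong refl)
        fix k assume "k \<in> {..<l}"
        then have "bar (\<Sum>n<N. H \<delta> n (y k)) = bar (y k)"
          using N by (intro bar_eqv) simp
        moreover have "(\<Sum>n<N. H \<delta> n (y k)) \<in> fbvec r"
          by (intro fbvec_sum H_fbvec p(2) y)
        ultimately show "bar (L (a k) (\<Sum>n<N. H \<delta> n (y k))) = aQ (a k) (bar (y k))"
          by (simp only: bar_L[OF fbvec_Fin])
      qed
      finally show ?thesis by (simp only: a)
    qed
    ultimately show ?thesis by blast
  qed
  then have "Z \<subseteq> gen (l * N) z"
    by (intro subsetI nakayama[OF syz zZ zh])
  then show ?thesis
    using zZ zh by blast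
qed

text \<open>Preimages under \<open>D z\<close> chosen pointwise need not depend linearly on
  \<open>u\<close>. They are chosen on a \<open>K\<close>-basis of \<open>A\<close> and extended;
  agreement with \<open>\<phi>\<close> spreads from the basis because \<open>\<phi>\<close> is
  linear modulo \<open>Rel\<close>.\<close>

lemma K_linear_lift:
  assumes p: "modlin sA Rel sR \<phi>" and z: "\<And>j. z j \<in> Fin" and \<phi>: "\<And>u. \<phi> u \<in> gen m z"
  shows "\<exists>\<eta>. lin sA sR \<eta> \<and> (\<forall>u. \<eta> u \<in> fbvec m \<and> D z (\<eta> u) \<approx> \<phi> u)"
proof -
  interpret VA: vector_space sA by (rule vsA)
  obtain B where B: "VA.independent B" "UNIV \<subseteq> VA.span B"
    using VA.maximal_independent_subset[of UNIV] by blast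
  have "\<exists>h. \<forall>u. h u \<in> fbvec m \<and> D z (h u) \<approx> \<phi> u"
    using \<phi> unfolding gen_def by (intro choice) blast
  then obtain h where h: "\<And>u. h u \<in> fbvec m" "\<And>u. D z (h u) \<approx> \<phi> u"
    by blast
  have pair: "vector_space_pair sA (sR :: 'k \<Rightarrow> (nat \<Rightarrow> 'a \<times> 'a \<Rightarrow> 'k) \<Rightarrow> _)"
    using vsR vsA by (simp add: vector_space_pair_def)
  obtain \<eta> where \<eta>: "lin sA sR \<eta>" "\<forall>u\<in>B. \<eta> u = h u"
    using vector_space_pair.linear_independent_extend[OF pair B(1)] by blast
  have ml: "modlin sA Rel sR (\<lambda>u. D z (\<eta> u) - \<phi> u)"
    by (intro modlin_diff p lin_modlin[OF lin_comp[OF \<eta>(1) lin_D] subsp_Rel])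
  have "VA.span B \<subseteq> {u. D z (\<eta> u) - \<phi> u \<in> Rel}"
    by (rule VA.span_minimal[OF _ modlin_subsp[OF ml]]) (use \<eta>(2) h(2) in auto)
  moreover have "VA.span B \<subseteq> {u. \<eta> u \<in> fbvec m}"
    by (rule VA.span_minimal[OF _ subsp_vimage[OF \<eta>(1) subsp_fbvec]]) (use \<eta>(2) h(1) in auto)
  ultimately show ?thesis
    using B(2) \<eta>(1) by blast
qed

text \<open>A right linear \<open>s\<close> with \<open>D z \<circ> s \<approx> p\<close> is a
  section of \<open>D z\<close> over \<open>Z\<close>, and \<open>1 - s D\<close> projects onto the
  new kernel. Hence exactness survives reduction: the reduced kernel is the whole kernel of the
  reduced map.\<close>

lemma next_syzygy:
  fixes l :: nat
  assumes syz: "syzygy r \<delta> Z p" and gens: "\<forall>k. y k \<in> Z"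
    and span: "\<forall>X\<in>Z. \<exists>a. bar X = (\<Sum>k<l. aQ (a k) (bar (y k)))"
  shows "\<exists>m z \<delta>' p'. (\<forall>j. z j \<in> Z) \<and> Z \<subseteq> gen m z \<and>
    syzygy m \<delta>' {X \<in> fbvec m. D z X \<in> Rel} p' \<and>
    bar ` {X \<in> fbvec m. D z X \<in> Rel} = {q \<in> fvec m. lcomb m (\<lambda>j. bar (z j)) q = 0}"
proof -
  note p = syzygyD[OF syz]
  obtain m z \<delta>' where z: "\<And>j. z j \<in> Z" "\<And>j. homog \<delta> (\<delta>' j) (z j)" "Z \<subseteq> gen m z"
    using homogeneous_generators[OF assms] by blast
  have zr: "z j \<in> fbvec r" and zF: "z j \<in> Fin" for j
    using p(2)[OF z(1)] fbvec_Fin by blast+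
  have DZ: "D z X \<in> Z" if "X \<in> fbvec m" for X
    by (rule D_mem[where z = z, OF that p(1) z(1)]) (auto intro: p(4,5))
  \<comment> \<open>The symbols \<open>E j u 1\<close> generate the free bimodule as a right module,
    so lifting \<open>p\<close> on them determines \<open>s\<close>. Slots from \<open>r\<close> on
    get the value 0, since \<open>rmap\<close> expects a total family.\<close>
  have "\<exists>\<eta>. \<forall>j. lin sA sR (\<eta> j) \<and> (\<forall>u. \<eta> j u \<in> fbvec m \<and> (j < r \<longrightarrow> D z (\<eta> j u) \<approx> p (E j u 1)))"
  proof (intro choice allI)
    fix j
    show "\<exists>\<eta>. lin sA sR \<eta> \<and> (\<forall>u. \<eta> u \<in> fbvec m \<and> (j < r \<longrightarrow> D z (\<eta> u) \<approx> p (E j u 1)))"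
    proof (cases "j < r")
      case True
      have "modlin sA Rel sR (\<lambda>u. p (E j u 1))"
        by (rule modlin_postcomp[OF modlin_E_left p(7) subsp_Rel p(8)])
      moreover have "p (E j u 1) \<in> gen m z" for u
        using p(9)[OF E_fbvec[OF True]] z(3) by blast
      ultimately have "\<exists>\<eta>. lin sA sR \<eta> \<and> (\<forall>u. \<eta> u \<in> fbvec m \<and> D z (\<eta> u) \<approx> p (E j u 1))"
        by (rule K_linear_lift[OF _ zF])
      then show ?thesis
        using True by simp
    next
      case False
      have "lin sA sR (\<lambda>u. 0 :: nat \<Rightarrow> 'a \<times> 'a \<Rightarrow> 'k)"
        by (intro linI vsA vsR) (auto simp: fun_eq_iff)
      then show ?thesis
        using False fbvec_0 by (intro exI[of _ "\<lambda>u. 0"]) simp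
    qed
  qed
  then obtain \<eta> where \<eta>: "\<And>j. lin sA sR (\<eta> j)" "\<And>j u. \<eta> j u \<in> fbvec m"
    "\<And>j u. j < r \<Longrightarrow> D z (\<eta> j u) \<approx> p (E j u 1)"
    by blast
  have \<eta>F: "\<eta> j u \<in> Fin" for j u
    using \<eta>(2) by (rule fbvec_Fin)
  let ?s = "rmap \<eta>"
  note s_Rel = rmap_Rel[where \<eta> = \<eta>, OF \<eta>(1) \<eta>F] and s_Rt = rmap_Rt[where \<eta> = \<eta>, OF \<eta>F] and s_fbvec = rmap_fbvec[where \<eta> = \<eta>, OF \<eta>(2)]
  have Ds: "D z (?s W) \<approx> p W" if "W \<in> fbvec r" for W
  proof (rule fbvec_cong_mod[OF that lin_modlin[OF lin_comp[OF lin_rmap lin_D] subsp_Rel] lin_modlin[OF p(7) subsp_Rel]])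
    fix j u v assume j: "j < r"
    have "D z (?s (E j u v)) = Rt v (D z (\<eta> j u))"
      by (simp add: rmap_E D_Rt[where z = z, OF zF \<eta>F])
    also have "Rt v (D z (\<eta> j u)) \<approx> Rt v (p (E j u 1))"
      by (rule lin_eqv[OF lin_Rt Rt_Rel \<eta>(3)[OF j]])
    also have "Rt v (p (E j u 1)) \<approx> p (Rt v (E j u 1))"
      by (rule eqv_sym[OF p(10)[OF E_fbvec[OF j]]])
    also have "p (Rt v (E j u 1)) = p (E j u v)"
      by (simp add: Rt_E)
    finally show "D z (?s (E j u v)) \<approx> p (E j u v)" .
  qed
  let ?Z = "{X \<in> fbvec m. D z X \<in> Rel}"
  let ?p = "\<lambda>X. X - ?s (D z X)"
  have DsD: "D z (?s (D z X)) \<approx> D z X" if "X \<in> fbvec m" for X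
    using eqv_trans[OF Ds[OF p(2)[OF DZ[OF that]]] p(11)[OF DZ[OF that]]] .
  have p'Z: "?p X \<in> ?Z" if X: "X \<in> fbvec m" for X
    using eqv_sym[OF DsD[OF X]] s_fbvec[OF p(2)[OF DZ[OF X]]] X
    by (simp add: lin_diff[OF lin_D] fbvec_diff)
  have syz': "syzygy m \<delta>' ?Z ?p"
    unfolding syzygy_def
  proof (intro conjI allI ballI)
    show "subsp sR ?Z"
    proof (rule subspI[OF vsR])
      show "0 \<in> ?Z"
        by (simp add: fbvec_0 lin_zero[OF lin_D])
      show "X + Y \<in> ?Z" if "X \<in> ?Z" "Y \<in> ?Z" for X Y
        using that fbvec_add[of X m Y] Rel_add[of "D z X" "D z Y"] by (simp only: mem_Collect_eq lin_add[OF lin_D])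
      show "sR k X \<in> ?Z" if "X \<in> ?Z" for k X
        using that fbvec_scale[of X m k] Rel_scale[of "D z X" k] by (simp only: mem_Collect_eq lin_scale[OF lin_D])
    qed
    show "Rel \<inter> fbvec m \<subseteq> ?Z"
      by (auto intro: D_Rel[where z = z, OF zF])
    show "lin sR sR ?p"
      by (rule lin_minus_lin[OF lin_ident[OF vsR] lin_comp[OF lin_D lin_rmap]])
    show "?p X \<in> Rel" if "X \<in> Rel" for X
      by (rule Rel_diff[OF that s_Rel[OF D_Rel[where z = z, OF zF that]]])
    show "?p X \<in> ?Z" if "X \<in> fbvec m" for X
      by (rule p'Z[OF that])
    show "?p (Rt b X) \<approx> Rt b (?p X)" if "X \<in> fbvec m" for b X
      using D_Rt[where z = z, OF zF fbvec_Fin[OF that], of b] s_Rt[OF fbvec_Fin[OF p(2)[OF DZ[OF that]]], of b]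
      by (simp add: lin_diff[OF lin_Rt])
    fix X assume X: "X \<in> ?Z"
    then have Xm: "X \<in> fbvec m" and XR: "D z X \<in> Rel" by simp_all
    show "L a X \<in> ?Z" for a
      using L_fbvec[OF Xm] L_Rel[OF XR] D_L[where z = z, OF zF fbvec_Fin[OF Xm]] by simp
    show "Rt b X \<in> ?Z" for b
      using Rt_fbvec[OF Xm] Rt_Rel[OF XR] D_Rt[where z = z, OF zF fbvec_Fin[OF Xm]] by simp
    show "H \<delta>' n X \<in> ?Z" for n
      using H_fbvec[OF Xm] eqv_mem[OF subsp_Rel subset_refl eqv_sym[OF H_D[where z = z and \<delta>' = \<delta>', OF zr z(2) Xm]] H_Rel[OF XR]]
      by simp
    show "?p X \<approx> X"
      using Rel_diff[OF Rel_0 s_Rel[OF XR]] by simp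
  qed blast
  have "bar ` ?Z = {q \<in> fvec m. lcomb m (\<lambda>j. bar (z j)) q = 0}"
  proof (intro equalityI subsetI)
    fix q assume "q \<in> bar ` ?Z"
    then obtain X where X: "X \<in> fbvec m" "D z X \<in> Rel" "q = bar X" by blast
    then show "q \<in> {q \<in> fvec m. lcomb m (\<lambda>j. bar (z j)) q = 0}"
      using bar_Rel[OF X(2)] bar_fvec[OF X(1)] by (simp add: bar_D[where z = z, OF zF X(1)])
  next
    fix q assume "q \<in> {q \<in> fvec m. lcomb m (\<lambda>j. bar (z j)) q = 0}"
    then have q: "q \<in> fvec m" "lcomb m (\<lambda>j. bar (z j)) q = 0" by simp_all
    \<comment> \<open>This lift of \<open>q\<close> need not lie in the kernel, but its projection
      does. The correction \<open>s (D z X)\<close> reduces to zero because \<open>D z X\<close>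
      does.\<close>
    let ?X = "lift1 m q"
    have X: "?X \<in> fbvec m"
      by (rule lift1_fbvec)
    have W: "D z ?X \<in> fbvec r"
      by (rule p(2)[OF DZ[OF X]])
    have "bar (D z ?X) = 0"
      by (simp add: bar_D[where z = z, OF zF X] bar_lift1[OF q(1)] q(2))
    then have "?s (cut (D z ?X)) \<in> Rel"
      by (intro s_Rel cut_Rel[OF W])
    then have "bar (?s (D z ?X)) = 0"
      using bar_rmap_cut[where \<eta> = \<eta>, OF \<eta>(1) \<eta>F fbvec_Fin[OF W]] bar_Rel by simp
    then have "bar (?p ?X) = q"
      by (simp add: lin_diff[OF lin_bar] bar_lift1[OF q(1)])
    then show "q \<in> bar ` ?Z"
      by (intro image_eqI[OF _ p'Z[OF X]]) (rule sym)
  qed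
  then show ?thesis
    using z(1,3) syz' by (intro exI conjI allI)
qed

text \<open>\<open>f\<close> and \<open>g\<close> are chain maps between the given resolution of \<open>K\<close> and the one obtained from
  the bimodules by applying \<^term>\<open>bar\<close>; \<open>u\<close> stands for \<open>1 - f g - h d\<close> with \<open>h\<close> a homotopy.\<close>

definition compare where
  "compare r Z rP ZP f g u \<longleftrightarrow> llin rP r f \<and> llin r rP g \<and> llin r r u \<and>
     (\<forall>v\<in>ZP. f v \<in> bar ` Z) \<and> (\<forall>q\<in>bar ` Z. g q \<in> ZP) \<and> (\<forall>q\<in>fvec r. u q \<in> bar ` Z) \<and>
     (\<forall>q\<in>bar ` Z. u q = q - f (g q))"

lemma compareD:
  assumes "compare r Z rP ZP f g u"
  shows "llin rP r f" "llin r rP g" "llin r r u" "v \<in> ZP \<Longrightarrow> f v \<in> bar ` Z" "q \<in> bar ` Z \<Longrightarrow> g q \<in> ZP"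
    "q \<in> fvec r \<Longrightarrow> u q \<in> bar ` Z" "q \<in> bar ` Z \<Longrightarrow> u q = q - f (g q)"
  using assms unfolding compare_def by blast+

lemma next_stage:
  assumes syz: "syzygy r \<delta> Z p" and cmp: "compare r Z rP ZP f g u"
    and d: "llin rP' rP d" "d ` fvec rP' = ZP"
  shows "\<exists>m z \<delta>' p' f' g' u'. (\<forall>j. z j \<in> Z) \<and> Z \<subseteq> gen m z \<and>
    syzygy m \<delta>' {X \<in> fbvec m. D z X \<in> Rel} p' \<and>
    compare m {X \<in> fbvec m. D z X \<in> Rel} rP' {v \<in> fvec rP'. d v = 0} f' g' u'"
proof -
  note p = syzygyD[OF syz] and c = compareD[OF cmp]
  have fd: "llin rP' r (\<lambda>v. f (d v))"
    by (rule llin_comp[OF d(1) c(1)])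
  \<comment> \<open>The first \<open>rP'\<close> entries span the values \<open>f (g q)\<close>,
    because \<open>g q = d x\<close> for some \<open>x\<close>; the remaining \<open>r\<close>
    entries span the values \<open>u q\<close>.\<close>
  define b where "b k = (if k < rP' then f (d (ue k)) else u (ue (k - rP')))" for k
  have b: "b k \<in> bar ` Z" if "k < rP' + r" for k
  proof (cases "k < rP'")
    case True
    then show ?thesis
      using c(4) d(2) ue_fvec[OF True] by (simp add: b_def) blast
  next
    case False
    then show ?thesis
      using c(6)[OF ue_fvec, of "k - rP'"] that by (simp add: b_def)
  qed
  have "\<exists>y. \<forall>k. y k \<in> Z \<and> (k < rP' + r \<longrightarrow> bar (y k) = b k)"
  proof (intro choice allI)
    fix k
    show "\<exists>y. y \<in> Z \<and> (k < rP' + r \<longrightarrow> bar y = b k)"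
    proof (cases "k < rP' + r")
      case True
      then show ?thesis using b[OF True] by force
    next
      case False
      then show ?thesis using subsp_0[OF vsR p(1)] by blast
    qed
  qed
  then obtain y where y: "\<And>k. y k \<in> Z" "\<And>k. k < rP' + r \<Longrightarrow> bar (y k) = b k"
    by blast
  have span: "\<exists>a. bar X = (\<Sum>k<rP' + r. aQ (a k) (bar (y k)))" if X: "X \<in> Z" for X
  proof -
    let ?q = "bar X"
    have qZ: "?q \<in> bar ` Z" and qr: "?q \<in> fvec r"
      using X bar_fvec[OF p(2)[OF X]] by blast+
    obtain x where x: "x \<in> fvec rP'" "g ?q = d x"
      using c(5)[OF qZ] d(2) by blast
    define a where "a k = (if k < rP' then x k else ?q (k - rP'))" for k
    have "(\<Sum>k<rP' + r. aQ (a k) (bar (y k))) = (\<Sum>k<rP' + r. aQ (a k) (b k))"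
      by (intro sum.cong refl) (simp add: y(2))
    also have "\<dots> = lcomb rP' (\<lambda>k. f (d (ue k))) x + lcomb r (\<lambda>k. u (ue k)) ?q"
      unfolding sum_lessThan_plus lcomb_def by (simp add: a_def b_def)
    also have "\<dots> = f (g ?q) + u ?q"
      by (simp only: llin_expand[OF fd x(1), symmetric] llin_expand[OF c(3) qr, symmetric] x(2))
    also have "\<dots> = ?q"
      using c(7)[OF qZ] by simp
    finally show ?thesis by (intro exI[of _ a]) simp
  qed
  have spans: "\<forall>k. y k \<in> Z" "\<forall>X\<in>Z. \<exists>a. bar X = (\<Sum>k<rP' + r. aQ (a k) (bar (y k)))"
    using y(1) span by blast+
  obtain m z \<delta>' p' where zs: "\<forall>j. z j \<in> Z" "Z \<subseteq> gen m z"
    "syzygy m \<delta>' {X \<in> fbvec m. D z X \<in> Rel} p'"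
    "bar ` {X \<in> fbvec m. D z X \<in> Rel} = {q \<in> fvec m. lcomb m (\<lambda>j. bar (z j)) q = 0}"
    using next_syzygy[OF syz spans] by (elim exE conjE) (rule that)
  note z = zs(1)[rule_format] zs(2-4)
  let ?d = "lcomb m (\<lambda>j. bar (z j))"
  have zF: "z j \<in> Fin" for j
    using fbvec_Fin[OF p(2)[OF z(1)]] .
  have ld: "llin m r ?d"
    by (intro llin_lcomb bar_fvec p(2) z(1))
  have img: "?d ` fvec m = bar ` Z"
  proof (intro equalityI subsetI)
    fix q assume "q \<in> ?d ` fvec m"
    then obtain v where v: "v \<in> fvec m" "q = ?d v" by blast
    have "D z (lift1 m v) \<in> Z"
      by (rule D_mem[where z = z, OF lift1_fbvec p(1) z(1)]) (auto intro: p(4,5))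
    moreover have "bar (D z (lift1 m v)) = q"
      by (simp add: bar_D[where z = z, OF zF lift1_fbvec] bar_lift1[OF v(1)] v(2))
    ultimately show "q \<in> bar ` Z" by blast
  next
    fix q assume "q \<in> bar ` Z"
    then obtain X where X: "X \<in> Z" "q = bar X" by blast
    then obtain Y where Y: "Y \<in> fbvec m" "D z Y \<approx> X"
      using z(2) unfolding gen_def by blast
    have "q = ?d (bar Y)"
      using bar_eqv[OF Y(2)] X(2) by (simp add: bar_D[where z = z, OF zF Y(1)])
    then show "q \<in> ?d ` fvec m"
      using bar_fvec[OF Y(1)] by blast
  qed
  obtain f' where f': "llin rP' m f'" "\<And>v. v \<in> fvec rP' \<Longrightarrow> ?d (f' v) = f (d v)"
  proof (rule llin_lift[OF fd ld])
    show "(\<lambda>v. f (d v)) ` fvec rP' \<subseteq> ?d ` fvec m"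
      unfolding img using c(4) d(2) by blast
  qed blast
  obtain g' where g': "llin m rP' g'" "\<And>q. q \<in> fvec m \<Longrightarrow> d (g' q) = g (?d q)"
  proof (rule llin_lift[OF llin_comp[OF ld c(2)] d(1)])
    show "(\<lambda>q. g (?d q)) ` fvec m \<subseteq> d ` fvec rP'"
      using c(5) img d(2) by blast
  qed blast
  obtain h where h: "llin r m h" "\<And>q. q \<in> fvec r \<Longrightarrow> ?d (h q) = u q"
  proof (rule llin_lift[OF c(3) ld])
    show "u ` fvec r \<subseteq> ?d ` fvec m"
      unfolding img using c(6) by blast
  qed blast
  \<comment> \<open>The new \<open>1 - f g - h d\<close>. It lands in the kernel because
    \<open>?d \<circ> h = u\<close> and \<open>u = 1 - f g\<close> on the image of
    \<open>?d\<close>. Carrying \<open>u\<close> along thus suffices: the next homotopy is simply a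
    lift of it.\<close>
  let ?u = "\<lambda>q. (q - f' (g' q)) - h (?d q)"
  have "compare m {X \<in> fbvec m. D z X \<in> Rel} rP' {v \<in> fvec rP'. d v = 0} f' g' ?u"
    unfolding compare_def z(4)
  proof (intro conjI ballI)
    show "llin rP' m f'" "llin m rP' g'"
      by (fact f'(1) g'(1))+
    show lu: "llin m m ?u"
      by (intro llin_sub llin_ident llin_comp[OF g'(1) f'(1)] llin_comp[OF ld h(1)])
    show "f' v \<in> {q \<in> fvec m. ?d q = 0}" if "v \<in> {v \<in> fvec rP'. d v = 0}" for v
      using that llin_mem[OF f'(1)] f'(2) llin_0[OF c(1)] by simp
    show "g' q \<in> {v \<in> fvec rP'. d v = 0}" if "q \<in> {q \<in> fvec m. ?d q = 0}" for q
      using that llin_mem[OF g'(1)] g'(2) llin_0[OF c(2)] by simp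
    show "?u q = q - f' (g' q)" if "q \<in> {q \<in> fvec m. ?d q = 0}" for q
      using that llin_0[OF h(1)] by simp
    show "?u q \<in> {q \<in> fvec m. ?d q = 0}" if q: "q \<in> fvec m" for q
    proof -
      have mem: "g' q \<in> fvec rP'" "f' (g' q) \<in> fvec m" "?d q \<in> fvec r" "h (?d q) \<in> fvec m"
        by (auto intro: llin_mem[OF g'(1)] llin_mem[OF f'(1)] llin_mem[OF ld] llin_mem[OF h(1)] q)
      have dq: "?d q \<in> bar ` Z"
        using img q by blast
      have "?d (?u q) = ?d q - ?d (f' (g' q)) - ?d (h (?d q))"
        by (simp only: llin_minus[OF ld fvec_diff[OF q mem(2)] mem(4)] llin_minus[OF ld q mem(2)])
      also have "\<dots> = ?d q - f (g (?d q)) - u (?d q)"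
        by (simp only: f'(2)[OF mem(1)] g'(2)[OF q] h(2)[OF mem(3)])
      also have "\<dots> = 0"
        using c(7)[OF dq] by simp
      finally show ?thesis
        using llin_mem[OF lu q] by simp
    qed
  qed
  then show ?thesis
    using zs(1-3) by (intro exI conjI)
qed

section \<open>The base of the resolution\<close>

definition \<mu> :: "(nat \<Rightarrow> 'a \<times> 'a \<Rightarrow> 'k) \<Rightarrow> 'a" where
  "\<mu> = lext sA (\<lambda>j u v. u \<cdot> v)"

lemma lin_mu: "lin sR sA \<mu>" and mu_E: "\<mu> (E j u v) = u \<cdot> v"
  by (simp_all add: \<mu>_def lin_lext[OF vsA] lext_E[OF vsA])

lemma mu_Rel:
  assumes "X \<in> Rel"
  shows "\<mu> X = 0"
proof -
  have "\<mu> X \<in> {0}"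
    by (rule Rel_map[OF assms lin_mu]; rule lin_modlin[OF _ subsp_zero[OF vsA]])
      (simp_all add: mu_E lin_mul_left lin_mul_right)
  then show ?thesis by simp
qed

lemma mu_L: "X \<in> Fin \<Longrightarrow> \<mu> (L a X) = a \<cdot> \<mu> X"
  by (erule Fin_cong[OF _ lin_comp[OF lin_L lin_mu] lin_comp[OF lin_mu lin_mul_left]])
    (simp add: L_E mu_E mul_assoc)

lemma mu_Rt: "X \<in> Fin \<Longrightarrow> \<mu> (Rt b X) = \<mu> X \<cdot> b"
  by (erule Fin_cong[OF _ lin_comp[OF lin_Rt lin_mu] lin_comp[OF lin_mu lin_mul_right]])
    (simp add: Rt_E mu_E mul_assoc)

lemma mu_H:
  assumes X: "X \<in> fbvec r"
  shows "\<mu> (H (\<lambda>_. 0) n X) = hcomp Agr (\<mu> X) n"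
proof -
  let ?F = "\<lambda>X. \<mu> (H (\<lambda>_. 0) n X) - hcomp Agr (\<mu> X) n"
  have l: "lin sR sA ?F"
    by (intro lin_minus_lin lin_comp[OF lin_H lin_mu] lin_comp[OF lin_mu lin_hcomp])
  have "X \<in> {X. ?F X \<in> {0}}"
  proof (rule fbvec_hom_induct[OF X subsp_vimage[OF l subsp_zero[OF vsA]]])
    show "Rel \<subseteq> {X. ?F X \<in> {0}}"
      using lin_zero[OF lin_hcomp] by (auto simp: mu_Rel H_Rel)
    fix j u v d e assume u: "u \<in> Agr d" and v: "v \<in> Agr e"
    have "\<mu> (H (\<lambda>_. 0) n (E j u v)) = \<mu> (if d + e = n then E j u v else 0)"
      using mu_Rel[OF H_hom[OF u v, of "\<lambda>_. 0" n j]] by (simp add: lin_diff[OF lin_mu])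
    then show "E j u v \<in> {X. ?F X \<in> {0}}"
      by (simp add: mu_E hcomp_hom[OF Agr_mul[OF u v]] lin_zero[OF lin_mu])
  qed
  then show ?thesis by simp
qed

text \<open>The composite of \<open>\<mu>\<close> with its right linear section
  \<open>a \<mapsto> 1 \<otimes> a\<close>. It is given on symbols because
  \<open>X \<mapsto> E 0 1 (\<mu> X)\<close> is linear only modulo \<open>Rel\<close>.\<close>

definition \<sigma> :: "(nat \<Rightarrow> 'a \<times> 'a \<Rightarrow> 'k) \<Rightarrow> (nat \<Rightarrow> 'a \<times> 'a \<Rightarrow> 'k)" where
  "\<sigma> = lext sR (\<lambda>j u v. E 0 1 (u \<cdot> v))"

lemma lin_sigma: "lin sR sR \<sigma>" and sigma_E: "\<sigma> (E j u v) = E 0 1 (u \<cdot> v)"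
  by (simp_all add: \<sigma>_def lin_lext[OF vsR] lext_E[OF vsR])

lemma sigma_Rel: "X \<in> Rel \<Longrightarrow> \<sigma> X \<in> Rel"
  by (erule Rel_map[OF _ lin_sigma])
    (simp_all add: sigma_E modlin_precomp[OF lin_mul_right modlin_E_right]
      modlin_precomp[OF lin_mul_left modlin_E_right])

lemma sigma_mu:
  assumes "X \<in> fbvec r"
  shows "\<sigma> X \<approx> E 0 1 (\<mu> X)"
  by (rule fbvec_cong_mod[OF assms lin_modlin[OF lin_sigma subsp_Rel] modlin_precomp[OF lin_mu modlin_E_right]])
    (simp add: sigma_E mu_E)

lemma mu_sigma: "X \<in> Fin \<Longrightarrow> \<mu> (\<sigma> X) = \<mu> X"
  by (erule Fin_cong[OF _ lin_comp[OF lin_sigma lin_mu] lin_mu]) (simp add: sigma_E mu_E)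

lemma sigma_Rt: "X \<in> Fin \<Longrightarrow> \<sigma> (Rt b X) = Rt b (\<sigma> X)"
  by (erule Fin_cong[OF _ lin_comp[OF lin_Rt lin_sigma] lin_comp[OF lin_sigma lin_Rt]])
    (simp add: sigma_E Rt_E mul_assoc)

lemma sigma_fbvec: "X \<in> fbvec r \<Longrightarrow> \<sigma> X \<in> fbvec 1"
  by (erule fbvec_map[OF _ lin_sigma subsp_fbvec]) (simp add: sigma_E E_fbvec)

lemma base_syzygy: "syzygy 1 (\<lambda>_. 0) {X \<in> fbvec 1. \<mu> X = 0} (\<lambda>X. X - \<sigma> X)"
  unfolding syzygy_def
proof (intro conjI allI ballI)
  let ?Z = "{X \<in> fbvec 1. \<mu> X = 0}"
  have "?Z = fbvec 1 \<inter> {X. \<mu> X \<in> {0}}"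
    by auto
  then show "subsp sR ?Z"
    using VR.subspace_inter[OF subsp_fbvec subsp_vimage[OF lin_mu subsp_zero[OF vsA]]] by simp
  show "Rel \<inter> fbvec 1 \<subseteq> ?Z"
    using mu_Rel by auto
  show "lin sR sR (\<lambda>X. X - \<sigma> X)"
    by (rule lin_minus_lin[OF lin_ident[OF vsR] lin_sigma])
  show "X - \<sigma> X \<in> Rel" if "X \<in> Rel" for X
    by (rule Rel_diff[OF that sigma_Rel[OF that]])
  show "X - \<sigma> X \<in> ?Z" if X: "X \<in> fbvec 1" for X
    using mu_sigma[OF fbvec_Fin[OF X]] fbvec_diff[OF X sigma_fbvec[OF X]]
    by (simp only: mem_Collect_eq lin_diff[OF lin_mu]) simp
  show "Rt b X - \<sigma> (Rt b X) \<approx> Rt b (X - \<sigma> X)" if X: "X \<in> fbvec 1" for b X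
    by (simp add: sigma_Rt[OF fbvec_Fin[OF X]] lin_diff[OF lin_Rt])
  fix X assume "X \<in> ?Z"
  then have X: "X \<in> fbvec 1" and XF: "X \<in> Fin" and mu: "\<mu> X = 0"
    using fbvec_Fin by blast+
  show "L a X \<in> ?Z" for a
    using L_fbvec[OF X] by (simp add: mu_L[OF XF] mu)
  show "Rt b X \<in> ?Z" for b
    using Rt_fbvec[OF X] by (simp add: mu_Rt[OF XF] mu)
  show "H (\<lambda>_. 0) n X \<in> ?Z" for n
    using H_fbvec[OF X] by (simp add: mu_H[OF X] mu lin_zero[OF lin_hcomp])
  have "\<sigma> X \<in> Rel"
    using eqv_mem[OF subsp_Rel subset_refl sigma_mu[OF X]] by (simp add: mu E_zero_right)
  then show "X - \<sigma> X \<approx> X"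
    using Rel_diff[OF Rel_0] by simp
qed simp

text \<open>Since \<open>\<epsilon> (u v) = \<epsilon> (\<epsilon>(v) u)\<close>, reduction carries
  the kernel of \<open>\<mu>\<close> to the augmentation ideal; this is where a resolution of
  \<open>A\<close> becomes one of \<open>K\<close>.\<close>

lemma bar_base: "bar ` {X \<in> fbvec 1. \<mu> X = 0} = {q \<in> fvec 1. \<epsilon> (q 0) = 0}"
proof (intro equalityI subsetI)
  fix q assume "q \<in> bar ` {X \<in> fbvec 1. \<mu> X = 0}"
  then obtain X where X: "X \<in> fbvec 1" "\<mu> X = 0" "q = bar X"
    by blast
  have l0: "lin sQ sA (\<lambda>q. q 0)"
    by (intro linI vsQ vsA) (simp_all add: sQ_def sA_def)
  have "hcomp Agr (bar X 0) 0 = hcomp Agr (\<mu> X) 0"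
    by (rule fbvec_cong[OF X(1) lin_comp[OF lin_comp[OF lin_bar l0] lin_hcomp] lin_comp[OF lin_mu lin_hcomp]])
      (simp add: bar_E mu_E iota_eps[symmetric] eps_sA eps_mul mult.commute)
  then have "\<iota> (\<epsilon> (q 0)) = 0"
    by (simp add: iota_eps X lin_zero[OF lin_hcomp])
  then show "q \<in> {q \<in> fvec 1. \<epsilon> (q 0) = 0}"
    using iota_eq_0 bar_fvec[OF X(1)] X(3) by simp
next
  fix q assume "q \<in> {q \<in> fvec 1. \<epsilon> (q 0) = 0}"
  then have q: "q \<in> fvec 1" "\<epsilon> (q 0) = 0" by simp_all
  \<comment> \<open>Multiplication kills \<open>q \<otimes> 1 - 1 \<otimes> q\<close>, and its
    second term reduces to \<open>\<epsilon>(q) = 0\<close>.\<close>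
  let ?X = "E 0 (q 0) 1 - E 0 1 (q 0)"
  have "bar ?X = q"
    using q by (auto simp: lin_diff[OF lin_bar] bar_E fun_eq_iff fvec_def sA_def)
  moreover have "?X \<in> fbvec 1"
    by (intro fbvec_diff E_fbvec) simp_all
  moreover have "\<mu> ?X = 0"
    by (simp add: lin_diff[OF lin_mu] mu_E)
  ultimately show "q \<in> bar ` {X \<in> fbvec 1. \<mu> X = 0}"
    by (intro image_eqI[of _ _ ?X]) simp_all
qed

lemma base_compare:
  fixes \<pi> :: "(nat \<Rightarrow> 'a) \<Rightarrow> 'k"
  assumes add: "\<forall>v\<in>fvec s. \<forall>w\<in>fvec s. \<pi> (v + w) = \<pi> v + \<pi> w"
    and act: "\<forall>a. \<forall>v\<in>fvec s. \<pi> (aQ a v) = \<epsilon> a * \<pi> v"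
    and surj: "\<pi> ` fvec s = UNIV"
  shows "\<exists>f g u. compare 1 {X \<in> fbvec 1. \<mu> X = 0} s {v \<in> fvec s. \<pi> v = 0} f g u"
proof -
  obtain v1 where v1: "v1 \<in> fvec s" "\<pi> v1 = 1"
    using surj by (metis UNIV_I imageE)
  have \<pi>0: "\<pi> 0 = 0"
    using act[rule_format, OF fvec_0, of 0] by simp
  have \<pi>_sum: "\<pi> (\<Sum>i\<in>I. F i) = (\<Sum>i\<in>I. \<pi> (F i))" if "\<And>i. i \<in> I \<Longrightarrow> F i \<in> fvec s" "finite I" for F and I :: "nat set"
    using that(2,1)
  proof (induction I rule: finite_induct)
    case (insert x I)
    have "\<pi> (sum F (insert x I)) = \<pi> (F x + sum F I)"
      by (simp only: sum.insert[OF insert.hyps])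
    also have "\<dots> = \<pi> (F x) + \<pi> (sum F I)"
      using insert.prems by (intro add[rule_format] fvec_sum) auto
    also have "\<pi> (sum F I) = (\<Sum>i\<in>I. \<pi> (F i))"
      using insert.prems by (intro insert.IH) simp
    finally show ?case
      by (simp only: sum.insert[OF insert.hyps])
  qed (simp add: \<pi>0)
  \<comment> \<open>\<open>?f\<close> lifts \<open>\<pi>\<close> along \<open>\<epsilon>\<close>,
    and \<open>?g\<close> lifts \<open>\<epsilon>\<close> along \<open>\<pi>\<close> by means of a
    vector of value 1. In degree 0 there is no homotopy term, so \<open>u\<close> is
    \<open>1 - f g\<close>.\<close>
  let ?c = "\<lambda>j. aQ (\<iota> (\<pi> (ue j))) (ue 0)"
  let ?f = "lcomb s ?c"
  let ?g = "\<lambda>q. aQ (q 0) v1"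
  have f: "llin s 1 ?f"
    by (intro llin_lcomb fvec_aQ ue_fvec) simp
  have g: "llin 1 s ?g"
    by (rule llinI, rule fvec_aQ[OF v1(1)]) (auto simp: aQ_def mul_add_left mul_assoc fun_eq_iff)
  have eps_f: "\<epsilon> (?f v 0) = \<pi> v" if v: "v \<in> fvec s" for v
  proof -
    have "\<epsilon> (sum F I) = (\<Sum>i\<in>I. \<epsilon> (F i))" for F and I :: "nat set"
      by (induction I rule: infinite_finite_induct) (simp_all add: eps_add)
    then have "\<epsilon> (?f v 0) = (\<Sum>j<s. \<epsilon> (v j) * \<pi> (ue j))"
      by (simp add: lcomb_def sum_fun_apply aQ_def ue_def eps_mul)
    also have "\<dots> = (\<Sum>j<s. \<pi> (aQ (v j) (ue j)))"
      using act by (intro sum.cong) (auto simp: ue_fvec)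
    also have "\<dots> = \<pi> (\<Sum>j<s. aQ (v j) (ue j))"
      by (rule \<pi>_sum[symmetric]) (auto intro: fvec_aQ ue_fvec)
    finally show ?thesis
      using fvec_expand[OF v] by simp
  qed
  have \<pi>_g: "\<pi> (?g q) = \<epsilon> (q 0)" for q
    using act v1 by simp
  have "compare 1 {X \<in> fbvec 1. \<mu> X = 0} s {v \<in> fvec s. \<pi> v = 0} ?f ?g (\<lambda>q. q - ?f (?g q))"
    unfolding compare_def bar_base
  proof (intro conjI ballI)
    show "llin s 1 ?f" "llin 1 s ?g"
      by (fact f g)+
    show u: "llin 1 1 (\<lambda>q. q - ?f (?g q))"
      by (intro llin_sub llin_ident llin_comp[OF g f])
    show "?f v \<in> {q \<in> fvec 1. \<epsilon> (q 0) = 0}" if "v \<in> {v \<in> fvec s. \<pi> v = 0}" for v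
      using that llin_mem[OF f] eps_f by simp
    show "?g q \<in> {v \<in> fvec s. \<pi> v = 0}" if "q \<in> {q \<in> fvec 1. \<epsilon> (q 0) = 0}" for q
      using that llin_mem[OF g, of q] \<pi>_g[of q] by simp
    show "q - ?f (?g q) \<in> {q \<in> fvec 1. \<epsilon> (q 0) = 0}" if q: "q \<in> fvec 1" for q
      using llin_mem[OF u q] eps_f[OF llin_mem[OF g q]] \<pi>_g[of q] by (simp add: eps_diff)
  qed simp
  then show ?thesis by (intro exI)
qed

section \<open>Assembling the bimodule resolution\<close>

lemma resolution_exists:
  fixes \<pi> :: "(nat \<Rightarrow> 'a) \<Rightarrow> 'k" and rP :: "nat \<Rightarrow> nat"
  assumes add: "\<forall>v\<in>fvec (rP 0). \<forall>w\<in>fvec (rP 0). \<pi> (v + w) = \<pi> v + \<pi> w"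
    and act: "\<forall>a. \<forall>v\<in>fvec (rP 0). \<pi> (aQ a v) = \<epsilon> a * \<pi> v"
    and surj: "\<pi> ` fvec (rP 0) = UNIV"
    and lin: "\<forall>i. 1 \<le> i \<and> i \<le> n \<longrightarrow> llin (rP i) (rP (i - 1)) (d i)"
    and ex0: "1 \<le> n \<longrightarrow> d 1 ` fvec (rP 1) = {v \<in> fvec (rP 0). \<pi> v = 0}"
    and ex: "\<forall>i. 1 \<le> i \<and> i < n \<longrightarrow> d (i + 1) ` fvec (rP (i + 1)) = {v \<in> fvec (rP i). d i v = 0}"
  shows "\<exists>(r :: nat \<Rightarrow> nat) z. r 0 = 1 \<and> (\<forall>i j. 1 \<le> i \<and> i \<le> n \<longrightarrow> z i j \<in> fbvec (r (i - 1))) \<and>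
    (1 \<le> n \<longrightarrow> (\<forall>X\<in>fbvec (r 0). \<mu> X = 0 \<longleftrightarrow> (\<exists>Y\<in>fbvec (r 1). D (z 1) Y \<approx> X))) \<and>
    (\<forall>i. 1 \<le> i \<and> i < n \<longrightarrow> (\<forall>X\<in>fbvec (r i).
       D (z i) X \<in> Rel \<longleftrightarrow> (\<exists>Y\<in>fbvec (r (i + 1)). D (z (i + 1)) Y \<approx> X)))"
proof -
  \<comment> \<open>In degree 0 the outgoing map of \<open>P\<close> is the augmentation
    \<open>\<pi>\<close>, not \<open>d 0\<close>.\<close>
  define ZP where "ZP i = {v \<in> fvec (rP i). if i = 0 then \<pi> v = 0 else d i v = 0}" for i
  have step_d: "llin (rP (Suc i)) (rP i) (d (Suc i))" "d (Suc i) ` fvec (rP (Suc i)) = ZP i" if "i < n" for i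
  proof -
    show "llin (rP (Suc i)) (rP i) (d (Suc i))"
      using lin[rule_format, of "Suc i"] that by simp
    show "d (Suc i) ` fvec (rP (Suc i)) = ZP i"
      using ex0 ex[rule_format, of i] that by (cases "i = 0") (simp_all add: ZP_def)
  qed
  \<comment> \<open>A state holds the rank, the kernel, and the images of the generators under the
    outgoing differential. Degrees, projector and comparison maps are only asserted to exist. Past
    \<open>n\<close> no data of \<open>P\<close> remain, and \<open>P\<close> and \<open>Q\<close>
    hold vacuously, so dummy states continue the sequence.\<close>
  define P where "P i x \<longleftrightarrow> (case x of (r, Z, z) \<Rightarrow> i \<le> n \<longrightarrow>
      (\<exists>\<delta> p f g u. syzygy r \<delta> Z p \<and> compare r Z (rP i) (ZP i) f g u) \<and>
      (i = 0 \<longrightarrow> r = 1 \<and> Z = {X \<in> fbvec 1. \<mu> X = 0}))"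
    for i and x :: "nat \<times> (nat \<Rightarrow> 'a \<times> 'a \<Rightarrow> 'k) set \<times> (nat \<Rightarrow> nat \<Rightarrow> 'a \<times> 'a \<Rightarrow> 'k)"
  define Q where "Q i x y \<longleftrightarrow> (case x of (r, Z, z) \<Rightarrow> case y of (r', Z', z') \<Rightarrow> i < n \<longrightarrow>
      (\<forall>j. z' j \<in> Z) \<and> Z \<subseteq> gen r' z' \<and> Z' = {X \<in> fbvec r'. D z' X \<in> Rel})"
    for i and x y :: "nat \<times> (nat \<Rightarrow> 'a \<times> 'a \<Rightarrow> 'k) set \<times> (nat \<Rightarrow> nat \<Rightarrow> 'a \<times> 'a \<Rightarrow> 'k)"
  have "\<exists>F. \<forall>i. P i (F i) \<and> Q i (F i) (F (Suc i))"
  proof (rule dependent_nat_choice)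
    obtain f g u where "compare 1 {X \<in> fbvec 1. \<mu> X = 0} (rP 0) {v \<in> fvec (rP 0). \<pi> v = 0} f g u"
      using base_compare[OF add act surj] by (elim exE)
    then have "P 0 (1, {X \<in> fbvec 1. \<mu> X = 0}, undefined)"
      using base_syzygy by (auto simp: P_def ZP_def)
    then show "\<exists>x. P 0 x" by (rule exI)
  next
    fix x i assume Px: "P i x"
    obtain r Z z where x: "x = (r, Z, z)" by (cases x)
    show "\<exists>y. P (Suc i) y \<and> Q i x y"
    proof (cases "i < n")
      case True
      then obtain \<delta> p f g u where "syzygy r \<delta> Z p" "compare r Z (rP i) (ZP i) f g u"
        using Px by (auto simp: P_def x)
      from next_stage[OF this step_d[OF True]] obtain m z' \<delta>' p' f' g' u' where
        y: "\<forall>j. z' j \<in> Z" "Z \<subseteq> gen m z'"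
        "syzygy m \<delta>' {X \<in> fbvec m. D z' X \<in> Rel} p'"
        "compare m {X \<in> fbvec m. D z' X \<in> Rel} (rP (Suc i)) {v \<in> fvec (rP (Suc i)). d (Suc i) v = 0} f' g' u'"
        by (elim exE conjE) (rule that)
      have "{v \<in> fvec (rP (Suc i)). d (Suc i) v = 0} = ZP (Suc i)"
        by (simp add: ZP_def)
      then have "\<exists>\<delta> p f g u. syzygy m \<delta> {X \<in> fbvec m. D z' X \<in> Rel} p \<and>
          compare m {X \<in> fbvec m. D z' X \<in> Rel} (rP (Suc i)) (ZP (Suc i)) f g u"
        using y(3,4) by (intro exI conjI) (simp_all only:)
      then have "P (Suc i) (m, {X \<in> fbvec m. D z' X \<in> Rel}, z')"
        by (simp add: P_def)
      moreover have "Q i x (m, {X \<in> fbvec m. D z' X \<in> Rel}, z')"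
        using y(1,2) by (simp add: Q_def x)
      ultimately show ?thesis by (intro exI conjI)
    next
      case False
      then have "P (Suc i) (0, {}, undefined) \<and> Q i x (0, {}, undefined)"
        by (simp add: P_def Q_def x)
      then show ?thesis by (rule exI)
    qed
  qed
  then obtain F where F: "\<And>i. P i (F i)" "\<And>i. Q i (F i) (F (Suc i))"
    by blast
  define r where "r i = fst (F i)" for i
  define Z where "Z i = fst (snd (F i))" for i
  define z where "z i = snd (snd (F i))" for i
  have FF: "F i = (r i, Z i, z i)" for i
    by (simp add: r_def Z_def z_def)
  have PF: "\<exists>\<delta> p. syzygy (r i) \<delta> (Z i) p" if "i \<le> n" for i
    using F(1)[of i] that by (auto simp: P_def FF)
  have P0: "r 0 = 1" "Z 0 = {X \<in> fbvec 1. \<mu> X = 0}"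
    using F(1)[of 0] by (auto simp: P_def FF)
  have QF: "z (Suc i) j \<in> Z i" "Z i \<subseteq> gen (r (Suc i)) (z (Suc i))"
    "Z (Suc i) = {X \<in> fbvec (r (Suc i)). D (z (Suc i)) X \<in> Rel}" if "i < n" for i j
    using F(2)[of i] that by (auto simp: Q_def FF)
  have exact: "X \<in> Z i \<longleftrightarrow> (\<exists>Y\<in>fbvec (r (Suc i)). D (z (Suc i)) Y \<approx> X)" if i: "i < n" and X: "X \<in> fbvec (r i)" for i X
  proof
    assume "X \<in> Z i"
    then show "\<exists>Y\<in>fbvec (r (Suc i)). D (z (Suc i)) Y \<approx> X"
      using QF(2)[OF i] unfolding gen_def by blast
  next
    assume "\<exists>Y\<in>fbvec (r (Suc i)). D (z (Suc i)) Y \<approx> X"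
    then obtain Y where Y: "Y \<in> fbvec (r (Suc i))" "D (z (Suc i)) Y \<approx> X" by blast
    obtain \<delta> p where "syzygy (r i) \<delta> (Z i) p"
      using PF[of i] i by auto
    note p = syzygyD[OF this]
    have DY: "D (z (Suc i)) Y \<in> Z i"
      by (rule D_mem[OF Y(1) p(1) QF(1)[OF i]]) (auto intro: p(4,5))
    \<comment> \<open>\<open>Z i\<close> absorbs only those relations that lie in the free bimodule
      of rank \<open>r i\<close>, so the difference must be shown to be in
      \<open>fbvec (r i)\<close>.\<close>
    have "D (z (Suc i)) Y - X \<in> Z i"
      by (rule p(3)[OF Y(2) fbvec_diff[OF p(2)[OF DY] X]])
    from subsp_diff[OF vsR p(1) DY this] show "X \<in> Z i" by simp
  qed
  show ?thesis
  proof (intro exI[of _ r] exI[of _ z] conjI allI impI ballI)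
    show "r 0 = 1" by (fact P0(1))
    show "z i j \<in> fbvec (r (i - 1))" if i: "1 \<le> i \<and> i \<le> n" for i j
    proof -
      obtain k where k: "i = Suc k" "k < n"
        using i by (cases i) auto
      obtain \<delta> p where "syzygy (r k) \<delta> (Z k) p"
        using PF[of k] k by auto
      then show ?thesis
        using syzygy_fbvec QF(1)[OF k(2)] k(1) by simp
    qed
    show "\<mu> X = 0 \<longleftrightarrow> (\<exists>Y\<in>fbvec (r 1). D (z 1) Y \<approx> X)" if "1 \<le> n" "X \<in> fbvec (r 0)" for X
      using exact[of 0 X] that P0 by simp
    show "D (z i) X \<in> Rel \<longleftrightarrow> (\<exists>Y\<in>fbvec (r (i + 1)). D (z (i + 1)) Y \<approx> X)"
      if i: "1 \<le> i \<and> i < n" and X: "X \<in> fbvec (r i)" for i X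
    proof -
      obtain k where k: "i = Suc k" "k < n"
        using i by (cases i) auto
      have "D (z i) X \<in> Rel \<longleftrightarrow> X \<in> Z i"
        using QF(3)[OF k(2)] X k(1) by simp
      then show ?thesis
        using exact[of i X] i X by simp
    qed
  qed
qed

section \<open>Translation to the notions of the statement\<close>

lemma tequiv_iff:
  assumes "X \<in> Fin" "Y \<in> Fin"
  shows "tequiv \<iota> X Y \<longleftrightarrow> X \<approx> Y"
  using subsp_diff[OF vsR subsp_Fin assms] by (simp add: tequiv_def Rel_def fun_diff_def)

text \<open>On finite supports \<open>push\<close> is linear, hence determined by its values on
  symbols.\<close>

lemma push_eq_lin:
  assumes G: "lin sR sR G" "\<And>j u v. G (E j u v) = unitvec j (h (T u v))" and X: "X \<in> Fin"
  shows "(\<lambda>i. push h (X i)) = G X"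
proof -
  obtain r where r: "X \<in> fbvec r"
    using X by (auto simp: Fin_def)
  let ?S = "{X \<in> fbvec r. (\<lambda>i. push h (X i)) = G X}"
  have "X \<in> ?S"
  proof (rule fbvec_induct[OF r])
    show "subsp sR ?S"
    proof (rule subspI[OF vsR])
      show "0 \<in> ?S"
        by (auto simp: fbvec_0 lin_zero[OF G(1)] push_def fun_eq_iff)
      show "X + Y \<in> ?S" if XY: "X \<in> ?S" "Y \<in> ?S" for X Y
      proof -
        have "push h ((X + Y) i) = push h (X i) + push h (Y i)" for i
          using XY by (simp add: push_add fbvec_def)
        moreover have "push h (X i) = G X i" "push h (Y i) = G Y i" for i
          using XY by (auto dest: fun_cong[of _ _ i])
        ultimately have "(\<lambda>i. push h ((X + Y) i)) = G (X + Y)"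
          by (simp add: lin_add[OF G(1)] fun_eq_iff)
        then show ?thesis
          using XY fbvec_add by blast
      qed
      show "sR k X \<in> ?S" if X: "X \<in> ?S" for k X
      proof -
        have "push h (X i) = G X i" for i
          using X by (auto dest: fun_cong[of _ _ i])
        then have "(\<lambda>i. push h (sR k X i)) = G (sR k X)"
          by (simp only: lin_scale[OF G(1)]) (simp add: sR_def push_scale)
        then show ?thesis
          using X fbvec_scale by blast
      qed
    qed
    show "E j u v \<in> ?S" if "j < r" for j u v
    proof -
      have "push h (E j u v i) = unitvec j (h (T u v)) i" for i
        by (cases "i = j") (auto simp: E_def unitvec_def push_point, auto simp: push_def)
      then show ?thesis
        using E_fbvec[OF that] by (simp add: G(2))
    qed
  qed
  then show ?thesis by simp
qed

text \<open>For the opposite multiplication \<open>L\<close> is the right action and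
  \<open>Rt\<close> the left one. Being bi-\<open>FP_n\<close> is symmetric in the two actions, so
  one construction yields both halves of the theorem.\<close>

lemma bimodule_actions:
  "mul = (*) \<and> (\<forall>a. \<forall>X\<in>Fin. fblact a X = L a X \<and> fbract X a = Rt a X) \<or>
    mul = (\<lambda>x y. y * x) \<and> (\<forall>a. \<forall>X\<in>Fin. fblact a X = Rt a X \<and> fbract X a = L a X)"
  using side
proof (elim disjE conjE)
  assume m: "mul = (*)" and T: "T = Pair"
  have 1: "T (a \<cdot> u) v = (case T u v of (u, v) \<Rightarrow> (a * u, v))"
    and 2: "T u (v \<cdot> a) = (case T u v of (u, v) \<Rightarrow> (u, v * a))" for a u v
    by (simp_all add: m T)
  have "fblact a X = L a X \<and> fbract X a = Rt a X" if "X \<in> Fin" for a X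
    unfolding fblact_def fbract_def
    by (intro conjI push_eq_lin[OF lin_L _ that] push_eq_lin[OF lin_Rt _ that])
      (simp_all only: L_E Rt_E, simp_all only: E_def 1 2)
  then show ?thesis
    using m by blast
next
  assume m: "mul = (\<lambda>x y. y * x)" and T: "T = (\<lambda>u v. (v, u))"
  have 1: "T (a \<cdot> u) v = (case T u v of (u, v) \<Rightarrow> (u, v * a))"
    and 2: "T u (v \<cdot> a) = (case T u v of (u, v) \<Rightarrow> (a * u, v))" for a u v
    by (simp_all add: m T)
  have "fblact a X = Rt a X \<and> fbract X a = L a X" if "X \<in> Fin" for a X
    unfolding fblact_def fbract_def
    by (intro conjI push_eq_lin[OF lin_L _ that] push_eq_lin[OF lin_Rt _ that])
      (simp_all only: L_E Rt_E, simp_all only: E_def 1 2)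
  then show ?thesis
    using m by blast
qed

lemma bimod_hom_D:
  assumes z: "\<And>j. z j \<in> fbvec s"
  shows "bimod_hom \<iota> r s (D z)"
  unfolding bimod_hom_def
proof (intro conjI ballI allI impI)
  have zF: "z j \<in> Fin" for j
    using fbvec_Fin[OF z] .
  have refl: "tequiv \<iota> X X" for X
    using tr_zero[of \<iota>] by (simp add: tequiv_def)
  show DX: "D z X \<in> fbvec s" if "X \<in> fbvec r" for X
    by (rule D_fbvec[OF z that])
  show "tequiv \<iota> (D z X) (D z Y)" if "X \<in> fbvec r" "Y \<in> fbvec r" "tequiv \<iota> X Y" for X Y
    using lin_eqv[OF lin_D D_Rel[where z = z, OF zF], of X Y] that(3)
    unfolding tequiv_iff[OF fbvec_Fin[OF that(1)] fbvec_Fin[OF that(2)]]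
      tequiv_iff[OF fbvec_Fin[OF DX[OF that(1)]] fbvec_Fin[OF DX[OF that(2)]]] by blast
  show "tequiv \<iota> (D z (fbadd X Y)) (fbadd (D z X) (D z Y))" for X Y
  proof -
    have fbadd: "fbadd U V = U + V" for U V :: "nat \<Rightarrow> 'a \<times> 'a \<Rightarrow> 'k"
      by (simp add: fbadd_def fun_eq_iff)
    show ?thesis
      unfolding fbadd lin_add[OF lin_D] by (rule refl)
  qed
  have "D z (fblact a X) = fblact a (D z X)" "D z (fbract X a) = fbract (D z X) a" if X: "X \<in> fbvec r" for a X
    using bimodule_actions fbvec_Fin[OF X] fbvec_Fin[OF DX[OF X]]
      D_L[where z = z, OF zF fbvec_Fin[OF X]] D_Rt[where z = z, OF zF fbvec_Fin[OF X]]
    by (elim disjE conjE; simp only: Ball_def)+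
  then show "tequiv \<iota> (D z (fblact a X)) (fblact a (D z X))" "tequiv \<iota> (D z (fbract X a)) (fbract (D z X) a)"
    if "X \<in> fbvec r" for a X
    using that refl by (simp_all only:)
qed

lemma bi_FP_if_resolution:
  fixes \<pi> :: "(nat \<Rightarrow> 'a) \<Rightarrow> 'k" and rP :: "nat \<Rightarrow> nat"
  assumes "\<forall>v\<in>fvec (rP 0). \<forall>w\<in>fvec (rP 0). \<pi> (v + w) = \<pi> v + \<pi> w"
    and "\<forall>a. \<forall>v\<in>fvec (rP 0). \<pi> (aQ a v) = \<epsilon> a * \<pi> v"
    and "\<pi> ` fvec (rP 0) = UNIV"
    and "\<forall>i. 1 \<le> i \<and> i \<le> n \<longrightarrow> llin (rP i) (rP (i - 1)) (d i)"
    and "1 \<le> n \<longrightarrow> d 1 ` fvec (rP 1) = {v \<in> fvec (rP 0). \<pi> v = 0}"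
    and "\<forall>i. 1 \<le> i \<and> i < n \<longrightarrow> d (i + 1) ` fvec (rP (i + 1)) = {v \<in> fvec (rP i). d i v = 0}"
  shows "bi_FP \<iota> n"
proof -
  from resolution_exists[OF assms] obtain r :: "nat \<Rightarrow> nat" and z where
    r0: "r 0 = 1" and z: "\<forall>i j. 1 \<le> i \<and> i \<le> n \<longrightarrow> z i j \<in> fbvec (r (i - 1))"
    and ex0: "1 \<le> n \<longrightarrow> (\<forall>X\<in>fbvec (r 0). \<mu> X = 0 \<longleftrightarrow> (\<exists>Y\<in>fbvec (r 1). D (z 1) Y \<approx> X))"
    and ex: "\<forall>i. 1 \<le> i \<and> i < n \<longrightarrow> (\<forall>X\<in>fbvec (r i).
       D (z i) X \<in> Rel \<longleftrightarrow> (\<exists>Y\<in>fbvec (r (i + 1)). D (z (i + 1)) Y \<approx> X))"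
    by (elim exE conjE) (rule that)
  have DF: "D (z i) X \<in> Fin" if "1 \<le> i" "i \<le> n" "X \<in> fbvec (r i)" for i X
    using D_fbvec[where z = "z i" and s = "r (i - 1)", OF _ that(3)] z that fbvec_Fin by blast
  show ?thesis
    unfolding bi_FP_def
  proof (rule exI[of _ r], rule exI[of _ "\<lambda>i. D (z i)"], rule exI[of _ \<mu>],
      intro conjI ballI allI impI)
    show "\<mu> X = \<mu> Y" if "X \<in> fbvec (r 0)" "Y \<in> fbvec (r 0)" "tequiv \<iota> X Y" for X Y
      using mu_Rel[of "X - Y"] that(3)
      unfolding tequiv_iff[OF fbvec_Fin[OF that(1)] fbvec_Fin[OF that(2)]] lin_diff[OF lin_mu] by simp
    show "\<mu> (fbadd X Y) = \<mu> X + \<mu> Y" for X Y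
    proof -
      have "fbadd X Y = X + Y"
        by (simp add: fbadd_def fun_eq_iff)
      then show ?thesis
        by (simp only: lin_add[OF lin_mu])
    qed
    show "\<mu> (fblact a X) = a * \<mu> X" "\<mu> (fbract X a) = \<mu> X * a" if X: "X \<in> fbvec (r 0)" for a X
      using bimodule_actions fbvec_Fin[OF X] mu_L[OF fbvec_Fin[OF X], of a] mu_Rt[OF fbvec_Fin[OF X], of a]
      by (elim disjE conjE; simp)+
    show "\<mu> ` fbvec (r 0) = UNIV"
    proof -
      have "a \<in> \<mu> ` fbvec (r 0)" for a
        by (rule image_eqI[of _ _ "E 0 a 1"]) (simp_all add: mu_E E_fbvec r0)
      then show ?thesis by blast
    qed
    show "bimod_hom \<iota> (r i) (r (i - 1)) (D (z i))" if "1 \<le> i \<and> i \<le> n" for i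
      using z that by (intro bimod_hom_D) blast
    show "\<mu> X = 0 \<longleftrightarrow> (\<exists>Y\<in>fbvec (r 1). tequiv \<iota> (D (z 1) Y) X)" if "1 \<le> n" and X: "X \<in> fbvec (r 0)" for X
      using ex0 that DF[of 1] tequiv_iff[OF _ fbvec_Fin[OF X]] by simp
    show "tequiv \<iota> (D (z i) X) (\<lambda>_ _. 0) \<longleftrightarrow> (\<exists>Y\<in>fbvec (r (i + 1)). tequiv \<iota> (D (z (i + 1)) Y) X)"
      if i: "1 \<le> i \<and> i < n" and X: "X \<in> fbvec (r i)" for i X
    proof -
      have "(\<lambda>_ _. 0) = (0 :: nat \<Rightarrow> 'a \<times> 'a \<Rightarrow> 'k)"
        by (simp add: fun_eq_iff)
      then have "tequiv \<iota> (D (z i) X) (\<lambda>_ _. 0) \<longleftrightarrow> D (z i) X \<in> Rel"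
        using tequiv_iff[OF DF[of i X] subsp_0[OF vsR subsp_Fin]] i X by simp
      also have "\<dots> \<longleftrightarrow> (\<exists>Y\<in>fbvec (r (i + 1)). D (z (i + 1)) Y \<approx> X)"
        using ex i X by blast
      also have "\<dots> \<longleftrightarrow> (\<exists>Y\<in>fbvec (r (i + 1)). tequiv \<iota> (D (z (i + 1)) Y) X)"
        using DF[of "i + 1"] tequiv_iff[OF _ fbvec_Fin[OF X]] i by simp
      finally show ?thesis .
    qed
  qed
qed

end

theorem theorem4:
  fixes \<iota> :: "'k::field \<Rightarrow> 'a::ring_1" and Agr :: "nat \<Rightarrow> 'a set" and n :: nat
  assumes "connected_graded_algebra \<iota> Agr"
    and "left_FP \<iota> Agr n \<or> right_FP \<iota> Agr n"
  shows "bi_FP \<iota> n"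
  using assms(2)
proof
  assume "left_FP \<iota> Agr n"
  interpret conn_alg \<iota> Agr "(*)" Pair
    using assms(1) by unfold_locales simp_all
  have "\<exists>r d \<pi>. (\<forall>v\<in>fvec (r 0). \<forall>w\<in>fvec (r 0). \<pi> (v + w) = \<pi> v + \<pi> w) \<and>
     (\<forall>a. \<forall>v\<in>fvec (r 0). \<pi> (aQ a v) = \<epsilon> a * \<pi> v) \<and> \<pi> ` fvec (r 0) = UNIV \<and>
     (\<forall>i. 1 \<le> i \<and> i \<le> n \<longrightarrow> llin (r i) (r (i - 1)) (d i)) \<and>
     (1 \<le> n \<longrightarrow> d 1 ` fvec (r 1) = {v \<in> fvec (r 0). \<pi> v = 0}) \<and>
     (\<forall>i. 1 \<le> i \<and> i < n \<longrightarrow> d (i + 1) ` fvec (r (i + 1)) = {v \<in> fvec (r i). d i v = 0})"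
    using \<open>left_FP \<iota> Agr n\<close>
    unfolding left_FP_def left_lin_def llin_def aQ_def plus_fun_def zero_fun_def .
  then show ?thesis
    by (elim exE conjE) (rule bi_FP_if_resolution)
next
  assume "right_FP \<iota> Agr n"
  interpret conn_alg \<iota> Agr "\<lambda>x y. y * x" "\<lambda>u v. (v, u)"
    using assms(1) by unfold_locales simp_all
  have "\<exists>r d \<pi>. (\<forall>v\<in>fvec (r 0). \<forall>w\<in>fvec (r 0). \<pi> (v + w) = \<pi> v + \<pi> w) \<and>
     (\<forall>a. \<forall>v\<in>fvec (r 0). \<pi> (aQ a v) = \<pi> v * \<epsilon> a) \<and> \<pi> ` fvec (r 0) = UNIV \<and>
     (\<forall>i. 1 \<le> i \<and> i \<le> n \<longrightarrow> llin (r i) (r (i - 1)) (d i)) \<and>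
     (1 \<le> n \<longrightarrow> d 1 ` fvec (r 1) = {v \<in> fvec (r 0). \<pi> v = 0}) \<and>
     (\<forall>i. 1 \<le> i \<and> i < n \<longrightarrow> d (i + 1) ` fvec (r (i + 1)) = {v \<in> fvec (r i). d i v = 0})"
    using \<open>right_FP \<iota> Agr n\<close>
    unfolding right_FP_def right_lin_def llin_def aQ_def plus_fun_def zero_fun_def .
  \<comment> \<open>The values \<open>\<pi> v\<close> and \<open>\<epsilon> a\<close> lie in the
    field, so the order in which \<open>right_FP\<close> multiplies them is immaterial.\<close>
  then show ?thesis
    by (elim exE conjE) (rule bi_FP_if_resolution, simp_all only: mult.commute[of "\<epsilon> _"])
qed

end
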